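(* Let $q=1$ or $q=2$. Let $\xi$ be a translation invariant measurable $[0,\infty)$-valued functional $\xi(x;\mathcal{X})$ (defined for locally finite $\mathcal{X}\subset\mathbb{R}^d$ and $x\in\mathcal{X}$), and let $X_1,X_2,\ldots$ be i.i.d. random $d$-vectors with common (arbitrary) probability density $f$ on $\mathbb{R}^d$, with $\mathcal{X}_n=\{X_1,\ldots,X_n\}$. Suppose that for all $\tau\in(0,\infty)$, $\xi$ is almost surely stabilizing on $\mathcal{P}_\tau$, with limit $\xi_\infty(\mathcal{P}_\tau)$. If $\xi$ satisfies the moments condition $$\sup_{n\in\mathbb{N}} E\left[\xi(n^{1/d}X_1;n^{1/d}\mathcal{X}_n)^p\right]<\infty$$ for some $p>q$, then as $n\to\infty$, $$n^{-1}H_{\xi_n}(\mathcal{X}_n)\to\int_{\mathbb{R}^d}E[\xi_\infty(\mathcal{P}_{f(x)})]\,f(x)\,dx\quad\text{in }L^q .$$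
   Context: Here $\mathbb{R}^d$ carries the Euclidean norm $|\cdot|$, $B(x;r)=\{y\in\mathbb{R}^d:|y-x|\le r\}$, and $\mathbf{0}$ is the origin. For $\mathcal{X}\subset\mathbb{R}^d$, $a>0$, $y\in\mathbb{R}^d$: $a\mathcal{X}=\{ax:x\in\mathcal{X}\}$, $y+\mathcal{X}=\{y+x:x\in\mathcal{X}\}$. $\mathcal{X}$ is locally finite if it has finitely many points in any bounded region. $\xi(x;\mathcal{X})$ is a measurable $[0,\infty)$-valued function of pairs $(x,\mathcal{X})$ with $\mathcal{X}\subset\mathbb{R}^d$ locally finite and $x\in\mathcal{X}$; if $x\notin\mathcal{X}$, $\xi(x;\mathcal{X})$ abbreviates $\xi(x;\mathcal{X}\cup\{x\})$. $\xi$ is translation invariant if $\xi(y+x;y+\mathcal{X})=\xi(x;\mathcal{X})$ for all $y\in\mathbb{R}^d$ and all $x,\mathcal{X}$. For finite $\mathcal{X}$, $H_\xi(\mathcal{X})=\sum_{x\in\mathcal{X}}\xi(x;\mathcal{X})$. Define $\xi_n(x;\mathcal{X})=\xi(n^{1/d}x;n^{1/d}\mathcal{X})$, so $H_{\xi_n}(\mathcal{X}_n)=\sum_{i=1}^n\xi(n^{1/d}X_i;n^{1/d}\mathcal{X}_n)$. Stabilization: for locally finite $\mathcal{S}\subset\mathbb{R}^d$ and $m\in\mathbb{N}$ let $$\overline{\xi}(\mathcal{S};m)=\sup_{n\in\mathbb{N}}\Big(\operatorname{ess\,sup}_{m,n}\{\xi(\mathbf{0};(\mathcal{S}\cap B(\mathbf{0};m))\cup\mathcal{A})\}\Big),\quad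 \underline{\xi}(\mathcal{S};m)=\inf_{n\in\mathbb{N}}\Big(\operatorname{ess\,inf}_{m,n}\{\xi(\mathbf{0};(\mathcal{S}\cap B(\mathbf{0};m))\cup\mathcal{A})\}\Big),$$ where $\operatorname{ess\,sup}_{m,n}$ (resp. $\operatorname{ess\,inf}_{m,n}$) is the essential supremum (resp. infimum), with respect to Lebesgue measure on $\mathbb{R}^{dn}$, over sets $\mathcal{A}\subset\mathbb{R}^d\setminus B(\mathbf{0};m)$ of cardinality $n$. The limit of $\xi$ on $\mathcal{S}$ is $\xi_\infty(\mathcal{S})=\limsup_{m\to\infty}\overline{\xi}(\mathcal{S};m)$. $\xi$ stabilizes on $\mathcal{S}$ if $\lim_{m\to\infty}\overline{\xi}(\mathcal{S};m)=\lim_{m\to\infty}\underline{\xi}(\mathcal{S};m)=\xi_\infty(\mathcal{S})$. $\mathcal{P}_\tau$ is a homogeneous Poisson point process of intensity $\tau$ on $\mathbb{R}^d$. In the limiting integral $E[\xi_\infty(\mathcal{P}_{f(x)})]$ is evaluated with $x$ fixed, and the integrand is read as $0$ where $f(x)=0$. *)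

theory Defs
  imports "HOL-Probability.Probability"
begin

definition locally_finite :: "'a::euclidean_space set \<Rightarrow> bool" where
  "locally_finite S \<longleftrightarrow> (\<forall>B. bounded B \<longrightarrow> finite (S \<inter> B))"

text \<open>The space of locally finite point sets carries the \<open>\<sigma>\<close>-algebra generated by the counts of
  points in bounded Borel sets.\<close>

definition point_sets :: "'a::euclidean_space set measure" where
  "point_sets = sigma {S. locally_finite S}
     {{S. locally_finite S \<and> card (S \<inter> B) = k} | B k. B \<in> sets borel \<and> bounded B}"

text \<open>The values of \<open>\<xi>\<close> matter only at pairs \<open>(x, S)\<close> with \<open>S\<close> locally finite and \<open>x \<in> S\<close>.\<close>

definition measurable_functional :: "('a::euclidean_space \<Rightarrow> 'a set \<Rightarrow> real) \<Rightarrow> bool" where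
  "measurable_functional \<xi> \<longleftrightarrow>
     (\<lambda>(x, S). \<xi> x S) \<in> borel_measurable (restrict_space (borel \<Otimes>\<^sub>M point_sets) {(x, S). x \<in> S})"

definition nonneg_functional :: "('a::euclidean_space \<Rightarrow> 'a set \<Rightarrow> real) \<Rightarrow> bool" where
  "nonneg_functional \<xi> \<longleftrightarrow> (\<forall>S x. locally_finite S \<longrightarrow> x \<in> S \<longrightarrow> 0 \<le> \<xi> x S)"

definition translation_invariant :: "('a::euclidean_space \<Rightarrow> 'a set \<Rightarrow> real) \<Rightarrow> bool" where
  "translation_invariant \<xi> \<longleftrightarrow>
     (\<forall>S x y. locally_finite S \<longrightarrow> x \<in> S \<longrightarrow> \<xi> (y + x) ((+) y ` S) = \<xi> x S)"

text \<open>The convention that \<open>\<xi>(x; S)\<close> abbreviates \<open>\<xi>(x; S \<union> {x})\<close> when \<open>x \<notin> S\<close>.\<close>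

definition eval_at :: "('a::euclidean_space \<Rightarrow> 'a set \<Rightarrow> real) \<Rightarrow> 'a \<Rightarrow> 'a set \<Rightarrow> real" where
  "eval_at \<xi> x S = \<xi> x (insert x S)"

definition total_functional :: "('a::euclidean_space \<Rightarrow> 'a set \<Rightarrow> real) \<Rightarrow> 'a set \<Rightarrow> real" where
  "total_functional \<xi> S = (\<Sum>x\<in>S. eval_at \<xi> x S)"

definition rescaled :: "('a::euclidean_space \<Rightarrow> 'a set \<Rightarrow> real) \<Rightarrow> nat \<Rightarrow> 'a \<Rightarrow> 'a set \<Rightarrow> real" where
  "rescaled \<xi> n x S =
     (let c = real n powr (1 / real DIM('a)) in eval_at \<xi> (c *\<^sub>R x) ((*\<^sub>R) c ` S))"

text \<open>The counterpart of \<^const>\<open>esssup\<close>; like there, a non-measurable function gets a junk value.\<close>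

definition essinf ::
    "'a measure \<Rightarrow> ('a \<Rightarrow> 'b::{second_countable_topology, dense_linorder, linorder_topology, complete_linorder}) \<Rightarrow> 'b" where
  "essinf M f = (if f \<in> borel_measurable M then Liminf (ae_filter M) f else bot)"

text \<open>Subsets of cardinality \<open>n\<close> of the complement of \<open>cball 0 m\<close>, as injective
  \<open>n\<close>-tuples under Lebesgue measure on the \<open>n\<close>-fold product space.\<close>

definition outer_tuples :: "nat \<Rightarrow> nat \<Rightarrow> (nat \<Rightarrow> 'a::euclidean_space) measure" where
  "outer_tuples m n = restrict_space (Pi\<^sub>M {1..n} (\<lambda>_. lborel))
     {y. inj_on y {1..n} \<and> y ` {1..n} \<inter> cball 0 (real m) = {}}"

text \<open>Here \<open>n\<close> ranges over the positive integers. Values are extended nonnegative reals because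
  the supremum and the limits may be infinite.\<close>

definition upper_stab :: "('a::euclidean_space \<Rightarrow> 'a set \<Rightarrow> real) \<Rightarrow> 'a set \<Rightarrow> nat \<Rightarrow> ennreal" where
  "upper_stab \<xi> S m = (SUP n\<in>{1..}. esssup (outer_tuples m n)
     (\<lambda>y. ennreal (eval_at \<xi> 0 ((S \<inter> cball 0 (real m)) \<union> y ` {1..n}))))"

definition lower_stab :: "('a::euclidean_space \<Rightarrow> 'a set \<Rightarrow> real) \<Rightarrow> 'a set \<Rightarrow> nat \<Rightarrow> ennreal" where
  "lower_stab \<xi> S m = (INF n\<in>{1..}. essinf (outer_tuples m n)
     (\<lambda>y. ennreal (eval_at \<xi> 0 ((S \<inter> cball 0 (real m)) \<union> y ` {1..n}))))"

definition limit_functional :: "('a::euclidean_space \<Rightarrow> 'a set \<Rightarrow> real) \<Rightarrow> 'a set \<Rightarrow> ennreal" where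
  "limit_functional \<xi> S = limsup (upper_stab \<xi> S)"

definition stabilizes_on :: "('a::euclidean_space \<Rightarrow> 'a set \<Rightarrow> real) \<Rightarrow> 'a set \<Rightarrow> bool" where
  "stabilizes_on \<xi> S \<longleftrightarrow>
     upper_stab \<xi> S \<longlonglongrightarrow> limit_functional \<xi> S \<and>
     lower_stab \<xi> S \<longlonglongrightarrow> limit_functional \<xi> S"

text \<open>The Poisson weights are written out because \<^const>\<open>poisson_pmf\<close> requires a positive rate,
  which excludes null sets \<open>B\<close>.\<close>

definition homogeneous_poisson ::
    "'v measure \<Rightarrow> real \<Rightarrow> ('v \<Rightarrow> 'a::euclidean_space set) \<Rightarrow> bool" where
  "homogeneous_poisson N \<tau> P \<longleftrightarrow>
     prob_space N \<and> P \<in> measurable N point_sets \<and>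
     (\<forall>B k. B \<in> sets borel \<longrightarrow> bounded B \<longrightarrow>
        measure N {v \<in> space N. card (P v \<inter> B) = k} =
          (\<tau> * measure lborel B) ^ k / fact k * exp (- (\<tau> * measure lborel B))) \<and>
     (\<forall>\<B>. finite \<B> \<longrightarrow> disjoint \<B> \<longrightarrow> (\<forall>B\<in>\<B>. B \<in> sets borel \<and> bounded B) \<longrightarrow>
        prob_space.indep_vars N (\<lambda>_. count_space UNIV) (\<lambda>B v. card (P v \<inter> B)) \<B>)"

definition sample_set :: "(nat \<Rightarrow> 'w \<Rightarrow> 'a) \<Rightarrow> nat \<Rightarrow> 'w \<Rightarrow> 'a set" where
  "sample_set X n \<omega> = (\<lambda>i. X i \<omega>) ` {1..n}"

definition converges_in_Lq ::
    "'w measure \<Rightarrow> nat \<Rightarrow> (nat \<Rightarrow> 'w \<Rightarrow> real) \<Rightarrow> ('w \<Rightarrow> real) \<Rightarrow> bool" where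
  "converges_in_Lq M q Y Z \<longleftrightarrow>
     (\<forall>n. Y n \<in> borel_measurable M \<and> integrable M (\<lambda>\<omega>. \<bar>Y n \<omega>\<bar> ^ q)) \<and>
     Z \<in> borel_measurable M \<and> integrable M (\<lambda>\<omega>. \<bar>Z \<omega>\<bar> ^ q) \<and>
     (\<lambda>n. \<integral>\<omega>. \<bar>Y n \<omega> - Z \<omega>\<bar> ^ q \<partial>M) \<longlonglongrightarrow> 0"

text \<open>\<open>N \<tau>\<close> is the probability space of the Poisson process \<open>P \<tau>\<close>, given for \<open>\<tau> > 0\<close> only.\<close>

definition limit_mean ::
    "('a::euclidean_space \<Rightarrow> 'a set \<Rightarrow> real) \<Rightarrow> (real \<Rightarrow> 'v measure) \<Rightarrow>
     (real \<Rightarrow> 'v \<Rightarrow> 'a set) \<Rightarrow> ('a \<Rightarrow> real) \<Rightarrow> ennreal" where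
  "limit_mean \<xi> N P f =
     (\<integral>\<^sup>+x. (if f x = 0 then 0
           else (\<integral>\<^sup>+v. limit_functional \<xi> (P (f x) v) \<partial>N (f x)) * ennreal (f x)) \<partial>lborel)"

end

theory Submission
  imports Defs "HOL-Real_Asymp.Real_Asymp"
begin

text \<open>
  Magnify space by \<open>n\<^sup>1\<^sup>/\<^sup>d\<close> and look at the sample from one of its points \<open>x\<close>. In a ball of fixed radius
  the other points are nearly a Poisson process of intensity \<open>f x\<close>, and from two different points one
  sees two nearly independent such processes, since the two balls are disjoint before magnification
  when \<open>n\<close> is large. Whatever the points outside the ball do, the value of \<open>\<xi>\<close> lies between the
  stabilization bounds of the configuration inside, almost surely: given the inner points, the outer ones
  have a density, so they avoid the null sets that essential suprema and infima disregard
  (\<open>eval_le_upper_stab\<close>). By stabilization both bounds approach the same limit as the radius grows.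

  For \<open>\<xi>\<close> with values in \<open>[0, 1]\<close> this bounds the mean of the product of the values at two points by
  the square of the limit \<open>\<mu>\<close>, up to a vanishing error, and, applied to \<open>1 - \<xi>\<close> as well, it shows that
  the mean at one point tends to \<open>\<mu>\<close>. The variance of the average is governed by pairs, so it tends to
  \<open>0\<close> (\<open>bounded_lln\<close>). In general, \<open>\<xi>\<close> is truncated at a level \<open>K\<close>: the moment condition with \<open>p > q\<close>
  makes the excess over \<open>K\<close> small in \<open>L\<^sup>q\<close> uniformly in \<open>n\<close>, and the truncated limits increase to the
  limit of the theorem (\<open>Lq_convergence\<close>).

  The local comparison with Poisson processes rests on three facts. A point process without multiple
  points is determined in law by its void probabilities (\<open>poisson_law_unique\<close>); hence superposition,
  restriction and scaling of Poisson processes, as well as the independence of disjoint regions, are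
  identities between exponentials. Replacing the sample size \<open>n\<close> by a Poisson variable of mean
  \<open>n\<close> alters the sample by about \<open>\<surd>n\<close> points, of which a region of mass \<open>O(1/n)\<close> rarely notices one
  (\<open>poissonization_error\<close>). Finally, an integrable density is nearly constant on small balls in the mean,
  by continuity of translations in \<open>L\<^sup>1\<close> (\<open>L1_local_oscillation\<close>); averaging over the points
  in this way takes the place of an argument at Lebesgue points.
\<close>

section \<open>The space of locally finite point sets\<close>

lemma space_point_sets: "space point_sets = {S. locally_finite S}"
  unfolding point_sets_def by (rule space_measure_of) auto

lemma locally_finite_finite: "finite S \<Longrightarrow> locally_finite S"
  by (simp add: locally_finite_def)

lemma locally_finite_Int: "locally_finite S \<Longrightarrow> locally_finite (S \<inter> B)"
  unfolding locally_finite_def by (metis finite_Int inf_assoc inf_commute)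

lemma locally_finite_Un: "locally_finite S \<Longrightarrow> locally_finite T \<Longrightarrow> locally_finite (S \<union> T)"
  unfolding locally_finite_def by (simp add: Int_Un_distrib2)

text \<open>Half the least distance between two of the points serves as a radius for all of them.\<close>

lemma finite_Hausdorff_basis:
  fixes F :: "'a::metric_space set"
  assumes F: "finite F" and D: "topological_basis D"
  shows "\<exists>b. (\<forall>x\<in>F. b x \<in> D \<and> x \<in> b x) \<and> (\<forall>x\<in>F. \<forall>y\<in>F. x \<noteq> y \<longrightarrow> b x \<inter> b y = {})"
proof -
  obtain d where d: "0 < d" "\<And>x y. x \<in> F \<Longrightarrow> y \<in> F \<Longrightarrow> x \<noteq> y \<Longrightarrow> d \<le> dist x y"
  proof -
    let ?E = "(\<lambda>(x, y). dist x y) ` {(x, y) \<in> F \<times> F. x \<noteq> y}"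
    \<comment> \<open>the element \<open>1\<close> only keeps the set nonempty when \<open>F\<close> has at most one point\<close>
    have fin: "finite (insert 1 ?E)"
      by (intro finite.insertI finite_imageI finite_subset[OF _ finite_cartesian_product[OF F F]]) auto
    show thesis
      using fin by (intro that[of "Min (insert 1 ?E)"]) (auto intro!: Min_le)
  qed
  have "\<forall>x\<in>F. \<exists>B\<in>D. x \<in> B \<and> B \<subseteq> ball x (d/2)"
  proof
    fix x assume "x \<in> F"
    have "x \<in> ball x (d/2)" using d(1) by simp
    then show "\<exists>B\<in>D. x \<in> B \<and> B \<subseteq> ball x (d/2)"
      by (rule topological_basisE[OF D open_ball]) blast
  qed
  then obtain b where b: "\<And>x. x \<in> F \<Longrightarrow> b x \<in> D \<and> x \<in> b x \<and> b x \<subseteq> ball x (d/2)"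
    by metis
  have "b x \<inter> b y = {}" if "x \<in> F" "y \<in> F" "x \<noteq> y" for x y
  proof (rule ccontr)
    have bx: "b x \<subseteq> ball x (d/2)" "b y \<subseteq> ball y (d/2)" using b that by auto
    assume "b x \<inter> b y \<noteq> {}"
    then obtain z where "z \<in> ball x (d/2)" "z \<in> ball y (d/2)"
      using bx by blast
    then have "dist x y < d"
      by (metis dist_commute dist_triangle_half_r mem_ball)
    with d(2)[OF that] show False by simp
  qed
  with b show ?thesis by blast
qed

text \<open>Since a configuration is a set, it has at least \<open>k\<close> points in \<open>B\<close> if and only if
  \<open>k\<close> pairwise disjoint members of a countable base of the topology each meet it within \<open>B\<close>.
  So the events of having no point in a region already generate the whole \<open>\<sigma>\<close>-algebra.\<close>

lemma sets_point_sets_void: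
  "sets (point_sets :: 'a::euclidean_space set measure) =
     sigma_sets {S. locally_finite S} {{S. locally_finite S \<and> S \<inter> B = {}} | B. B \<in> sets borel \<and> bounded B}"
  (is "_ = sigma_sets ?\<Omega> ?V")
proof
  let ?G = "{{S. locally_finite S \<and> card (S \<inter> B) = k} | (B::'a set) k. B \<in> sets borel \<and> bounded B}"
  have G: "sets (point_sets :: 'a set measure) = sigma_sets ?\<Omega> ?G"
    unfolding point_sets_def by (rule sets_measure_of) auto
  have "?V \<subseteq> sigma_sets ?\<Omega> ?G"
  proof safe
    fix B :: "'a set" assume B: "B \<in> sets borel" "bounded B"
    have "{S. locally_finite S \<and> S \<inter> B = {}} = {S. locally_finite S \<and> card (S \<inter> B) = 0}"
      using B(2) by (auto simp: locally_finite_def)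
    also have "\<dots> \<in> sigma_sets ?\<Omega> ?G"
      using B by (intro sigma_sets.Basic) blast
    finally show "{S. locally_finite S \<and> S \<inter> B = {}} \<in> sigma_sets ?\<Omega> ?G" .
  qed
  then show "sigma_sets ?\<Omega> ?V \<subseteq> sets (point_sets :: 'a set measure)"
    unfolding G by (rule sigma_sets_mono)
  obtain D :: "'a set set" where D: "countable D" "topological_basis D"
    using ex_countable_basis by auto
  interpret V: sigma_algebra ?\<Omega> "sigma_sets ?\<Omega> ?V"
    by (rule sigma_algebra_sigma_sets) auto
  have atleast: "{S. locally_finite S \<and> k \<le> card (S \<inter> B)} \<in> sigma_sets ?\<Omega> ?V"
    if B: "B \<in> sets borel" "bounded B" for B :: "'a set" and k
  proof -
    let ?C = "{\<C>. finite \<C> \<and> \<C> \<subseteq> D \<and> disjoint \<C> \<and> card \<C> = k}"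
    have "(k \<le> card (S \<inter> B)) = (\<exists>\<C>\<in>?C. \<forall>C\<in>\<C>. S \<inter> (B \<inter> C) \<noteq> {})" if S: "locally_finite S" for S
    proof
      have fin: "finite (S \<inter> B)" using S B(2) by (simp add: locally_finite_def)
      {
        assume "k \<le> card (S \<inter> B)"
        then obtain F where F: "F \<subseteq> S \<inter> B" "card F = k" "finite F"
          by (metis obtain_subset_with_card_n)
        obtain b where b: "\<And>x. x \<in> F \<Longrightarrow> b x \<in> D \<and> x \<in> b x"
          "\<And>x y. x \<in> F \<Longrightarrow> y \<in> F \<Longrightarrow> x \<noteq> y \<Longrightarrow> b x \<inter> b y = {}"
          using finite_Hausdorff_basis[OF F(3) D(2)] by blast
        have "inj_on b F" using b by (intro inj_onI) blast
        then have "b ` F \<in> ?C" using F b by (auto simp: card_image disjoint_def)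
        moreover have "\<forall>C\<in>b ` F. S \<inter> (B \<inter> C) \<noteq> {}" using b F by blast
        ultimately show "\<exists>\<C>\<in>?C. \<forall>C\<in>\<C>. S \<inter> (B \<inter> C) \<noteq> {}" by blast
      next
        assume "\<exists>\<C>\<in>?C. \<forall>C\<in>\<C>. S \<inter> (B \<inter> C) \<noteq> {}"
        then obtain \<C> where C: "finite \<C>" "disjoint \<C>" "card \<C> = k" "\<forall>C\<in>\<C>. \<exists>p. p \<in> S \<inter> (B \<inter> C)"
          by blast
        from C(4) obtain p where p: "\<And>C. C \<in> \<C> \<Longrightarrow> p C \<in> S \<inter> (B \<inter> C)" by metis
        have "inj_on p \<C>" using p C(2) by (intro inj_onI) (metis IntD2 disjointD disjoint_iff)
        moreover have "p ` \<C> \<subseteq> S \<inter> B" using p by blast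
        ultimately show "k \<le> card (S \<inter> B)" using C(3) fin by (metis card_image card_mono)
      }
    qed
    then have "{S. locally_finite S \<and> k \<le> card (S \<inter> B)} =
        (\<Union>\<C>\<in>?C. {S \<in> ?\<Omega>. \<forall>C\<in>\<C>. S \<notin> {S. locally_finite S \<and> S \<inter> (B \<inter> C) = {}}})"
      by auto
    also have "\<dots> \<in> sigma_sets ?\<Omega> ?V"
    proof (rule V.countable_UN')
      show "countable ?C"
        using D(1) by (intro countable_subset[OF _ countable_Collect_finite_subset[OF D(1)]]) auto
      show "(\<lambda>\<C>. {S \<in> ?\<Omega>. \<forall>C\<in>\<C>. S \<notin> {S. locally_finite S \<and> S \<inter> (B \<inter> C) = {}}}) ` ?C \<subseteq> sigma_sets ?\<Omega> ?V"
      proof safe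
        fix \<C> assume \<C>: "finite \<C>" "\<C> \<subseteq> D"
        have "{S. locally_finite S \<and> S \<inter> (B \<inter> C) = {}} \<in> sigma_sets ?\<Omega> ?V" if "C \<in> \<C>" for C
        proof -
          have "open C" using \<C> D(2) that by (auto intro: topological_basis_open)
          then have "B \<inter> C \<in> sets borel" "bounded (B \<inter> C)" using B by auto
          then show ?thesis by (intro sigma_sets.Basic) blast
        qed
        then have "\<And>C. C \<in> \<C> \<Longrightarrow> {S \<in> ?\<Omega>. S \<notin> {S. locally_finite S \<and> S \<inter> (B \<inter> C) = {}}} \<in> sigma_sets ?\<Omega> ?V"
          by (intro V.sets_Collect_neg) (auto simp: Collect_conj_eq[symmetric])
        then show "{S \<in> ?\<Omega>. \<forall>C\<in>\<C>. S \<notin> {S. locally_finite S \<and> S \<inter> (B \<inter> C) = {}}} \<in> sigma_sets ?\<Omega> ?V"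
          using \<C>(1) by (intro V.sets_Collect_finite_All) auto
      qed
    qed
    finally show ?thesis .
  qed
  have "?G \<subseteq> sigma_sets ?\<Omega> ?V"
  proof safe
    fix B :: "'a set" and k assume B: "B \<in> sets borel" "bounded B"
    have "{S. locally_finite S \<and> card (S \<inter> B) = k} =
        {S. locally_finite S \<and> k \<le> card (S \<inter> B)} - {S. locally_finite S \<and> Suc k \<le> card (S \<inter> B)}"
      by auto
    then show "{S. locally_finite S \<and> card (S \<inter> B) = k} \<in> sigma_sets ?\<Omega> ?V"
      using V.Diff[OF atleast[OF B, of k] atleast[OF B, of "Suc k"]] by simp
  qed
  then show "sets (point_sets :: 'a set measure) \<subseteq> sigma_sets ?\<Omega> ?V"
    unfolding G by (rule sigma_sets_mono)
qed

lemma void_sets: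
  assumes B: "B \<in> sets borel"
  shows "{S. locally_finite S \<and> S \<inter> B = {}} \<in> sets point_sets"
proof -
  have "{S. locally_finite S \<and> S \<inter> B = {}} =
      (\<Inter>j::nat. {S. locally_finite S \<and> S \<inter> (B \<inter> cball 0 (real j)) = {}})"
  proof safe
    fix S x assume "S \<in> (\<Inter>j::nat. {S. locally_finite S \<and> S \<inter> (B \<inter> cball 0 (real j)) = {}})" and x: "x \<in> S" "x \<in> B"
    moreover obtain j where "norm x \<le> real j" using real_arch_simple by blast
    ultimately show "x \<in> {}" by fastforce
  qed auto
  also have "\<dots> \<in> sets point_sets"
  proof (rule sets.countable_INT)
    show "range (\<lambda>j::nat. {S. locally_finite S \<and> S \<inter> (B \<inter> cball 0 (real j)) = {}}) \<subseteq> sets point_sets"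
    proof safe
      fix j :: nat
      have "B \<inter> cball 0 (real j) \<in> sets borel" "bounded (B \<inter> cball 0 (real j))" using B by auto
      then show "{S. locally_finite S \<and> S \<inter> (B \<inter> cball 0 (real j)) = {}} \<in> sets point_sets"
        unfolding sets_point_sets_void by (intro sigma_sets.Basic) blast
    qed
  qed simp
  finally show ?thesis .
qed

lemma measurable_point_setsI:
  fixes F :: "'b \<Rightarrow> 'a::euclidean_space set"
  assumes "\<And>a. a \<in> space A \<Longrightarrow> locally_finite (F a)"
    and "\<And>B. B \<in> sets borel \<Longrightarrow> bounded B \<Longrightarrow> {a \<in> space A. F a \<inter> B = {}} \<in> sets A"
  shows "F \<in> measurable A point_sets"
proof (rule measurable_sigma_sets[OF sets_point_sets_void])
  show "F \<in> space A \<rightarrow> {S. locally_finite S}" using assms(1) by auto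
  fix y :: "'a set set" assume "y \<in> {{S. locally_finite S \<and> S \<inter> B = {}} | B. B \<in> sets borel \<and> bounded B}"
  then obtain B where B: "y = {S. locally_finite S \<and> S \<inter> B = {}}" "B \<in> sets borel" "bounded B" by auto
  have "F -` y \<inter> space A = {a \<in> space A. F a \<inter> B = {}}" using assms(1) B(1) by auto
  then show "F -` y \<inter> space A \<in> sets A" using assms(2)[OF B(2,3)] by simp
qed auto

lemma void_pred:
  fixes F :: "'b \<Rightarrow> 'a::euclidean_space set"
  assumes "F \<in> measurable A point_sets" "B \<in> sets borel"
  shows "{a \<in> space A. F a \<inter> B = {}} \<in> sets A"
proof -
  have "{a \<in> space A. F a \<inter> B = {}} = F -` {S. locally_finite S \<and> S \<inter> B = {}} \<inter> space A"
    using measurable_space[OF assms(1)] by (auto simp: space_point_sets)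
  then show ?thesis using measurable_sets[OF assms(1) void_sets[OF assms(2)]] by simp
qed

lemma measurable_restrict_region:
  fixes W :: "'a::euclidean_space set"
  assumes "W \<in> sets borel"
  shows "(\<lambda>S. S \<inter> W) \<in> measurable point_sets point_sets"
proof (rule measurable_point_setsI)
  fix B :: "'a set" assume "B \<in> sets borel"
  then show "{S \<in> space point_sets. S \<inter> W \<inter> B = {}} \<in> sets point_sets"
    using void_pred[OF measurable_ident_sets[OF refl], of "W \<inter> B"] assms by (simp add: Int_assoc)
qed (auto simp: space_point_sets intro: locally_finite_Int)

lemma measurable_superpose:
  "(\<lambda>(S :: 'a::euclidean_space set, T). S \<union> T) \<in> measurable (point_sets \<Otimes>\<^sub>M point_sets) point_sets"
proof (rule measurable_point_setsI)
  fix B :: "'a set" assume B: "B \<in> sets borel"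
  have "{p \<in> space (point_sets \<Otimes>\<^sub>M point_sets). (case p of (S, T) \<Rightarrow> S \<union> T) \<inter> B = {}} =
    {p \<in> space (point_sets \<Otimes>\<^sub>M point_sets). fst p \<inter> B = {}} \<inter> {p \<in> space (point_sets \<Otimes>\<^sub>M point_sets). snd p \<inter> B = {}}"
    by auto
  also have "\<dots> \<in> sets (point_sets \<Otimes>\<^sub>M point_sets)"
    by (intro sets.Int void_pred[OF _ B] measurable_fst measurable_snd)
  finally show "{p \<in> space (point_sets \<Otimes>\<^sub>M point_sets). (case p of (S, T) \<Rightarrow> S \<union> T) \<inter> B = {}} \<in> sets (point_sets \<Otimes>\<^sub>M point_sets)" .
qed (auto simp: space_point_sets space_pair_measure intro: locally_finite_Un)

lemma measurable_finite_image:
  fixes F :: "'i \<Rightarrow> 'b \<Rightarrow> 'a::euclidean_space"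
  assumes J: "finite J" and F: "\<And>j. j \<in> J \<Longrightarrow> F j \<in> measurable A borel"
  shows "(\<lambda>a. (\<lambda>j. F j a) ` J) \<in> measurable A point_sets"
proof (rule measurable_point_setsI)
  fix B :: "'a set" assume B: "B \<in> sets borel"
  have "{a \<in> space A. (\<lambda>j. F j a) ` J \<inter> B = {}} = {a \<in> space A. \<forall>j\<in>J. F j a \<notin> B}" by auto
  also have "\<dots> \<in> sets A"
  proof (rule sets.sets_Collect_finite_All[OF _ J])
    fix j assume "j \<in> J"
    then have "F j -` (-B) \<inter> space A \<in> sets A" using measurable_sets[OF F] B by auto
    moreover have "F j -` (-B) \<inter> space A = {a \<in> space A. F j a \<notin> B}" by auto
    ultimately show "{a \<in> space A. F j a \<notin> B} \<in> sets A" by simp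
  qed
  finally show "{a \<in> space A. (\<lambda>j. F j a) ` J \<inter> B = {}} \<in> sets A" .
qed (auto intro!: locally_finite_finite J finite_imageI)

lemma measurable_insert_point:
  fixes u :: "'b \<Rightarrow> 'a::euclidean_space"
  assumes "F \<in> measurable A point_sets" "u \<in> measurable A borel"
  shows "(\<lambda>a. insert (u a) (F a)) \<in> measurable A point_sets"
proof -
  have "(\<lambda>a. (\<lambda>(S, T). S \<union> T) ((\<lambda>j::unit. u a) ` {()}, F a)) \<in> measurable A point_sets"
    using assms by (intro measurable_compose[OF _ measurable_superpose] measurable_Pair measurable_finite_image) auto
  then show ?thesis by simp
qed

lemma locally_finite_affine:
  fixes S :: "'a::euclidean_space set"
  assumes S: "locally_finite S" and c: "c \<noteq> 0"
  shows "locally_finite ((\<lambda>z. c *\<^sub>R (z - x)) ` S)"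
  unfolding locally_finite_def
proof safe
  fix B :: "'a set" assume B: "bounded B"
  let ?C = "(\<lambda>u. x + (1/c) *\<^sub>R u) ` B"
  have "bounded ?C"
    using bounded_translation[OF bounded_scaling[OF B, of "1/c"], of x] by (simp add: image_image)
  then have "finite (S \<inter> ?C)" using S by (simp add: locally_finite_def)
  moreover have "(\<lambda>z. c *\<^sub>R (z - x)) ` S \<inter> B \<subseteq> (\<lambda>z. c *\<^sub>R (z - x)) ` (S \<inter> ?C)"
  proof safe
    fix z assume z: "c *\<^sub>R (z - x) \<in> B" "z \<in> S"
    have "z = x + (1/c) *\<^sub>R (c *\<^sub>R (z - x))" using c by simp
    then show "c *\<^sub>R (z - x) \<in> (\<lambda>z. c *\<^sub>R (z - x)) ` (S \<inter> ?C)" using z by blast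
  qed
  ultimately show "finite ((\<lambda>z. c *\<^sub>R (z - x)) ` S \<inter> B)" by (meson finite_imageI finite_subset)
qed

lemma measurable_affine_point_sets:
  fixes x :: "'a::euclidean_space"
  assumes c: "c \<noteq> 0"
  shows "(\<lambda>S. (\<lambda>z. c *\<^sub>R (z - x)) ` S) \<in> measurable point_sets point_sets"
proof (rule measurable_point_setsI)
  fix B :: "'a set" assume B: "B \<in> sets borel"
  have m: "(\<lambda>z. c *\<^sub>R (z - x)) \<in> measurable borel borel" by measurable
  have "(\<lambda>z. c *\<^sub>R (z - x)) -` B \<in> sets borel" using measurable_sets[OF m B] by simp
  from void_pred[OF measurable_ident_sets[OF refl] this]
  have "{S \<in> space point_sets. S \<inter> (\<lambda>z. c *\<^sub>R (z - x)) -` B = {}} \<in> sets point_sets" .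
  moreover have "{S \<in> space point_sets. S \<inter> (\<lambda>z. c *\<^sub>R (z - x)) -` B = {}} =
    {S \<in> space point_sets. (\<lambda>z. c *\<^sub>R (z - x)) ` S \<inter> B = {}}" by auto
  ultimately show "{S \<in> space point_sets. (\<lambda>z. c *\<^sub>R (z - x)) ` S \<inter> B = {}} \<in> sets point_sets" by simp
qed (auto simp: space_point_sets c intro: locally_finite_affine)

section \<open>Poisson laws are determined by their void probabilities\<close>

text \<open>The law of a Poisson process with intensity \<open>\<Lambda>\<close>, described by void probabilities alone: by the
  next lemma these determine the law, so that restriction, superposition and change of scale
  of Poisson processes reduce to identities between exponentials.\<close>

definition poisson_law :: "('a::euclidean_space set \<Rightarrow> real) \<Rightarrow> 'a set measure \<Rightarrow> bool" where
  "poisson_law \<Lambda> L \<longleftrightarrow> prob_space L \<and> sets L = sets point_sets \<and>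
     (\<forall>B. B \<in> sets borel \<longrightarrow> bounded B \<longrightarrow>
        measure L {S. locally_finite S \<and> S \<inter> B = {}} = exp (- \<Lambda> B))"

text \<open>The void events are closed under intersection, because avoiding two sets means avoiding their union,
  and they generate the \<open>\<sigma>\<close>-algebra.\<close>

lemma poisson_law_unique:
  fixes L1 :: "'a::euclidean_space set measure"
  assumes 1: "poisson_law \<Lambda>1 L1" and 2: "poisson_law \<Lambda>2 L2"
    and eq: "\<And>B. B \<in> sets borel \<Longrightarrow> bounded B \<Longrightarrow> \<Lambda>1 B = \<Lambda>2 B"
  shows "L1 = L2"
proof -
  interpret L1: prob_space L1 using 1 by (simp add: poisson_law_def)
  interpret L2: prob_space L2 using 2 by (simp add: poisson_law_def)
  let ?\<Omega> = "{S::'a set. locally_finite S}"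
  let ?V = "{{S. locally_finite S \<and> S \<inter> B = {}} | B. B \<in> sets (borel :: 'a measure) \<and> bounded B}"
  have \<Omega>: "?\<Omega> \<in> ?V" by (auto intro!: exI[of _ "{}"])
  show ?thesis
  proof (rule measure_eqI_generator_eq[where E="?V" and \<Omega>="?\<Omega>" and A="\<lambda>_. ?\<Omega>"])
    show "Int_stable ?V"
    proof (rule Int_stableI, safe)
      fix B C :: "'a set" assume "B \<in> sets borel" "bounded B" "C \<in> sets borel" "bounded C"
      then show "\<exists>D. {S. locally_finite S \<and> S \<inter> B = {}} \<inter> {S. locally_finite S \<and> S \<inter> C = {}} =
          {S. locally_finite S \<and> S \<inter> D = {}} \<and> D \<in> sets borel \<and> bounded D"
        by (intro exI[of _ "B \<union> C"]) auto
    qed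
    show "emeasure L1 X = emeasure L2 X" if "X \<in> ?V" for X
      using that 1 2 eq by (auto simp: poisson_law_def L1.emeasure_eq_measure L2.emeasure_eq_measure)
    show "sets L1 = sigma_sets ?\<Omega> ?V" "sets L2 = sigma_sets ?\<Omega> ?V"
      using 1 2 by (simp_all add: poisson_law_def sets_point_sets_void)
    show "range (\<lambda>_::nat. ?\<Omega>) \<subseteq> ?V" using \<Omega> by auto
  qed auto
qed

lemma poisson_law_sets[measurable_cong]: "poisson_law \<Lambda> L \<Longrightarrow> sets L = sets point_sets"
  by (simp add: poisson_law_def)

lemma poisson_law_space: "poisson_law \<Lambda> L \<Longrightarrow> space L = {S. locally_finite S}"
  using sets_eq_imp_space_eq[OF poisson_law_sets] by (simp add: space_point_sets)

lemma poisson_law_prob: "poisson_law \<Lambda> L \<Longrightarrow> prob_space L"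
  by (simp add: poisson_law_def)

lemma poisson_law_measurable: "poisson_law \<Lambda> L \<Longrightarrow> g \<in> measurable point_sets A \<Longrightarrow> g \<in> measurable L A"
  using measurable_cong_sets[of L point_sets A A] poisson_law_sets by blast

text \<open>The hypothesis on \<open>h\<close> and \<open>T\<close> says that \<open>h\<close> pulls void events back to void events; restriction to a region
  and affine maps of space have this property.\<close>

lemma poisson_law_map:
  fixes L :: "'a::euclidean_space set measure"
  assumes L: "poisson_law \<Lambda> L" and h: "(h :: 'a set \<Rightarrow> 'a set) \<in> measurable point_sets point_sets"
    and T: "\<And>S B. locally_finite S \<Longrightarrow> h S \<inter> B = {} \<longleftrightarrow> S \<inter> T B = {}"
    and TB: "\<And>B. B \<in> sets borel \<Longrightarrow> bounded B \<Longrightarrow> T B \<in> sets borel \<and> bounded (T B)"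
  shows "poisson_law (\<lambda>B. \<Lambda> (T B)) (distr L point_sets h)"
  unfolding poisson_law_def
proof (intro conjI allI impI)
  interpret L: prob_space L using L by (rule poisson_law_prob)
  have hL: "h \<in> measurable L point_sets" using L h by (rule poisson_law_measurable)
  show "prob_space (distr L point_sets h)" using hL by (rule L.prob_space_distr)
  fix B :: "'a set" assume B: "B \<in> sets borel" "bounded B"
  have "h -` {S. locally_finite S \<and> S \<inter> B = {}} \<inter> space L = {S. locally_finite S \<and> S \<inter> T B = {}}"
    using T measurable_space[OF hL] by (auto simp: poisson_law_space[OF L] space_point_sets)
  then show "measure (distr L point_sets h) {S. locally_finite S \<and> S \<inter> B = {}} = exp (- \<Lambda> (T B))"
    using L TB[OF B] by (simp add: measure_distr[OF hL void_sets[OF B(1)]] poisson_law_def)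
qed simp

lemma poisson_law_superpose:
  fixes L1 :: "'a::euclidean_space set measure"
  assumes 1: "poisson_law \<Lambda>1 L1" and 2: "poisson_law \<Lambda>2 L2"
  shows "poisson_law (\<lambda>B. \<Lambda>1 B + \<Lambda>2 B) (distr (L1 \<Otimes>\<^sub>M L2) point_sets (\<lambda>(S, T). S \<union> T))"
  unfolding poisson_law_def
proof (intro conjI allI impI)
  interpret L1: prob_space L1 using 1 by (rule poisson_law_prob)
  interpret L2: prob_space L2 using 2 by (rule poisson_law_prob)
  interpret P: pair_prob_space L1 L2 ..
  have m: "(\<lambda>(S, T). S \<union> T) \<in> measurable (L1 \<Otimes>\<^sub>M L2) point_sets"
    using measurable_superpose poisson_law_sets[OF 1] poisson_law_sets[OF 2]
    by (simp cong: measurable_cong_sets sets_pair_measure_cong)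
  then show "prob_space (distr (L1 \<Otimes>\<^sub>M L2) point_sets (\<lambda>(S, T). S \<union> T))" by (rule P.prob_space_distr)
  fix B :: "'a set" assume B: "B \<in> sets borel" "bounded B"
  let ?V = "{S. locally_finite S \<and> S \<inter> B = {}}"
  have V: "?V \<in> sets L1" "?V \<in> sets L2"
    using void_sets[OF B(1)] poisson_law_sets[OF 1] poisson_law_sets[OF 2] by auto
  have "(\<lambda>(S, T). S \<union> T) -` ?V \<inter> space (L1 \<Otimes>\<^sub>M L2) = ?V \<times> ?V"
    by (auto simp: space_pair_measure poisson_law_space[OF 1] poisson_law_space[OF 2] intro: locally_finite_Un)
  moreover have "measure (L1 \<Otimes>\<^sub>M L2) (?V \<times> ?V) = measure L1 ?V * measure L2 ?V"
    using V by (simp add: measure_def L2.emeasure_pair_measure_Times enn2real_mult)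
  ultimately show "measure (distr (L1 \<Otimes>\<^sub>M L2) point_sets (\<lambda>(S, T). S \<union> T)) ?V = exp (- (\<Lambda>1 B + \<Lambda>2 B))"
    using 1 2 B by (simp add: measure_distr[OF m void_sets[OF B(1)]] poisson_law_def exp_add[symmetric])
qed simp

section \<open>A Poisson number of independent points\<close>

lemma (in prob_space) expectation_diff_le_prob:
  fixes f g :: "'a \<Rightarrow> real"
  assumes [measurable]: "f \<in> borel_measurable M" "g \<in> borel_measurable M" and A[measurable]: "A \<in> sets M"
    and f: "\<And>x. x \<in> space M \<Longrightarrow> 0 \<le> f x \<and> f x \<le> 1" and g: "\<And>x. x \<in> space M \<Longrightarrow> 0 \<le> g x \<and> g x \<le> 1"
    and eq: "\<And>x. x \<in> space M \<Longrightarrow> x \<notin> A \<Longrightarrow> f x = g x"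
  shows "\<bar>expectation f - expectation g\<bar> \<le> prob A"
proof -
  have i: "integrable M f" "integrable M g"
    using f g by (auto intro!: integrable_const_bound[where B=1])
  have "\<bar>expectation f - expectation g\<bar> = \<bar>\<integral>x. f x - g x \<partial>M\<bar>"
    using i by simp
  also have "\<dots> \<le> (\<integral>x. indicator A x \<partial>M)"
  proof (rule order_trans[OF integral_abs_bound], rule integral_mono)
    show "integrable M (indicator A :: _ \<Rightarrow> real)"
      by (rule integrable_const_bound[where B=1]) auto
    show "\<bar>f x - g x\<bar> \<le> indicator A x" if "x \<in> space M" for x
      using f[OF that] g[OF that] eq[OF that] by (auto simp: indicator_def)
  qed (use i in auto)
  also have "\<dots> = prob A" by simp
  finally show ?thesis .
qed

lemma poisson_expectation:
  fixes h :: "nat \<Rightarrow> real"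
  assumes l: "0 < l" and h: "\<And>k. 0 \<le> h k" and s: "(\<lambda>k. l ^ k / fact k * h k) sums s"
  shows "integrable (measure_pmf (poisson_pmf l)) h"
    and "measure_pmf.expectation (poisson_pmf l) h = exp (- l) * s"
proof -
  have s': "(\<lambda>k. pmf (poisson_pmf l) k * h k) sums (exp (- l) * s)"
    using sums_mult[OF s, of "exp (- l)"] l by (simp add: mult_ac)
  have "integrable (count_space UNIV) (\<lambda>k. pmf (poisson_pmf l) k * h k)"
    using s' h by (simp add: integrable_count_space_nat_iff sums_iff abs_mult)
  then show "integrable (measure_pmf (poisson_pmf l)) h"
    unfolding measure_pmf_eq_density by (subst integrable_density) auto
  have "measure_pmf.expectation (poisson_pmf l) h = (\<integral>k. pmf (poisson_pmf l) k * h k \<partial>count_space UNIV)"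
    unfolding measure_pmf_eq_density by (subst integral_density) auto
  also have "\<dots> = exp (- l) * s"
    using \<open>integrable (count_space UNIV) (\<lambda>k. pmf (poisson_pmf l) k * h k)\<close> s'
    by (subst integral_count_space_nat) (auto simp: sums_iff)
  finally show "measure_pmf.expectation (poisson_pmf l) h = exp (- l) * s" .
qed

lemma exp_sums: "(\<lambda>k. (x::real) ^ k / fact k) sums exp x"
  using exp_converges[of x] by (simp add: divide_inverse mult.commute)

lemma exp_sums_mean: "(\<lambda>k. (x::real) ^ k / fact k * real k) sums (x * exp x)"
proof -
  have "(\<lambda>k. x ^ Suc k / fact (Suc k) * real (Suc k)) = (\<lambda>k. x * (x ^ k / fact k))"
    by (simp add: fun_eq_iff divide_simps del: of_nat_Suc)
  then have "(\<lambda>k. x ^ Suc k / fact (Suc k) * real (Suc k)) sums (x * exp x)"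
    using sums_mult[OF exp_sums, of x x] by simp
  then show ?thesis by (subst (asm) sums_Suc_iff) simp
qed

lemma exp_sums_square: "(\<lambda>k. (x::real) ^ k / fact k * (real k)\<^sup>2) sums ((x\<^sup>2 + x) * exp x)"
proof -
  have "(\<lambda>k. x ^ Suc k / fact (Suc k) * (real (Suc k))\<^sup>2) = (\<lambda>k. x * (x ^ k / fact k * real k + x ^ k / fact k))"
  proof
    fix k
    define a where "a = real (Suc k)"
    have a: "real k = a - 1" "fact (Suc k) = a * fact k" "a \<noteq> 0" by (auto simp: a_def)
    show "x ^ Suc k / fact (Suc k) * (real (Suc k))\<^sup>2 = x * (x ^ k / fact k * real k + x ^ k / fact k)"
      unfolding a a_def[symmetric] using a(3) by (simp add: power2_eq_square field_simps)
  qed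
  moreover have "(\<lambda>k. x * (x ^ k / fact k * real k + x ^ k / fact k)) sums (x * (x * exp x + exp x))"
    by (intro sums_mult sums_add exp_sums_mean exp_sums)
  ultimately have "(\<lambda>k. x ^ Suc k / fact (Suc k) * (real (Suc k))\<^sup>2) sums ((x\<^sup>2 + x) * exp x)"
    by (simp add: algebra_simps power2_eq_square)
  then show ?thesis by (subst (asm) sums_Suc_iff) simp
qed

text \<open>By the Cauchy-Schwarz inequality, from the second moment about \<open>a\<close>.\<close>

lemma poisson_mean_abs_deviation:
  assumes l: "0 < l"
  shows "integrable (measure_pmf (poisson_pmf l)) (\<lambda>k. \<bar>real k - a\<bar>)"
    and "measure_pmf.expectation (poisson_pmf l) (\<lambda>k. \<bar>real k - a\<bar>) \<le> sqrt (l + (l - a)\<^sup>2)"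
proof -
  let ?P = "measure_pmf (poisson_pmf l)"
  have "(\<lambda>k. l ^ k / fact k * (real k)\<^sup>2 + (a\<^sup>2 * (l ^ k / fact k) - 2 * a * (l ^ k / fact k * real k))) sums
      ((l\<^sup>2 + l) * exp l + (a\<^sup>2 * exp l - 2 * a * (l * exp l)))"
    by (intro sums_mult sums_add sums_diff exp_sums_mean exp_sums exp_sums_square)
  then have s: "(\<lambda>k. l ^ k / fact k * (real k - a)\<^sup>2) sums (exp l * (l + (l - a)\<^sup>2))"
    by (simp add: power2_eq_square algebra_simps add_divide_distrib diff_divide_distrib)
  note sq = poisson_expectation[OF l _ s, simplified]
  have [simp]: "exp (- l) * (exp l * (l + (l - a)\<^sup>2)) = l + (l - a)\<^sup>2"
    by (simp add: mult.assoc[symmetric] exp_add[symmetric])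
  show int: "integrable ?P (\<lambda>k. \<bar>real k - a\<bar>)"
  proof (rule Bochner_Integration.integrable_bound[where f="\<lambda>k. 1 + (real k - a)\<^sup>2"])
    have "\<bar>x\<bar> \<le> \<bar>1 + x\<^sup>2\<bar>" for x :: real
      using sum_squares_bound[of "\<bar>x\<bar>" 1] by (simp add: abs_if power2_eq_square split: if_splits)
    then show "AE x in ?P. norm \<bar>real x - a\<bar> \<le> norm (1 + (real x - a)\<^sup>2)" by auto
  qed (use sq in auto)
  have "(measure_pmf.expectation (poisson_pmf l) (\<lambda>k. \<bar>real k - a\<bar>))\<^sup>2 \<le>
      measure_pmf.expectation (poisson_pmf l) (\<lambda>k. \<bar>real k - a\<bar>\<^sup>2)"
    using measure_pmf.variance_positive[of "poisson_pmf l" "\<lambda>k. \<bar>real k - a\<bar>"]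
      measure_pmf.variance_eq[OF int] sq(1) by simp
  also have "\<dots> = l + (l - a)\<^sup>2" using sq(2) by simp
  finally show "measure_pmf.expectation (poisson_pmf l) (\<lambda>k. \<bar>real k - a\<bar>) \<le> sqrt (l + (l - a)\<^sup>2)"
    by (rule real_le_rsqrt)
qed

definition poissonized :: "real \<Rightarrow> 'a::euclidean_space measure \<Rightarrow> 'a set measure" where
  "poissonized l Q = distr (measure_pmf (poisson_pmf l) \<Otimes>\<^sub>M (\<Pi>\<^sub>M i\<in>(UNIV::nat set). Q)) point_sets
     (\<lambda>(k, z). z ` {..<k})"

lemma measurable_component_borel:
  fixes Q :: "'a::euclidean_space measure"
  assumes "sets Q = sets borel" "i \<in> I"
  shows "(\<lambda>z. z i) \<in> measurable (\<Pi>\<^sub>M i\<in>I. Q) borel"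
  using measurable_component_singleton[of i I "\<lambda>_. Q"] assms measurable_cong_sets[of _ _ Q borel] by blast

lemma measurable_poissonized:
  fixes Q :: "'a::euclidean_space measure"
  assumes "sets Q = sets borel"
  shows "(\<lambda>(k, z). z ` {..<k}) \<in> measurable (measure_pmf p \<Otimes>\<^sub>M (\<Pi>\<^sub>M i\<in>(UNIV::nat set). Q)) point_sets"
proof -
  have "(\<lambda>(k, z). z ` {..<k}) \<in> measurable (count_space UNIV \<Otimes>\<^sub>M (\<Pi>\<^sub>M i\<in>(UNIV::nat set). Q)) point_sets"
    using assms
    by (intro measurable_pair_measure_countable1)
       (auto intro!: measurable_finite_image measurable_component_borel assms)
  then show ?thesis by (simp cong: measurable_cong_sets sets_pair_measure_cong)
qed

lemma prob_avoid:
  assumes Q: "prob_space Q" and J: "finite J" "J \<subseteq> I" and B: "B \<in> sets Q"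
  shows "measure (Pi\<^sub>M I (\<lambda>_. Q)) {z \<in> space (Pi\<^sub>M I (\<lambda>_. Q)). z ` J \<inter> B = {}} = (1 - measure Q B) ^ card J"
proof -
  interpret Q: prob_space Q by fact
  interpret product_prob_space "\<lambda>_. Q" I ..
  have "{z \<in> space (Pi\<^sub>M I (\<lambda>_. Q)). z ` J \<inter> B = {}} = prod_emb I (\<lambda>_. Q) J (Pi\<^sub>E J (\<lambda>_. space Q - B))"
    using J(2) by (auto simp: prod_emb_def space_PiM PiE_iff Pi_iff extensional_def restrict_def disjoint_iff subset_iff)
  also have "measure (Pi\<^sub>M I (\<lambda>_. Q)) \<dots> = (\<Prod>j\<in>J. measure Q (space Q - B))"
    using J B by (intro measure_PiM_emb) auto
  finally show ?thesis using B by (simp add: Q.prob_compl)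
qed

text \<open>Poisson many independent points with law \<open>Q\<close>: the generating function of the Poisson law turns
  the probabilities \<open>(1 - Q B)\<^sup>k\<close> of avoiding \<open>B\<close> into \<open>exp (- l * Q B)\<close>.\<close>

lemma poisson_law_poissonized:
  fixes Q :: "'a::euclidean_space measure"
  assumes Q: "prob_space Q" "sets Q = sets borel" and l: "0 < l"
  shows "poisson_law (\<lambda>B. l * measure Q B) (poissonized l Q)"
  unfolding poisson_law_def
proof (intro conjI allI impI)
  interpret Q: prob_space Q by fact
  let ?\<Pi> = "\<Pi>\<^sub>M i\<in>(UNIV::nat set). Q"
  interpret P: product_prob_space "\<lambda>_. Q" "UNIV::nat set" ..
  interpret pair_prob_space "measure_pmf (poisson_pmf l)" ?\<Pi> ..
  have m: "(\<lambda>(k, z). z ` {..<k}) \<in> measurable (measure_pmf (poisson_pmf l) \<Otimes>\<^sub>M ?\<Pi>) point_sets"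
    using Q(2) by (rule measurable_poissonized)
  show "prob_space (poissonized l Q)" unfolding poissonized_def using m by (rule prob_space_distr)
  fix B :: "'a set" assume B: "B \<in> sets borel" "bounded B"
  have V: "{S. locally_finite S \<and> S \<inter> B = {}} \<in> sets point_sets" using B(1) by (rule void_sets)
  let ?A = "(\<lambda>(k, z). z ` {..<k}) -` {S. locally_finite S \<and> S \<inter> B = {}} \<inter> space (measure_pmf (poisson_pmf l) \<Otimes>\<^sub>M ?\<Pi>)"
  have A: "?A \<in> sets (measure_pmf (poisson_pmf l) \<Otimes>\<^sub>M ?\<Pi>)" by (rule measurable_sets[OF m V])
  have k: "emeasure ?\<Pi> (Pair k -` ?A) = ennreal ((1 - measure Q B) ^ k)" for k
  proof -
    have "Pair k -` ?A = {z \<in> space ?\<Pi>. z ` {..<k} \<inter> B = {}}"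
      by (auto simp: space_pair_measure locally_finite_finite)
    then show ?thesis
      using prob_avoid[OF Q(1), of "{..<k}" UNIV B] B Q(2) by (simp add: P.P.emeasure_eq_measure)
  qed
  have "(\<lambda>k. l ^ k / fact k * (1 - measure Q B) ^ k) sums exp (l * (1 - measure Q B))"
    using exp_sums[of "l * (1 - measure Q B)"] by (simp add: power_mult_distrib)
  note pe = poisson_expectation[OF l _ this]
  have "emeasure (poissonized l Q) {S. locally_finite S \<and> S \<inter> B = {}} =
      (\<integral>\<^sup>+k. ennreal ((1 - measure Q B) ^ k) \<partial>measure_pmf (poisson_pmf l))"
    unfolding poissonized_def emeasure_distr[OF m V] P.P.emeasure_pair_measure_alt[OF A] k ..
  also have "\<dots> = ennreal (measure_pmf.expectation (poisson_pmf l) (\<lambda>k. (1 - measure Q B) ^ k))"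
    using pe(1) by (intro nn_integral_eq_integral) (auto simp: Q.prob_le_1)
  also have "measure_pmf.expectation (poisson_pmf l) (\<lambda>k. (1 - measure Q B) ^ k) = exp (- l) * exp (l * (1 - measure Q B))"
    using pe(2) by (simp add: Q.prob_le_1)
  also have "\<dots> = exp (- (l * measure Q B))"
    by (simp add: exp_add[symmetric] algebra_simps)
  finally show "measure (poissonized l Q) {S. locally_finite S \<and> S \<inter> B = {}} = exp (- (l * measure Q B))"
    by (simp add: measure_def)
qed (simp add: poissonized_def)

text \<open>After normalization of \<open>\<nu>\<close> this is the previous lemma; the null measure gives the empty configuration.\<close>

lemma poisson_law_exists:
  fixes \<nu> :: "'a::euclidean_space measure"
  assumes "finite_measure \<nu>" and sets: "sets \<nu> = sets borel"
  shows "\<exists>L. poisson_law (measure \<nu>) L"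
proof (cases "measure \<nu> UNIV = 0")
  interpret finite_measure \<nu> by fact
  have sp: "space \<nu> = UNIV" using sets_eq_imp_space_eq[OF sets] by simp
  case True
  have "measure \<nu> B = 0" if "B \<in> sets borel" for B
    using finite_measure_mono[of B UNIV] True that sets measure_nonneg[of \<nu> B] by auto
  moreover have "prob_space (return point_sets ({}::'a set))"
    by (rule prob_space_return) (simp add: space_point_sets locally_finite_finite)
  ultimately have "poisson_law (measure \<nu>) (return point_sets {})"
    by (auto simp: poisson_law_def measure_return[OF void_sets] locally_finite_finite indicator_def)
  then show ?thesis ..
next
  interpret finite_measure \<nu> by fact
  have sp: "space \<nu> = UNIV" using sets_eq_imp_space_eq[OF sets] by simp
  case False
  define l where "l = measure \<nu> UNIV"
  have l: "0 < l" using False by (simp add: l_def zero_less_measure_iff)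
  define Q where "Q = scale_measure (ennreal (1 / l)) \<nu>"
  have Qm: "measure Q B = measure \<nu> B / l" for B
    using l by (simp add: Q_def measure_scale_measure)
  have "emeasure \<nu> UNIV = ennreal l" by (simp add: l_def emeasure_eq_measure)
  then have "prob_space Q"
    using l sp by (intro prob_spaceI) (simp add: Q_def space_scale_measure ennreal_mult[symmetric])
  moreover have "sets Q = sets borel" using sets by (simp add: Q_def)
  ultimately have "poisson_law (\<lambda>B. l * measure Q B) (poissonized l Q)"
    using l by (intro poisson_law_poissonized)
  then show ?thesis using l by (auto simp: Qm)
qed

text \<open>The two samples are built from one sequence of independent points, so they differ within \<open>W\<close>
  only if one of the points by which they differ in number falls into \<open>W\<close>.\<close>

lemma poissonization_error:
  fixes Q :: "'a::euclidean_space measure" and G :: "'a set \<Rightarrow> real"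
  assumes Q: "prob_space Q" "sets Q = sets borel" and l: "0 < l" and J: "finite J"
    and G: "G \<in> borel_measurable point_sets" and G01: "\<And>S. locally_finite S \<Longrightarrow> 0 \<le> G S \<and> G S \<le> 1"
    and W: "W \<in> sets borel" and loc: "\<And>S. locally_finite S \<Longrightarrow> G (S \<inter> W) = G S"
  shows "\<bar>(\<integral>z. G (z ` J) \<partial>(\<Pi>\<^sub>M j\<in>J. Q)) - (\<integral>S. G S \<partial>poissonized l Q)\<bar> \<le>
     measure Q W * sqrt (l + (l - real (card J))\<^sup>2)"
proof -
  interpret Q: prob_space Q by fact
  let ?\<Pi> = "\<Pi>\<^sub>M i\<in>(UNIV::nat set). Q" and ?P = "measure_pmf (poisson_pmf l)"
  let ?n = "card J"
  interpret P: product_prob_space "\<lambda>_. Q" "UNIV::nat set" ..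
  interpret PP: pair_prob_space ?P ?\<Pi> ..
  have m: "(\<lambda>(k, z). z ` {..<k}) \<in> measurable (?P \<Otimes>\<^sub>M ?\<Pi>) point_sets"
    using Q(2) by (rule measurable_poissonized)
  have mk: "(\<lambda>z. z ` K) \<in> measurable (\<Pi>\<^sub>M i\<in>I. Q) point_sets" if "finite K" "K \<subseteq> I" for I and K :: "'b set"
    using that by (intro measurable_finite_image measurable_component_borel[OF Q(2)]) auto
  have mk': "(\<lambda>z. z ` {..<k}) \<in> measurable ?\<Pi> point_sets" for k
    by (intro measurable_finite_image measurable_component_borel[OF Q(2)]) auto
  define e where "e k = (\<integral>z. G (z ` {..<k}) \<partial>?\<Pi>)" for k
  have sample: "(\<integral>z. G (z ` J) \<partial>(\<Pi>\<^sub>M j\<in>J. Q)) = e ?n"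
  proof -
    obtain t where t: "bij_betw t J {..<?n}" using J by (metis bij_betw_iff_card card_lessThan finite_lessThan)
    have D: "distr ?\<Pi> (\<Pi>\<^sub>M j\<in>J. Q) (\<lambda>z. \<lambda>j\<in>J. z (t j)) = (\<Pi>\<^sub>M j\<in>J. Q)"
      using t by (intro distr_PiM_reindex[where M="\<lambda>_. Q"]) (auto simp: Q(1) bij_betw_def)
    have mt: "(\<lambda>z. \<lambda>j\<in>J. z (t j)) \<in> measurable ?\<Pi> (\<Pi>\<^sub>M j\<in>J. Q)" by measurable
    have "(\<integral>z. G (z ` J) \<partial>(\<Pi>\<^sub>M j\<in>J. Q)) = (\<integral>z. G ((\<lambda>j\<in>J. z (t j)) ` J) \<partial>?\<Pi>)"
      by (subst D[symmetric], subst integral_distr[OF mt])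
         (auto intro!: measurable_compose[OF mk[OF J] G])
    also have "(\<lambda>z. G ((\<lambda>j\<in>J. z (t j)) ` J)) = (\<lambda>z. G (z ` {..<?n}))"
    proof
      fix z :: "nat \<Rightarrow> 'a"
      have "(\<lambda>j\<in>J. z (t j)) ` J = z ` (t ` J)" by auto
      then show "G ((\<lambda>j\<in>J. z (t j)) ` J) = G (z ` {..<?n})" using t by (simp add: bij_betw_def)
    qed
    finally show ?thesis by (simp add: e_def)
  qed
  have bound: "\<bar>e i - e j\<bar> \<le> real (j - i) * measure Q W" if "i \<le> j" for i j
  proof -
    let ?A = "{z \<in> space ?\<Pi>. z ` {i..<j} \<inter> W \<noteq> {}}"
    have Ac: "{z \<in> space ?\<Pi>. z ` {i..<j} \<inter> W = {}} \<in> sets ?\<Pi>"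
      by (intro void_pred[OF measurable_finite_image W] measurable_component_borel[OF Q(2)]) auto
    have A: "?A = space ?\<Pi> - {z \<in> space ?\<Pi>. z ` {i..<j} \<inter> W = {}}" by auto
    have "\<bar>e i - e j\<bar> \<le> measure ?\<Pi> ?A"
      unfolding e_def
    proof (rule P.P.expectation_diff_le_prob)
      show "?A \<in> sets ?\<Pi>" unfolding A using Ac by auto
      fix z assume z: "z \<in> space ?\<Pi>" "z \<notin> ?A"
      then have "z ` {i..<j} \<inter> W = {}" by simp
      moreover have "z ` {..<j} = z ` {..<i} \<union> z ` {i..<j}"
        using that by (metis image_Un ivl_disj_un_one(2))
      ultimately have "z ` {..<i} \<inter> W = z ` {..<j} \<inter> W" by auto
      then show "G (z ` {..<i}) = G (z ` {..<j})"
        by (metis loc locally_finite_finite finite_imageI finite_lessThan)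
    qed (auto intro!: measurable_compose[OF mk' G] G01 locally_finite_finite)
    also have "\<dots> = 1 - (1 - measure Q W) ^ (j - i)"
      unfolding A using prob_avoid[OF Q(1), of "{i..<j}" UNIV W] W Q(2) Ac by (simp add: P.P.prob_compl)
    also have "\<dots> \<le> real (j - i) * measure Q W"
      using Bernoulli_inequality[of "- measure Q W" "j - i"] Q.prob_le_1[of W] by simp
    finally show ?thesis .
  qed
  have bound': "\<bar>e k - e ?n\<bar> \<le> measure Q W * \<bar>real k - real ?n\<bar>" for k
    using bound[of k ?n] bound[of ?n k] by (cases "k \<le> ?n") (auto simp: abs_minus_commute mult.commute of_nat_diff)
  have "(\<integral>S. G S \<partial>poissonized l Q) = (\<integral>p. (\<lambda>(k, z). G (z ` {..<k})) p \<partial>(?P \<Otimes>\<^sub>M ?\<Pi>))"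
    unfolding poissonized_def by (subst integral_distr[OF m G]) (auto intro!: Bochner_Integration.integral_cong)
  also have "\<dots> = measure_pmf.expectation (poisson_pmf l) e"
    unfolding e_def
  proof (subst PP.integral_fst'[symmetric])
    have "(\<lambda>p. (\<lambda>(k, z). G (z ` {..<k})) p) \<in> borel_measurable (?P \<Otimes>\<^sub>M ?\<Pi>)"
      using measurable_compose[OF m G] by (simp add: case_prod_beta')
    then show "integrable (?P \<Otimes>\<^sub>M ?\<Pi>) (\<lambda>p. (\<lambda>(k, z). G (z ` {..<k})) p)"
      by (rule PP.integrable_const_bound[where B=1, rotated])
         (auto intro!: AE_I2 simp: G01 locally_finite_finite split: prod.split)
  qed simp
  finally have pois: "(\<integral>S. G S \<partial>poissonized l Q) = measure_pmf.expectation (poisson_pmf l) e" .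
  have e01: "0 \<le> e k" "e k \<le> 1" for k
    unfolding e_def
    by (auto intro!: integral_nonneg_AE AE_I2 P.P.integral_le_const P.P.integrable_const_bound[where B=1]
        measurable_compose[OF mk' G] simp: G01 locally_finite_finite)
  have ie: "integrable ?P e"
    by (rule measure_pmf.integrable_const_bound[where B=1]) (use e01 in \<open>auto simp: abs_le_iff intro: order_trans[of _ 0]\<close>)
  have "\<bar>e ?n - measure_pmf.expectation (poisson_pmf l) e\<bar> = \<bar>measure_pmf.expectation (poisson_pmf l) (\<lambda>k. e k - e ?n)\<bar>"
    using ie by (simp add: abs_minus_commute)
  also have "\<dots> \<le> measure_pmf.expectation (poisson_pmf l) (\<lambda>k. measure Q W * \<bar>real k - real ?n\<bar>)"
    by (rule order_trans[OF integral_abs_bound], rule integral_mono)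
       (use ie bound' poisson_mean_abs_deviation[OF l, of "real ?n"] in auto)
  also have "\<dots> \<le> measure Q W * sqrt (l + (l - real ?n)\<^sup>2)"
    using poisson_mean_abs_deviation[OF l, of "real ?n"] by (auto intro: mult_left_mono)
  finally show ?thesis by (simp add: sample pois)
qed

section \<open>Local functionals of Poisson processes\<close>

lemma homogeneous_poisson_law:
  assumes "homogeneous_poisson N \<tau> P"
  shows "poisson_law (\<lambda>B. \<tau> * measure lborel B) (distr N point_sets P)"
  unfolding poisson_law_def
proof (intro conjI allI impI)
  have N: "prob_space N" and P: "P \<in> measurable N point_sets"
    and void: "\<And>B k. B \<in> sets borel \<Longrightarrow> bounded B \<Longrightarrow> measure N {v \<in> space N. card (P v \<inter> B) = k} =
      (\<tau> * measure lborel B) ^ k / fact k * exp (- (\<tau> * measure lborel B))"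
    using assms by (auto simp: homogeneous_poisson_def)
  show "prob_space (distr N point_sets P)" using N P by (rule prob_space.prob_space_distr)
  fix B :: "'b set" assume B: "B \<in> sets borel" "bounded B"
  have lf: "locally_finite (P v)" if "v \<in> space N" for v
    using measurable_space[OF P that] by (simp add: space_point_sets)
  have "P -` {S. locally_finite S \<and> S \<inter> B = {}} \<inter> space N = {v \<in> space N. card (P v \<inter> B) = 0}"
    using lf B(2) by (auto simp: locally_finite_def)
  then show "measure (distr N point_sets P) {S. locally_finite S \<and> S \<inter> B = {}} = exp (- (\<tau> * measure lborel B))"
    using void[OF B, of 0] by (simp add: measure_distr[OF P void_sets[OF B(1)]])
qed simp

lemma poisson_law_avoid:
  assumes "poisson_law \<Lambda> L" "W \<in> sets borel" "bounded W"
  shows "measure L {S \<in> space L. S \<inter> W \<noteq> {}} = 1 - exp (- \<Lambda> W)"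
proof -
  interpret L: prob_space L using assms(1) by (rule poisson_law_prob)
  have "{S \<in> space L. S \<inter> W \<noteq> {}} = space L - {S. locally_finite S \<and> S \<inter> W = {}}"
    by (auto simp: poisson_law_space[OF assms(1)])
  then show ?thesis
    using assms void_sets[OF assms(2)] L.prob_compl[of "{S. locally_finite S \<and> S \<inter> W = {}}"]
    by (simp add: poisson_law_def)
qed

lemma poisson_law_restrict:
  fixes L :: "'a::euclidean_space set measure"
  assumes L: "poisson_law \<Lambda> L" and W: "W \<in> sets borel"
  shows "poisson_law (\<lambda>B. \<Lambda> (B \<inter> W)) (distr L point_sets (\<lambda>S. S \<inter> W))"
  by (rule poisson_law_map[OF L measurable_restrict_region[OF W]])
     (use W in \<open>auto intro: bounded_subset\<close>)

text \<open>A functional that is local to \<open>W\<close> has the same mean under the law and under its restriction to \<open>W\<close>, so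
  that intensities have to be compared on subsets of \<open>W\<close> only.\<close>

lemma integral_poisson_restrict:
  fixes L :: "'a::euclidean_space set measure" and g :: "'a set \<Rightarrow> real"
  assumes L: "poisson_law \<Lambda> L" and W: "W \<in> sets borel" and g: "g \<in> borel_measurable point_sets"
    and loc: "\<And>S. locally_finite S \<Longrightarrow> g (S \<inter> W) = g S"
  shows "(\<integral>S. g S \<partial>distr L point_sets (\<lambda>S. S \<inter> W)) = (\<integral>S. g S \<partial>L)"
  using loc
  by (subst integral_distr[OF poisson_law_measurable[OF L measurable_restrict_region[OF W]] g])
     (auto intro!: Bochner_Integration.integral_cong simp: poisson_law_space[OF L])

text \<open>The larger process is the smaller one with an independent Poisson process added, and the latter
  has no point in \<open>W\<close> except with probability at most its mean number of points there.\<close>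

lemma poisson_superposition_error:
  fixes L :: "'a::euclidean_space set measure"
  assumes L: "poisson_law \<Lambda> L" and L': "poisson_law \<Lambda>' L'" and \<nu>: "finite_measure \<nu>" "sets \<nu> = sets borel"
    and eq: "\<And>B. B \<in> sets borel \<Longrightarrow> B \<subseteq> W \<Longrightarrow> \<Lambda>' B = \<Lambda> B + measure \<nu> B"
    and g: "g \<in> borel_measurable point_sets" and g01: "\<And>S. locally_finite S \<Longrightarrow> 0 \<le> g S \<and> g S \<le> 1"
    and W: "W \<in> sets borel" "bounded W" and loc: "\<And>S. locally_finite S \<Longrightarrow> g (S \<inter> W) = (g S :: real)"
  shows "\<bar>(\<integral>S. g S \<partial>L') - (\<integral>S. g S \<partial>L)\<bar> \<le> measure \<nu> W"
proof -
  obtain L0 where L0: "poisson_law (measure \<nu>) L0" using poisson_law_exists[OF \<nu>] by blast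
  let ?R = "\<lambda>L. distr L point_sets (\<lambda>S. S \<inter> W)"
  note R = poisson_law_restrict[OF L W(1)] and R' = poisson_law_restrict[OF L' W(1)]
    and R0 = poisson_law_restrict[OF L0 W(1)]
  have R'_eq: "?R L' = distr (?R L \<Otimes>\<^sub>M ?R L0) point_sets (\<lambda>(S, T). S \<union> T)"
    by (rule poisson_law_unique[OF R' poisson_law_superpose[OF R R0]]) (use W in \<open>auto simp: eq\<close>)
  interpret A: prob_space "?R L" using R by (rule poisson_law_prob)
  interpret B: prob_space "?R L0" using R0 by (rule poisson_law_prob)
  interpret P: pair_prob_space "?R L" "?R L0" ..
  have m: "(\<lambda>(S, T). S \<union> T) \<in> measurable (?R L \<Otimes>\<^sub>M ?R L0) point_sets"
    using measurable_superpose by (simp cong: measurable_cong_sets sets_pair_measure_cong)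
  have mf: "fst \<in> measurable (?R L \<Otimes>\<^sub>M ?R L0) point_sets" and ms: "snd \<in> measurable (?R L \<Otimes>\<^sub>M ?R L0) point_sets"
    using measurable_fst[of "?R L" "?R L0"] measurable_snd[of "?R L" "?R L0"]
      measurable_cong_sets[OF refl sets_distr] by blast+
  let ?N = "{p \<in> space (?R L \<Otimes>\<^sub>M ?R L0). snd p \<inter> W \<noteq> {}}"
  have N: "?N = space (?R L \<Otimes>\<^sub>M ?R L0) - {p \<in> space (?R L \<Otimes>\<^sub>M ?R L0). snd p \<inter> W = {}}" by auto
  have Ns: "?N \<in> sets (?R L \<Otimes>\<^sub>M ?R L0)" unfolding N by (rule sets.compl_sets[OF void_pred[OF ms W(1)]])
  have lf: "locally_finite (fst p)" "locally_finite (snd p)" if "p \<in> space (?R L \<Otimes>\<^sub>M ?R L0)" for p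
    using that by (auto simp: space_pair_measure space_point_sets)
  have "\<bar>(\<integral>S. g S \<partial>?R L') - (\<integral>S. g S \<partial>?R L)\<bar> =
    \<bar>(\<integral>p. g (fst p \<union> snd p) \<partial>(?R L \<Otimes>\<^sub>M ?R L0)) - (\<integral>p. g (fst p) \<partial>(?R L \<Otimes>\<^sub>M ?R L0))\<bar>"
  proof -
    have "(\<integral>S. g S \<partial>?R L') = (\<integral>p. g (fst p \<union> snd p) \<partial>(?R L \<Otimes>\<^sub>M ?R L0))"
      unfolding R'_eq by (subst integral_distr[OF m g]) (auto intro!: Bochner_Integration.integral_cong)
    moreover have "(\<integral>S. g S \<partial>?R L) = (\<integral>p. g (fst p) \<partial>(?R L \<Otimes>\<^sub>M ?R L0))"
    proof -
      have "integrable (?R L \<Otimes>\<^sub>M ?R L0) (\<lambda>p. g (fst p))"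
        by (rule P.integrable_const_bound[where B=1]) (auto intro!: AE_I2 measurable_compose[OF mf g] simp: g01 lf)
      from P.integral_fst'[OF this] show ?thesis by (simp add: B.prob_space del: space_distr)
    qed
    ultimately show ?thesis by simp
  qed
  also have "\<dots> \<le> P.prob ?N"
  proof (rule P.expectation_diff_le_prob)
    fix p assume p: "p \<in> space (?R L \<Otimes>\<^sub>M ?R L0)" "p \<notin> ?N"
    then have "(fst p \<union> snd p) \<inter> W = fst p \<inter> W" by auto
    then show "g (fst p \<union> snd p) = g (fst p)"
      using loc[OF lf(1)[OF p(1)]] loc[OF locally_finite_Un[OF lf[OF p(1)]]] by simp
  qed (use Ns measurable_compose[OF m g] in \<open>auto intro!: measurable_compose[OF mf g] g01 lf locally_finite_Un simp: case_prod_beta'\<close>)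
  also have "\<dots> = measure (?R L0) {S \<in> space (?R L0). S \<inter> W \<noteq> {}}"
  proof -
    have "?N = space (?R L) \<times> {S \<in> space (?R L0). S \<inter> W \<noteq> {}}" by (auto simp: space_pair_measure)
    moreover have "{S \<in> space (?R L0). S \<inter> W \<noteq> {}} \<in> sets (?R L0)"
    proof -
      have "{S \<in> space (?R L0). S \<inter> W \<noteq> {}} = space (?R L0) - {S \<in> space (?R L0). S \<inter> W = {}}" by auto
      then show ?thesis using sets.compl_sets[OF void_pred[OF measurable_ident_sets[OF refl] W(1)]] by simp
    qed
    ultimately show ?thesis
      unfolding measure_def
      by (simp only: B.emeasure_pair_measure_Times[OF sets.top] A.emeasure_space_1 mult_1)
  qed
  also have "\<dots> = 1 - exp (- measure \<nu> W)" using poisson_law_avoid[OF R0 W] by simp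
  also have "\<dots> \<le> measure \<nu> W" using exp_ge_add_one_self[of "- measure \<nu> W"] by simp
  finally show ?thesis
    using integral_poisson_restrict[OF L W(1) g loc] integral_poisson_restrict[OF L' W(1) g loc] by simp
qed

lemma measure_density_real:
  fixes k :: "'a \<Rightarrow> real"
  assumes k: "integrable M k" "\<And>x. 0 \<le> k x" and B: "B \<in> sets M"
  shows "measure (density M (\<lambda>x. ennreal (k x))) B = (\<integral>x. indicator B x * k x \<partial>M)"
proof -
  have "emeasure (density M (\<lambda>x. ennreal (k x))) B = (\<integral>\<^sup>+x. ennreal (k x) * indicator B x \<partial>M)"
    using k B by (intro emeasure_density) auto
  also have "\<dots> = (\<integral>\<^sup>+x. ennreal (indicator B x * k x) \<partial>M)"
    by (intro nn_integral_cong) (auto simp: indicator_def)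
  also have "\<dots> = ennreal (\<integral>x. indicator B x * k x \<partial>M)"
    using k integrable_mult_indicator[OF B k(1)] by (intro nn_integral_eq_integral) auto
  finally show ?thesis using k by (simp add: measure_def)
qed

lemma finite_measure_density_real:
  fixes k :: "'a \<Rightarrow> real"
  assumes k: "integrable M k" "\<And>x. 0 \<le> k x"
  shows "finite_measure (density M (\<lambda>x. ennreal (k x)))"
proof (rule finite_measureI)
  have "emeasure (density M (\<lambda>x. ennreal (k x))) (space M) = (\<integral>\<^sup>+x. ennreal (k x) \<partial>M)"
    using k by (subst emeasure_density) (auto intro!: nn_integral_cong)
  also have "\<dots> < \<infinity>" using nn_integral_eq_integral[OF k(1)] k(2) by simp
  finally show "emeasure (density M (\<lambda>x. ennreal (k x))) (space (density M (\<lambda>x. ennreal (k x)))) \<noteq> \<infinity>" by simp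
qed

text \<open>Both processes contain the one whose density is the pointwise minimum.\<close>

lemma poisson_density_error:
  fixes L1 L2 :: "'a::euclidean_space set measure" and h1 h2 :: "'a \<Rightarrow> real"
  assumes L: "poisson_law \<Lambda>1 L1" "poisson_law \<Lambda>2 L2"
    and h1: "set_integrable lborel W h1" "\<And>x. 0 \<le> h1 x" and h2: "set_integrable lborel W h2" "\<And>x. 0 \<le> h2 x"
    and \<Lambda>: "\<And>B. B \<in> sets borel \<Longrightarrow> B \<subseteq> W \<Longrightarrow> \<Lambda>1 B = (LINT x:B|lborel. h1 x)"
        "\<And>B. B \<in> sets borel \<Longrightarrow> B \<subseteq> W \<Longrightarrow> \<Lambda>2 B = (LINT x:B|lborel. h2 x)"
    and g: "g \<in> borel_measurable point_sets" and g01: "\<And>S. locally_finite S \<Longrightarrow> 0 \<le> g S \<and> g S \<le> 1"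
    and W: "W \<in> sets borel" "bounded W" and loc: "\<And>S. locally_finite S \<Longrightarrow> g (S \<inter> W) = (g S :: real)"
  shows "\<bar>(\<integral>S. g S \<partial>L1) - (\<integral>S. g S \<partial>L2)\<bar> \<le> (LINT x:W|lborel. \<bar>h1 x - h2 x\<bar>)"
proof -
  define H1 H2 where "H1 x = indicator W x * h1 x" and "H2 x = indicator W x * h2 x" for x
  have H: "integrable lborel H1" "integrable lborel H2" "\<And>x. 0 \<le> H1 x" "\<And>x. 0 \<le> H2 x"
    using h1 h2 by (auto simp: H1_def[abs_def] H2_def[abs_def] set_integrable_def)
  define k where "k x = min (H1 x) (H2 x)" for x
  have k: "integrable lborel k" "\<And>x. 0 \<le> k x" using H by (auto simp: k_def[abs_def])
  have d: "integrable lborel (\<lambda>x. H1 x - k x)" "integrable lborel (\<lambda>x. H2 x - k x)"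
      "\<And>x. 0 \<le> H1 x - k x" "\<And>x. 0 \<le> H2 x - k x"
    using H k by (auto simp: k_def)
  let ?\<nu> = "\<lambda>k. density lborel (\<lambda>x. ennreal (k x))"
  obtain L0 where L0: "poisson_law (measure (?\<nu> k)) L0"
    using poisson_law_exists[of "?\<nu> k"] finite_measure_density_real[OF k] by auto
  have eq: "\<Lambda>1 B = measure (?\<nu> k) B + measure (?\<nu> (\<lambda>x. H1 x - k x)) B"
      "\<Lambda>2 B = measure (?\<nu> k) B + measure (?\<nu> (\<lambda>x. H2 x - k x)) B" if B: "B \<in> sets borel" "B \<subseteq> W" for B
  proof -
    have i: "integrable lborel (\<lambda>x. indicator B x * F x)" if "integrable lborel F" for F :: "'a \<Rightarrow> real"
      using integrable_mult_indicator[of B lborel F] that B by simp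
    have "(LINT x:B|lborel. h1 x) = (\<integral>x. indicator B x * H1 x \<partial>lborel)"
        "(LINT x:B|lborel. h2 x) = (\<integral>x. indicator B x * H2 x \<partial>lborel)"
      unfolding set_lebesgue_integral_def using B(2)
      by (auto intro!: Bochner_Integration.integral_cong simp: H1_def H2_def indicator_def)
    moreover have "measure (?\<nu> (\<lambda>x. H1 x - k x)) B = (\<integral>x. indicator B x * H1 x \<partial>lborel) - measure (?\<nu> k) B"
        "measure (?\<nu> (\<lambda>x. H2 x - k x)) B = (\<integral>x. indicator B x * H2 x \<partial>lborel) - measure (?\<nu> k) B"
      using B measure_density_real[OF d(1,3), of B] measure_density_real[OF d(2,4), of B]
        measure_density_real[OF k, of B] i[OF H(1)] i[OF H(2)] i[OF k(1)]
      by (simp_all add: right_diff_distrib)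
    ultimately show "\<Lambda>1 B = measure (?\<nu> k) B + measure (?\<nu> (\<lambda>x. H1 x - k x)) B"
      "\<Lambda>2 B = measure (?\<nu> k) B + measure (?\<nu> (\<lambda>x. H2 x - k x)) B"
      using \<Lambda>[OF B] by linarith+
  qed
  have WI: "(\<integral>x. indicator W x * (H1 x - k x) \<partial>lborel) = (\<integral>x. H1 x - k x \<partial>lborel)"
       "(\<integral>x. indicator W x * (H2 x - k x) \<partial>lborel) = (\<integral>x. H2 x - k x \<partial>lborel)"
    by (auto intro!: Bochner_Integration.integral_cong simp: H1_def H2_def k_def indicator_def)
  have "\<bar>(\<integral>S. g S \<partial>L1) - (\<integral>S. g S \<partial>L0)\<bar> \<le> measure (?\<nu> (\<lambda>x. H1 x - k x)) W"
    by (rule poisson_superposition_error[OF L0 L(1) _ _ _ g g01 W loc])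
       (auto intro: finite_measure_density_real d eq(1))
  moreover have "\<bar>(\<integral>S. g S \<partial>L2) - (\<integral>S. g S \<partial>L0)\<bar> \<le> measure (?\<nu> (\<lambda>x. H2 x - k x)) W"
    by (rule poisson_superposition_error[OF L0 L(2) _ _ _ g g01 W loc])
       (auto intro: finite_measure_density_real d eq(2))
  ultimately have "\<bar>(\<integral>S. g S \<partial>L1) - (\<integral>S. g S \<partial>L2)\<bar> \<le> (\<integral>x. H1 x - k x \<partial>lborel) + (\<integral>x. H2 x - k x \<partial>lborel)"
    using W(1) d by (simp add: measure_density_real WI)
  also have "\<dots> = (\<integral>x. (H1 x - k x) + (H2 x - k x) \<partial>lborel)"
    by (rule Bochner_Integration.integral_add[OF d(1,2), symmetric])
  also have "\<dots> = (LINT x:W|lborel. \<bar>h1 x - h2 x\<bar>)"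
    unfolding set_lebesgue_integral_def
    by (auto intro!: Bochner_Integration.integral_cong simp: H1_def H2_def k_def indicator_def)
  finally show ?thesis .
qed

text \<open>Independence of disjoint regions: replacing a Poisson process outside \<open>A\<close> by an independent copy
  does not change its void probabilities, hence not its law.\<close>

lemma poisson_independent_regions:
  fixes L :: "'a::euclidean_space set measure" and g k :: "'a set \<Rightarrow> real"
  assumes L: "poisson_law \<Lambda> L"
    and A: "A \<in> sets borel" and add: "\<And>B. B \<in> sets borel \<Longrightarrow> bounded B \<Longrightarrow> \<Lambda> B = \<Lambda> (B \<inter> A) + \<Lambda> (B - A)"
    and g: "g \<in> borel_measurable point_sets" "\<And>S. locally_finite S \<Longrightarrow> 0 \<le> g S \<and> g S \<le> 1"
      "\<And>S. locally_finite S \<Longrightarrow> g (S \<inter> A) = g S"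
    and k: "k \<in> borel_measurable point_sets" "\<And>S. locally_finite S \<Longrightarrow> 0 \<le> k S \<and> k S \<le> 1"
      "\<And>S. locally_finite S \<Longrightarrow> k (S - A) = k S"
  shows "(\<integral>S. g S * k S \<partial>L) = (\<integral>S. g S \<partial>L) * (\<integral>S. k S \<partial>L)"
proof -
  interpret L: prob_space L using L by (rule poisson_law_prob)
  interpret P: pair_prob_space L L ..
  have sp: "space L = {S. locally_finite S}" using L by (rule poisson_law_space)
  have "(\<lambda>S. S - A) = (\<lambda>S. S \<inter> (- A))" by auto
  then have mA: "(\<lambda>S. S - A) \<in> measurable L point_sets" "(\<lambda>S. S \<inter> A) \<in> measurable L point_sets"
    using A by (auto intro!: poisson_law_measurable[OF L] measurable_restrict_region)
  have m: "(\<lambda>p. (fst p \<inter> A) \<union> (snd p - A)) \<in> measurable (L \<Otimes>\<^sub>M L) point_sets"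
    using measurable_compose[OF measurable_Pair[OF measurable_compose[OF measurable_fst mA(2)] measurable_compose[OF measurable_snd mA(1)]] measurable_superpose]
    by simp
  have lfD: "locally_finite (S - A)" if "locally_finite S" for S
    using locally_finite_Int[OF that, of "-A"] by (simp add: Diff_eq)
  have "L = distr (L \<Otimes>\<^sub>M L) point_sets (\<lambda>p. (fst p \<inter> A) \<union> (snd p - A))" (is "_ = ?D")
  proof (rule poisson_law_unique[OF L])
    show "poisson_law \<Lambda> ?D"
      unfolding poisson_law_def
    proof (intro conjI allI impI)
      show "prob_space ?D" using m by (rule P.prob_space_distr)
      fix B :: "'a set" assume B: "B \<in> sets borel" "bounded B"
      let ?V = "\<lambda>B. {S. locally_finite S \<and> S \<inter> B = {}}"
      have BA: "B \<inter> A \<in> sets borel" "B - A \<in> sets borel" "bounded (B \<inter> A)" "bounded (B - A)"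
        using A B by (auto intro: bounded_subset)
      have V: "?V (B \<inter> A) \<in> sets L" "?V (B - A) \<in> sets L"
        using void_sets[OF BA(1)] void_sets[OF BA(2)] poisson_law_sets[OF L] by auto
      have "(\<lambda>p. (fst p \<inter> A) \<union> (snd p - A)) -` ?V B \<inter> space (L \<Otimes>\<^sub>M L) = ?V (B \<inter> A) \<times> ?V (B - A)"
        by (auto simp: space_pair_measure sp intro!: locally_finite_Un locally_finite_Int lfD)
      moreover have "measure (L \<Otimes>\<^sub>M L) (?V (B \<inter> A) \<times> ?V (B - A)) = measure L (?V (B \<inter> A)) * measure L (?V (B - A))"
        using V by (simp add: measure_def L.emeasure_pair_measure_Times enn2real_mult)
      ultimately show "measure ?D (?V B) = exp (- \<Lambda> B)"
        using L BA add[OF B] by (simp add: measure_distr[OF m void_sets[OF B(1)]] poisson_law_def exp_add[symmetric])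
    qed simp
  qed simp
  then have "(\<integral>S. g S * k S \<partial>L) = (\<integral>S. g S * k S \<partial>?D)" by simp
  also have "\<dots> = (\<integral>p. g (fst p) * k (snd p) \<partial>(L \<Otimes>\<^sub>M L))"
  proof (subst integral_distr[OF m], use g k in measurable, rule Bochner_Integration.integral_cong[OF refl])
    fix p assume "p \<in> space (L \<Otimes>\<^sub>M L)"
    then have lf: "locally_finite (fst p)" "locally_finite (snd p)" by (auto simp: space_pair_measure sp)
    let ?U = "(fst p \<inter> A) \<union> (snd p - A)"
    have U: "locally_finite ?U" "?U \<inter> A = fst p \<inter> A" "?U - A = snd p - A"
      using lf by (auto intro!: locally_finite_Un locally_finite_Int lfD)
    show "g ?U * k ?U = g (fst p) * k (snd p)"
      using g(3)[OF lf(1)] g(3)[OF U(1)] k(3)[OF lf(2)] k(3)[OF U(1)] U(2,3) by simp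
  qed
  also have "\<dots> = (\<integral>S. g S \<partial>L) * (\<integral>S. k S \<partial>L)"
  proof -
    have gk: "g \<in> borel_measurable L" "k \<in> borel_measurable L"
      using g(1) k(1) by (auto intro: poisson_law_measurable[OF L])
    have "integrable (L \<Otimes>\<^sub>M L) (\<lambda>p. g (fst p) * k (snd p))"
      using gk g(2) k(2)
      by (intro P.integrable_const_bound[where B=1])
         (auto intro!: AE_I2 mult_le_one simp: space_pair_measure sp abs_mult)
    from P.integral_fst'[OF this] show ?thesis by simp
  qed
  finally show ?thesis .
qed

section \<open>Poisson processes seen from a point\<close>

lemma nn_integral_affine:
  fixes F :: "'a::euclidean_space \<Rightarrow> ennreal"
  assumes [measurable]: "F \<in> borel_measurable borel" and c: "c \<noteq> 0"
  shows "(\<integral>\<^sup>+z. F z \<partial>lborel) = ennreal (\<bar>c\<bar> ^ DIM('a)) * (\<integral>\<^sup>+u. F (x + c *\<^sub>R u) \<partial>lborel)"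
  by (subst lborel_affine[OF c, of x])
     (simp add: nn_integral_density nn_integral_distr nn_integral_cmult)

lemma integrable_affine:
  fixes f :: "'a::euclidean_space \<Rightarrow> real"
  assumes f: "integrable lborel f" and c: "c \<noteq> 0"
  shows "integrable lborel (\<lambda>u. f (x + c *\<^sub>R u))"
proof -
  have [measurable]: "f \<in> borel_measurable borel" using f by auto
  have "(\<integral>\<^sup>+z. norm (f z) \<partial>lborel) < \<infinity>" using f by (simp add: integrable_iff_bounded)
  then have "(\<integral>\<^sup>+u. norm (f (x + c *\<^sub>R u)) \<partial>lborel) < \<infinity>"
    using c by (subst (asm) nn_integral_affine[where c=c and x=x]) (auto simp: ennreal_mult_less_top)
  then show ?thesis by (simp add: integrable_iff_bounded)
qed

text \<open>Magnifying a neighbourhood of \<open>x\<close> by the factor \<open>c\<close> turns the intensity \<open>c\<^sup>d f\<close> into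
  \<open>u \<mapsto> f (x + u / c)\<close>.\<close>

lemma magnified_mass:
  fixes f :: "'a::euclidean_space \<Rightarrow> real"
  assumes f: "integrable lborel f" "\<And>z. 0 \<le> f z" and c: "0 < c" and B: "B \<in> sets borel"
  shows "c ^ DIM('a) * measure (density lborel (\<lambda>z. ennreal (f z))) ((\<lambda>z. c *\<^sub>R (z - x)) -` B) =
     (LINT u:B|lborel. f (x + (1 / c) *\<^sub>R u))"
proof -
  have m: "(\<lambda>z. c *\<^sub>R (z - x)) \<in> measurable borel borel" by measurable
  have T: "(\<lambda>z. c *\<^sub>R (z - x)) -` B \<in> sets borel" using measurable_sets[OF m B] by simp
  have [measurable]: "f \<in> borel_measurable borel" using f by auto
  have e: "indicator ((\<lambda>z. c *\<^sub>R (z - x)) -` B) (x + (1 / c) *\<^sub>R u) = (indicator B u :: ennreal)" for u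
    using c by (simp add: indicator_def)
  have i: "integrable lborel (\<lambda>u. indicator B u * f (x + (1 / c) *\<^sub>R u))"
    using integrable_mult_indicator[OF _ integrable_affine[OF f(1), of "1/c" x], of B] B c by simp
  have "emeasure (density lborel (\<lambda>z. ennreal (f z))) ((\<lambda>z. c *\<^sub>R (z - x)) -` B) =
      (\<integral>\<^sup>+z. ennreal (f z) * indicator ((\<lambda>z. c *\<^sub>R (z - x)) -` B) z \<partial>lborel)"
    using T by (intro emeasure_density) auto
  also have "\<dots> = ennreal (\<bar>1 / c\<bar> ^ DIM('a)) * (\<integral>\<^sup>+u. ennreal (f (x + (1 / c) *\<^sub>R u)) * indicator B u \<partial>lborel)"
    using T c by (subst nn_integral_affine[where c="1/c" and x=x]) (auto simp: e)
  also have "(\<integral>\<^sup>+u. ennreal (f (x + (1 / c) *\<^sub>R u)) * indicator B u \<partial>lborel) =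
      (\<integral>\<^sup>+u. ennreal (indicator B u * f (x + (1 / c) *\<^sub>R u)) \<partial>lborel)"
    by (intro nn_integral_cong) (auto simp: indicator_def)
  also have "\<dots> = ennreal (LINT u:B|lborel. f (x + (1 / c) *\<^sub>R u))"
    unfolding set_lebesgue_integral_def using i f(2) by (subst nn_integral_eq_integral) auto
  finally show ?thesis
    using c f(2) by (simp add: measure_def ennreal_mult[symmetric] set_lebesgue_integral_def power_divide)
qed

lemma poisson_local_error:
  fixes f :: "'a::euclidean_space \<Rightarrow> real"
  assumes f: "integrable lborel f" "\<And>z. 0 \<le> f z" and c: "0 < c"
    and L: "poisson_law (\<lambda>B. c ^ DIM('a) * measure (density lborel (\<lambda>z. ennreal (f z))) B) L"
    and L\<tau>: "poisson_law (\<lambda>B. \<tau> * measure lborel B) L\<tau>" and \<tau>: "0 \<le> \<tau>"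
    and g: "g \<in> borel_measurable point_sets" and g01: "\<And>S. locally_finite S \<Longrightarrow> 0 \<le> g S \<and> g S \<le> 1"
    and W: "W \<in> sets borel" "bounded W" and loc: "\<And>S. locally_finite S \<Longrightarrow> g (S \<inter> W) = (g S :: real)"
  shows "\<bar>(\<integral>S. g ((\<lambda>z. c *\<^sub>R (z - x)) ` S) \<partial>L) - (\<integral>S. g S \<partial>L\<tau>)\<bar> \<le>
     (LINT u:W|lborel. \<bar>f (x + (1 / c) *\<^sub>R u) - \<tau>\<bar>)"
proof -
  let ?T = "\<lambda>z. c *\<^sub>R (z - x)"
  have m: "(\<lambda>S. ?T ` S) \<in> measurable point_sets point_sets" using c by (intro measurable_affine_point_sets) auto
  have TB: "?T -` B \<in> sets borel \<and> bounded (?T -` B)" if "B \<in> sets borel" "bounded B" for B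
  proof
    have "?T \<in> measurable borel borel" by measurable
    then show "?T -` B \<in> sets borel" using measurable_sets[of ?T borel borel B] that by simp
    have "?T -` B \<subseteq> (\<lambda>u. x + u) ` (\<lambda>u. (1/c) *\<^sub>R u) ` B"
    proof
      fix z assume "z \<in> ?T -` B"
      then have "z = x + (1/c) *\<^sub>R ?T z" "?T z \<in> B" using c by auto
      then show "z \<in> (\<lambda>u. x + u) ` (\<lambda>u. (1/c) *\<^sub>R u) ` B" by blast
    qed
    then show "bounded (?T -` B)"
      using that(2) by (meson bounded_subset bounded_translation bounded_scaling)
  qed
  have LT: "poisson_law (\<lambda>B. c ^ DIM('a) * measure (density lborel (\<lambda>z. ennreal (f z))) (?T -` B)) (distr L point_sets (\<lambda>S. ?T ` S))"
    by (rule poisson_law_map[OF L m]) (use TB in auto)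
  have "\<bar>(\<integral>S. g S \<partial>distr L point_sets (\<lambda>S. ?T ` S)) - (\<integral>S. g S \<partial>L\<tau>)\<bar> \<le>
     (LINT u:W|lborel. \<bar>f (x + (1 / c) *\<^sub>R u) - \<tau>\<bar>)"
  proof (rule poisson_density_error[OF LT L\<tau> _ _ _ _ _ _ g g01 W loc])
    show "set_integrable lborel W (\<lambda>u. f (x + (1 / c) *\<^sub>R u))"
      unfolding set_integrable_def using W c by (intro integrable_mult_indicator integrable_affine f) auto
    have "emeasure lborel W < \<infinity>" using emeasure_bounded_finite[OF W(2)] by simp
    then show "set_integrable lborel W (\<lambda>u. \<tau>)" using W by (simp add: set_integrable_def)
    show "\<tau> * measure lborel B = (LINT x:B|lborel. \<tau>)" if "B \<in> sets borel" for B
      by (simp add: set_lebesgue_integral_def)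
  qed (use f \<tau> magnified_mass[OF f c] in auto)
  then show ?thesis
    by (subst (asm) integral_distr[OF poisson_law_measurable[OF L m] g])
qed

section \<open>Local oscillation of an integrable function\<close>

lemma lborel_shift:
  fixes f :: "'a::euclidean_space \<Rightarrow> real"
  assumes f: "integrable lborel f"
  shows "integrable lborel (\<lambda>x. f (x + h))" "(\<integral>x. f (x + h) \<partial>lborel) = (\<integral>x. f x \<partial>lborel)"
proof -
  show "integrable lborel (\<lambda>x. f (x + h))"
    using integrable_affine[OF f, of 1 h] by (simp add: add.commute)
  have [measurable]: "f \<in> borel_measurable borel" using f by auto
  have "(\<integral>x. f x \<partial>lborel) = (\<integral>x. f x \<partial>distr lborel borel ((+) h))"
    by (simp add: lborel_distr_plus)
  also have "\<dots> = (\<integral>x. f (x + h) \<partial>lborel)"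
    by (subst integral_distr) (auto simp: add.commute)
  finally show "(\<integral>x. f (x + h) \<partial>lborel) = (\<integral>x. f x \<partial>lborel)" by simp
qed

text \<open>A shift \<open>h\<close> preserves the measure of \<open>U\<close>, so \<open>U\<close> and its translate differ by twice the part of
  \<open>U\<close> that the shift moves out of \<open>U\<close>; each point of an open \<open>U\<close> is eventually not in that part.\<close>

lemma open_shift_L1:
  fixes U :: "'a::euclidean_space set"
  assumes U: "open U" "emeasure lborel U < \<infinity>" and h: "h \<longlonglongrightarrow> 0"
  shows "(\<lambda>n::nat. \<integral>x. \<bar>indicator U (x + h n) - indicator U x\<bar> \<partial>lborel) \<longlonglongrightarrow> (0::real)"
proof -
  let ?I = "indicator U :: 'a \<Rightarrow> real"
  have [measurable]: "U \<in> sets borel" using U by simp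
  have I: "integrable lborel ?I" using U by (simp add: integrable_indicator_iff)
  have out: "(\<lambda>n. \<integral>x. ?I x * (1 - ?I (x + h n)) \<partial>lborel) \<longlonglongrightarrow> (\<integral>x. 0 \<partial>(lborel :: 'a measure))"
  proof (rule integral_dominated_convergence[where w="?I"])
    show "AE x in lborel. (\<lambda>n. ?I x * (1 - ?I (x + h n))) \<longlonglongrightarrow> 0"
    proof (rule AE_I2)
      fix x
      show "(\<lambda>n. ?I x * (1 - ?I (x + h n))) \<longlonglongrightarrow> 0"
      proof (cases "x \<in> U")
        case True
        have "(\<lambda>n. x + h n) \<longlonglongrightarrow> x + 0" by (intro tendsto_intros h)
        then have "\<forall>\<^sub>F n in sequentially. x + h n \<in> U" using True U(1) by (auto dest: topological_tendstoD)
        then have "\<forall>\<^sub>F n in sequentially. ?I x * (1 - ?I (x + h n)) = 0" by eventually_elim simp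
        then show ?thesis by (rule tendsto_eventually)
      qed simp
    qed
  qed (use I in \<open>auto simp: indicator_def\<close>)
  have i: "integrable lborel (\<lambda>x. ?I x * (1 - ?I (x + h n)))" for n
    by (rule Bochner_Integration.integrable_bound[OF I]) (auto simp: indicator_def)
  have "(\<integral>x. \<bar>?I (x + h n) - ?I x\<bar> \<partial>lborel) = 2 * (\<integral>x. ?I x * (1 - ?I (x + h n)) \<partial>lborel)" for n
  proof -
    have "(\<integral>x. \<bar>?I (x + h n) - ?I x\<bar> \<partial>lborel) = (\<integral>x. (?I (x + h n) - ?I x) + 2 * (?I x * (1 - ?I (x + h n))) \<partial>lborel)"
      by (intro Bochner_Integration.integral_cong) (auto simp: indicator_def)
    also have "\<dots> = (\<integral>x. ?I (x + h n) \<partial>lborel) - (\<integral>x. ?I x \<partial>lborel) + 2 * (\<integral>x. ?I x * (1 - ?I (x + h n)) \<partial>lborel)"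
      using i lborel_shift(1)[OF I] I by (subst Bochner_Integration.integral_add) auto
    finally show ?thesis using lborel_shift(2)[OF I] by simp
  qed
  then show ?thesis using tendsto_mult_right_zero[of _ _ "2::real"] out by simp
qed

text \<open>Integrable functions are limits of simple ones, and a set of finite measure lies in an open set that is
  only slightly larger.\<close>

lemma L1_shift_continuous:
  fixes f :: "'a::euclidean_space \<Rightarrow> real"
  assumes f: "integrable lborel f" and h: "h \<longlonglongrightarrow> 0"
  shows "(\<lambda>n::nat. \<integral>x. \<bar>f (x + h n) - f x\<bar> \<partial>lborel) \<longlonglongrightarrow> 0"
proof -
  \<comment> \<open>the property is preserved by perturbations small in \<open>L\<^sup>1\<close>\<close>
  have approx: "(\<lambda>n. \<integral>x. \<bar>f (x + h n) - f x\<bar> \<partial>lborel) \<longlonglongrightarrow> 0"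
    if f: "integrable lborel f" and g: "\<And>e. 0 < e \<Longrightarrow> \<exists>g. integrable lborel g \<and> (\<integral>x. \<bar>f x - g x\<bar> \<partial>lborel) < e \<and>
        (\<lambda>n. \<integral>x. \<bar>g (x + h n) - g x\<bar> \<partial>lborel) \<longlonglongrightarrow> 0" for f :: "'a \<Rightarrow> real"
  proof (rule LIMSEQ_I)
    fix r :: real assume "0 < r"
    then obtain g where g: "integrable lborel g" "(\<integral>x. \<bar>f x - g x\<bar> \<partial>lborel) < r / 3"
        "(\<lambda>n. \<integral>x. \<bar>g (x + h n) - g x\<bar> \<partial>lborel) \<longlonglongrightarrow> 0"
      using g[of "r / 3"] by auto
    have d: "integrable lborel (\<lambda>x. \<bar>f x - g x\<bar>)" using f g by auto
    have le: "(\<integral>x. \<bar>f (x + h n) - f x\<bar> \<partial>lborel) \<le> 2 * (\<integral>x. \<bar>f x - g x\<bar> \<partial>lborel) + (\<integral>x. \<bar>g (x + h n) - g x\<bar> \<partial>lborel)" for n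
    proof -
      have "(\<integral>x. \<bar>f (x + h n) - f x\<bar> \<partial>lborel) \<le>
          (\<integral>x. \<bar>f (x + h n) - g (x + h n)\<bar> + \<bar>f x - g x\<bar> + \<bar>g (x + h n) - g x\<bar> \<partial>lborel)"
        using f g d lborel_shift(1)[OF f] lborel_shift(1)[OF g(1)] lborel_shift(1)[OF d]
        by (intro integral_mono) auto
      also have "\<dots> = (\<integral>x. \<bar>f (x + h n) - g (x + h n)\<bar> \<partial>lborel) + (\<integral>x. \<bar>f x - g x\<bar> \<partial>lborel) + (\<integral>x. \<bar>g (x + h n) - g x\<bar> \<partial>lborel)"
        using d g lborel_shift(1)[OF g(1)] lborel_shift(1)[OF d] by simp
      also have "(\<integral>x. \<bar>f (x + h n) - g (x + h n)\<bar> \<partial>lborel) = (\<integral>x. \<bar>f x - g x\<bar> \<partial>lborel)"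
        using lborel_shift(2)[OF d] by simp
      finally show ?thesis by simp
    qed
    obtain n0 where n0: "\<And>n. n \<ge> n0 \<Longrightarrow> \<bar>\<integral>x. \<bar>g (x + h n) - g x\<bar> \<partial>lborel\<bar> < r / 3"
      using LIMSEQ_D[OF g(3), of "r/3"] \<open>0 < r\<close> by auto
    show "\<exists>n0. \<forall>n\<ge>n0. norm ((\<integral>x. \<bar>f (x + h n) - f x\<bar> \<partial>lborel) - 0) < r"
    proof (intro exI[of _ n0] allI impI)
      fix n assume "n0 \<le> n"
      moreover have "0 \<le> (\<integral>x. \<bar>f (x + h n) - f x\<bar> \<partial>lborel)" by simp
      ultimately show "norm ((\<integral>x. \<bar>f (x + h n) - f x\<bar> \<partial>lborel) - 0) < r"
        using le[of n] n0[of n] g(2) by simp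
    qed
  qed
  show ?thesis using f
  proof (induction rule: integrable_induct)
    case (base A c)
    show ?case
    proof (rule approx)
      have [measurable]: "A \<in> sets borel" using base by simp
      show int: "integrable lborel (\<lambda>x. indicator A x *\<^sub>R c)" using base by (simp add: integrable_indicator_iff)
      fix e :: real assume e: "0 < e"
      obtain U where U: "open U" "A \<subseteq> U" "emeasure lborel (U - A) < ennreal (e / (\<bar>c\<bar> + 1))"
        using outer_regular_lborel[of A "e / (\<bar>c\<bar> + 1)"] e by (metis \<open>A \<in> sets borel\<close> divide_pos_pos abs_add_one_gt_zero add.commute)
      have [measurable]: "U \<in> sets borel" using U by simp
      have "emeasure lborel U \<le> emeasure lborel A + emeasure lborel (U - A)"
        using emeasure_subadditive[of A lborel "U - A"] U(2) by (simp add: Un_absorb1)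
      also have "\<dots> < \<infinity>" using base(2) U(3) by (metis ennreal_add_less_top infinity_ennreal_def order_less_trans ennreal_less_top)
      finally have Uf: "emeasure lborel U < \<infinity>" .
      let ?g = "\<lambda>x. indicator U x *\<^sub>R c"
      have ig: "integrable lborel ?g" using Uf by (simp add: integrable_indicator_iff)
      have "(\<integral>x. \<bar>indicator A x *\<^sub>R c - ?g x\<bar> \<partial>lborel) = (\<integral>x. \<bar>c\<bar> * indicator (U - A) x \<partial>lborel)"
        using U(2) by (intro Bochner_Integration.integral_cong) (auto simp: indicator_def)
      also have "\<dots> = \<bar>c\<bar> * measure lborel (U - A)" by simp
      also have "measure lborel (U - A) < e / (\<bar>c\<bar> + 1)"
      proof -
        have "0 < e / (\<bar>c\<bar> + 1)" using e by simp
        then show ?thesis using U(3) unfolding measure_def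
          by (metis enn2real_less_iff less_imp_le ennreal_less_top order_less_trans enn2real_ennreal)
      qed
      then have "\<bar>c\<bar> * measure lborel (U - A) \<le> \<bar>c\<bar> * (e / (\<bar>c\<bar> + 1))" by (intro mult_left_mono) auto
      also have "\<dots> < e" using e by (simp add: divide_simps algebra_simps)
      finally have "(\<integral>x. \<bar>indicator A x *\<^sub>R c - ?g x\<bar> \<partial>lborel) < e" by simp
      moreover have "(\<lambda>n. \<integral>x. \<bar>?g (x + h n) - ?g x\<bar> \<partial>lborel) \<longlonglongrightarrow> 0"
      proof -
        have "(\<integral>x. \<bar>?g (x + h n) - ?g x\<bar> \<partial>lborel) = \<bar>c\<bar> * (\<integral>x. \<bar>indicator U (x + h n) - indicator U x\<bar> \<partial>lborel)" for n
        proof -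
          have "(\<lambda>x. \<bar>?g (x + h n) - ?g x\<bar>) = (\<lambda>x. \<bar>c\<bar> * \<bar>indicator U (x + h n) - indicator U x\<bar>)"
            by (auto simp: indicator_def)
          then show ?thesis by (simp only: Bochner_Integration.integral_mult_right_zero)
        qed
        then show ?thesis using tendsto_mult_right_zero[OF open_shift_L1[OF U(1) Uf h]] by simp
      qed
      ultimately show "\<exists>g. integrable lborel g \<and> (\<integral>x. \<bar>indicator A x *\<^sub>R c - g x\<bar> \<partial>lborel) < e \<and>
        (\<lambda>n. \<integral>x. \<bar>g (x + h n) - g x\<bar> \<partial>lborel) \<longlonglongrightarrow> 0" using ig by blast
    qed
  next
    case (add f g)
    have L: "(\<lambda>n. (\<integral>x. \<bar>f (x + h n) - f x\<bar> \<partial>lborel) + (\<integral>x. \<bar>g (x + h n) - g x\<bar> \<partial>lborel)) \<longlonglongrightarrow> 0"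
      using tendsto_add[OF add.IH] by simp
    have B: "(\<integral>x. \<bar>f (x + h n) + g (x + h n) - (f x + g x)\<bar> \<partial>lborel) \<le>
        (\<integral>x. \<bar>f (x + h n) - f x\<bar> \<partial>lborel) + (\<integral>x. \<bar>g (x + h n) - g x\<bar> \<partial>lborel)" for n
    proof -
      have i: "integrable lborel (\<lambda>x. \<bar>f (x + h n) - f x\<bar>)" "integrable lborel (\<lambda>x. \<bar>g (x + h n) - g x\<bar>)"
        using add.hyps lborel_shift(1)[OF add.hyps(1)] lborel_shift(1)[OF add.hyps(2)] by auto
      have "(\<integral>x. \<bar>f (x + h n) + g (x + h n) - (f x + g x)\<bar> \<partial>lborel) \<le>
          (\<integral>x. \<bar>f (x + h n) - f x\<bar> + \<bar>g (x + h n) - g x\<bar> \<partial>lborel)"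
        using i add.hyps lborel_shift(1)[OF add.hyps(1)] lborel_shift(1)[OF add.hyps(2)]
        by (intro integral_mono) auto
      then show ?thesis using Bochner_Integration.integral_add[OF i] by simp
    qed
    show ?case
    proof (rule Lim_null_comparison[OF always_eventually[OF allI] L])
      show "norm (\<integral>x. \<bar>f (x + h n) + g (x + h n) - (f x + g x)\<bar> \<partial>lborel) \<le>
          (\<integral>x. \<bar>f (x + h n) - f x\<bar> \<partial>lborel) + (\<integral>x. \<bar>g (x + h n) - g x\<bar> \<partial>lborel)" for n
      proof -
        have "0 \<le> (\<integral>x. \<bar>f (x + h n) + g (x + h n) - (f x + g x)\<bar> \<partial>lborel)"
          by (rule integral_nonneg_AE) simp
        then show ?thesis using B[of n] by (simp only: real_norm_def abs_of_nonneg)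
      qed
    qed
  next
    case (lim f s)
    have "(\<lambda>i. \<integral>x. \<bar>f x - s i x\<bar> \<partial>lborel) \<longlonglongrightarrow> (\<integral>x. 0 \<partial>(lborel :: 'a measure))"
    proof (rule integral_dominated_convergence[where w="\<lambda>x. 3 * \<bar>f x\<bar>"])
      show "AE x in lborel. (\<lambda>i. \<bar>f x - s i x\<bar>) \<longlonglongrightarrow> 0"
      proof (rule AE_I2)
        fix x :: 'a
        have "(\<lambda>i. \<bar>f x - s i x\<bar>) \<longlonglongrightarrow> \<bar>f x - f x\<bar>" using lim.hyps by (intro tendsto_intros) auto
        then show "(\<lambda>i. \<bar>f x - s i x\<bar>) \<longlonglongrightarrow> 0" by simp
      qed
      show "AE x in lborel. norm \<bar>f x - s i x\<bar> \<le> 3 * \<bar>f x\<bar>" for i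
      proof (rule AE_I2)
        fix x :: 'a
        have "\<bar>s i x\<bar> \<le> 2 * \<bar>f x\<bar>" using lim.hyps(3)[of x i] by simp
        then show "norm \<bar>f x - s i x\<bar> \<le> 3 * \<bar>f x\<bar>" by simp
      qed
    qed (use lim.hyps in auto)
    then have L: "(\<lambda>i. \<integral>x. \<bar>f x - s i x\<bar> \<partial>lborel) \<longlonglongrightarrow> 0" by simp
    show ?case
    proof (rule approx[OF lim.hyps(4)])
      fix e :: real assume "0 < e"
      then obtain i where "(\<integral>x. \<bar>f x - s i x\<bar> \<partial>lborel) < e"
        using eventually_happens[OF order_tendstoD(2)[OF L]] by auto
      then show "\<exists>g. integrable lborel g \<and> (\<integral>x. \<bar>f x - g x\<bar> \<partial>lborel) < e \<and>
          (\<lambda>n. \<integral>x. \<bar>g (x + h n) - g x\<bar> \<partial>lborel) \<longlonglongrightarrow> 0"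
        using lim.hyps(1) lim.IH by blast
    qed
  qed
qed

text \<open>Exchanging the order of integration turns the integral into the mean over \<open>u\<close> in \<open>W\<close> of the
  \<open>L\<^sup>1\<close> distance between \<open>f\<close> and its translate by \<open>u / c n\<close>.\<close>

lemma L1_local_oscillation:
  fixes f :: "'a::euclidean_space \<Rightarrow> real" and c :: "nat \<Rightarrow> real"
  assumes f: "integrable lborel f" and W: "W \<in> sets borel" "bounded W" and c: "filterlim c at_top sequentially"
  shows "(\<lambda>n. \<integral>\<^sup>+x. ennreal (LINT u:W|lborel. \<bar>f (x + (1 / c n) *\<^sub>R u) - f x\<bar>) \<partial>lborel) \<longlonglongrightarrow> 0"
proof -
  have [measurable]: "f \<in> borel_measurable borel" using f by auto
  note W(1)[measurable]
  have Wf: "emeasure lborel W < \<infinity>" using emeasure_bounded_finite[OF W(2)] by simp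
  define om where "om h = (\<integral>x. \<bar>f (x + h) - f x\<bar> \<partial>lborel)" for h
  have om: "ennreal (om h) = (\<integral>\<^sup>+x. ennreal \<bar>f (x + h) - f x\<bar> \<partial>lborel)" for h
    unfolding om_def using f lborel_shift(1)[OF f] by (intro nn_integral_eq_integral[symmetric]) auto
  have om_le: "om h \<le> 2 * (\<integral>x. \<bar>f x\<bar> \<partial>lborel)" for h
  proof -
    have "om h \<le> (\<integral>x. \<bar>f (x + h)\<bar> + \<bar>f x\<bar> \<partial>lborel)"
      unfolding om_def using f lborel_shift(1)[OF f] by (intro integral_mono) auto
    also have "\<dots> = (\<integral>x. \<bar>f (x + h)\<bar> \<partial>lborel) + (\<integral>x. \<bar>f x\<bar> \<partial>lborel)"
      using f lborel_shift(1)[OF f] by (intro Bochner_Integration.integral_add) auto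
    finally show ?thesis using lborel_shift(2)[of "\<lambda>x. \<bar>f x\<bar>" h] f by simp
  qed
  have le: "(\<integral>\<^sup>+x. ennreal (LINT u:W|lborel. \<bar>f (x + (1 / c n) *\<^sub>R u) - f x\<bar>) \<partial>lborel) \<le>
      (\<integral>\<^sup>+u. ennreal (indicator W u * om ((1 / c n) *\<^sub>R u)) \<partial>lborel)" for n
  proof -
    have "(\<integral>\<^sup>+x. ennreal (LINT u:W|lborel. \<bar>f (x + (1 / c n) *\<^sub>R u) - f x\<bar>) \<partial>lborel) \<le>
       (\<integral>\<^sup>+x. (\<integral>\<^sup>+u. ennreal (indicator W u * \<bar>f (x + (1 / c n) *\<^sub>R u) - f x\<bar>) \<partial>lborel) \<partial>lborel)"
    proof (rule nn_integral_mono)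
      fix x :: 'a
      let ?k = "\<lambda>u. indicator W u * \<bar>f (x + (1 / c n) *\<^sub>R u) - f x\<bar>"
      show "ennreal (LINT u:W|lborel. \<bar>f (x + (1 / c n) *\<^sub>R u) - f x\<bar>) \<le> (\<integral>\<^sup>+u. ennreal (?k u) \<partial>lborel)"
      proof (cases "integrable lborel ?k")
        case True
        then show ?thesis unfolding set_lebesgue_integral_def by (subst nn_integral_eq_integral) auto
      next
        case False
        then show ?thesis unfolding set_lebesgue_integral_def by (simp add: not_integrable_integral_eq)
      qed
    qed
    also have "\<dots> = (\<integral>\<^sup>+u. (\<integral>\<^sup>+x. ennreal (indicator W u * \<bar>f (x + (1 / c n) *\<^sub>R u) - f x\<bar>) \<partial>lborel) \<partial>lborel)"
      by (rule lborel_pair.Fubini') measurable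
    also have "\<dots> = (\<integral>\<^sup>+u. ennreal (indicator W u * om ((1 / c n) *\<^sub>R u)) \<partial>lborel)"
      by (intro nn_integral_cong) (simp add: ennreal_mult' om nn_integral_cmult)
    finally show ?thesis .
  qed
  have "(\<lambda>n. \<integral>\<^sup>+u. ennreal (indicator W u * om ((1 / c n) *\<^sub>R u)) \<partial>lborel) \<longlonglongrightarrow> (\<integral>\<^sup>+u. 0 \<partial>(lborel :: 'a measure))"
  proof (rule nn_integral_dominated_convergence[where w="\<lambda>u. ennreal (2 * (\<integral>x. \<bar>f x\<bar> \<partial>lborel)) * indicator W u"])
    show "(\<lambda>u. ennreal (indicator W u * om ((1 / c n) *\<^sub>R u))) \<in> borel_measurable lborel" for n
      unfolding om_def by measurable
    show "AE u in lborel. ennreal (indicator W u * om ((1 / c n) *\<^sub>R u)) \<le> ennreal (2 * (\<integral>x. \<bar>f x\<bar> \<partial>lborel)) * indicator W u" for n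
      by (rule AE_I2) (auto simp: indicator_def om_le intro!: ennreal_leI)
    show "(\<integral>\<^sup>+u. ennreal (2 * (\<integral>x. \<bar>f x\<bar> \<partial>lborel)) * indicator W u \<partial>lborel) < \<infinity>"
      using Wf by (subst nn_integral_cmult) (auto simp: ennreal_mult_less_top)
    show "AE u in lborel. (\<lambda>n. ennreal (indicator W u * om ((1 / c n) *\<^sub>R u))) \<longlonglongrightarrow> 0"
    proof (rule AE_I2)
      fix u :: 'a
      have "(\<lambda>n. inverse (c n) *\<^sub>R u) \<longlonglongrightarrow> 0 *\<^sub>R u"
        by (intro tendsto_scaleR tendsto_const tendsto_inverse_0_at_top c)
      then have "(\<lambda>n. om ((1 / c n) *\<^sub>R u)) \<longlonglongrightarrow> 0"
        unfolding om_def by (intro L1_shift_continuous f) (simp add: divide_inverse)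
      then have "(\<lambda>n. ennreal (indicator W u * om ((1 / c n) *\<^sub>R u))) \<longlonglongrightarrow> ennreal (indicator W u * 0)"
        by (intro tendsto_intros)
      then show "(\<lambda>n. ennreal (indicator W u * om ((1 / c n) *\<^sub>R u))) \<longlonglongrightarrow> 0" by simp
    qed
  qed auto
  then have "(\<lambda>n. \<integral>\<^sup>+u. ennreal (indicator W u * om ((1 / c n) *\<^sub>R u)) \<partial>lborel) \<longlonglongrightarrow> 0" by simp
  from tendsto_sandwich[OF _ _ tendsto_const this] le show ?thesis by simp
qed

text \<open>The weight \<open>f\<close> may be unbounded, hence the truncation by \<open>1\<close>: where \<open>f \<le> R\<close> the integral is
  controlled by the one of \<open>F n\<close>, and \<open>f\<close> has little mass above \<open>R\<close>.\<close>

lemma weighted_truncation_tendsto_0: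
  fixes f :: "'a \<Rightarrow> real" and F :: "nat \<Rightarrow> 'a \<Rightarrow> real"
  assumes f: "integrable M f" "\<And>x. 0 \<le> f x"
    and F[measurable]: "\<And>n. F n \<in> borel_measurable M" and F0: "\<And>n x. 0 \<le> F n x"
    and FL: "(\<lambda>n. \<integral>\<^sup>+x. ennreal (F n x) \<partial>M) \<longlonglongrightarrow> 0"
    and a: "a \<longlonglongrightarrow> 0" "\<And>n. 0 \<le> a n" and b: "\<And>n. 0 \<le> b n \<and> b n \<le> C"
  shows "(\<lambda>n. \<integral>x. f x * min 1 (a n * f x + b n * F n x) \<partial>M) \<longlonglongrightarrow> 0"
proof -
  have [measurable]: "f \<in> borel_measurable M" using f by auto
  have C: "0 \<le> C" using b[of 0] by linarith
  have i1: "integrable M (\<lambda>x. f x * min 1 (a n * f x))" for n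
    by (rule Bochner_Integration.integrable_bound[OF f(1)]) (use f a in \<open>auto simp: abs_mult mult_left_le\<close>)
  have i2: "integrable M (\<lambda>x. f x * min 1 (b n * F n x))" for n
    by (rule Bochner_Integration.integrable_bound[OF f(1)]) (use f b F0 in \<open>auto simp: abs_mult mult_left_le\<close>)
  have "(\<lambda>n. \<integral>x. f x * min 1 (a n * f x) \<partial>M) \<longlonglongrightarrow> (\<integral>x. 0 \<partial>M)"
  proof (rule integral_dominated_convergence[where w=f])
    show "AE x in M. (\<lambda>n. f x * min 1 (a n * f x)) \<longlonglongrightarrow> 0"
    proof (rule AE_I2)
      fix x
      have "(\<lambda>n. f x * min 1 (a n * f x)) \<longlonglongrightarrow> f x * min 1 (0 * f x)" by (intro tendsto_intros a)
      then show "(\<lambda>n. f x * min 1 (a n * f x)) \<longlonglongrightarrow> 0" by simp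
    qed
  qed (use f a in \<open>auto simp: abs_mult mult_left_le\<close>)
  then have 1: "(\<lambda>n. \<integral>x. f x * min 1 (a n * f x) \<partial>M) \<longlonglongrightarrow> 0" by simp
  have "(\<lambda>R. \<integral>x. f x - min (f x) (real R) \<partial>M) \<longlonglongrightarrow> (\<integral>x. 0 \<partial>M)"
  proof (rule integral_dominated_convergence[where w=f])
    show "AE x in M. (\<lambda>R. f x - min (f x) (real R)) \<longlonglongrightarrow> 0"
    proof (rule AE_I2)
      fix x
      obtain R0 where "f x \<le> real R0" using real_arch_simple by blast
      then have "\<forall>\<^sub>F R in sequentially. f x - min (f x) (real R) = 0"
        by (intro eventually_sequentiallyI[of R0]) auto
      then show "(\<lambda>R. f x - min (f x) (real R)) \<longlonglongrightarrow> 0" by (rule tendsto_eventually)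
    qed
  qed (use f in \<open>auto simp: min_def\<close>)
  then have tail: "(\<lambda>R. \<integral>x. f x - min (f x) (real R) \<partial>M) \<longlonglongrightarrow> 0" by simp
  have 2: "(\<lambda>n. \<integral>x. f x * min 1 (b n * F n x) \<partial>M) \<longlonglongrightarrow> 0"
  proof (rule LIMSEQ_I)
    fix r :: real assume r: "0 < r"
    obtain R where R: "(\<integral>x. f x - min (f x) (real R) \<partial>M) < r / 2"
      using eventually_happens[OF order_tendstoD(2)[OF tail, of "r/2"]] r by auto
    have "\<forall>\<^sub>F n in sequentially. (\<integral>\<^sup>+x. ennreal (F n x) \<partial>M) < ennreal (r / (2 * (real R * C + 1)))"
      using r C by (intro order_tendstoD(2)[OF FL]) (auto intro!: divide_pos_pos add_nonneg_pos)
    then obtain n0 where n0: "\<And>n. n \<ge> n0 \<Longrightarrow> (\<integral>\<^sup>+x. ennreal (F n x) \<partial>M) < ennreal (r / (2 * (real R * C + 1)))"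
      by (auto simp: eventually_sequentially)
    show "\<exists>n0. \<forall>n\<ge>n0. norm ((\<integral>x. f x * min 1 (b n * F n x) \<partial>M) - 0) < r"
    proof (intro exI[of _ n0] allI impI)
      fix n assume n: "n0 \<le> n"
      have iF: "integrable M (F n)"
        using n0[OF n] F0 by (intro integrableI_bounded) (auto intro: order_less_trans)
      have "ennreal (\<integral>x. F n x \<partial>M) < ennreal (r / (2 * (real R * C + 1)))"
        using n0[OF n] iF F0 by (simp add: nn_integral_eq_integral)
      then have IF: "(\<integral>x. F n x \<partial>M) < r / (2 * (real R * C + 1))"
        by (subst (asm) ennreal_less_iff) (auto simp: F0)
      have imin: "integrable M (\<lambda>x. min (f x) (real R))"
        by (rule Bochner_Integration.integrable_bound[OF f(1)]) (use f in auto)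
      have "(\<integral>x. f x * min 1 (b n * F n x) \<partial>M) \<le> (\<integral>x. real R * C * F n x + (f x - min (f x) (real R)) \<partial>M)"
      proof (rule integral_mono[OF i2])
        show "integrable M (\<lambda>x. real R * C * F n x + (f x - min (f x) (real R)))"
          using iF f by (intro Bochner_Integration.integrable_add Bochner_Integration.integrable_diff integrable_mult_right imin) auto
        fix x
        have m: "min 1 (b n * F n x) \<le> C * F n x" "0 \<le> min 1 (b n * F n x)" "min 1 (b n * F n x) \<le> 1"
          using b[of n] F0[of n x] by (auto intro!: mult_right_mono min.coboundedI2)
        have "f x * min 1 (b n * F n x) = min (f x) (real R) * min 1 (b n * F n x) + (f x - min (f x) (real R)) * min 1 (b n * F n x)"
          by (simp add: algebra_simps)
        also have "min (f x) (real R) * min 1 (b n * F n x) \<le> real R * (C * F n x)"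
          using m f(2)[of x] C F0[of n x] by (intro mult_mono) auto
        also have "(f x - min (f x) (real R)) * min 1 (b n * F n x) \<le> f x - min (f x) (real R)"
          using m by (intro mult_left_le) auto
        finally show "f x * min 1 (b n * F n x) \<le> real R * C * F n x + (f x - min (f x) (real R))"
          by (simp add: mult.assoc)
      qed
      also have "\<dots> = real R * C * (\<integral>x. F n x \<partial>M) + (\<integral>x. f x - min (f x) (real R) \<partial>M)"
        using iF f imin by (subst Bochner_Integration.integral_add) auto
      also have "real R * C * (\<integral>x. F n x \<partial>M) \<le> (real R * C + 1) * (r / (2 * (real R * C + 1)))"
        using IF C F0 by (intro mult_mono) auto
      also have "\<dots> = r / 2"
        using C by (simp add: divide_simps add_nonneg_eq_0_iff)
      finally have "(\<integral>x. f x * min 1 (b n * F n x) \<partial>M) < r" using R by simp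
      moreover have "0 \<le> (\<integral>x. f x * min 1 (b n * F n x) \<partial>M)"
        using f b F0 by (intro integral_nonneg_AE AE_I2 mult_nonneg_nonneg) auto
      ultimately show "norm ((\<integral>x. f x * min 1 (b n * F n x) \<partial>M) - 0) < r" by simp
    qed
  qed
  have B: "(\<integral>x. f x * min 1 (a n * f x + b n * F n x) \<partial>M) \<le>
      (\<integral>x. f x * min 1 (a n * f x) \<partial>M) + (\<integral>x. f x * min 1 (b n * F n x) \<partial>M)" for n
  proof -
    have m: "min 1 (s + t) \<le> min 1 s + min 1 t" if "0 \<le> s" "0 \<le> t" for s t :: real using that by auto
    have i: "integrable M (\<lambda>x. f x * min 1 (a n * f x + b n * F n x))"
      by (rule Bochner_Integration.integrable_bound[OF f(1)]) (use f a b F0 in \<open>auto simp: abs_mult mult_left_le\<close>)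
    have "(\<integral>x. f x * min 1 (a n * f x + b n * F n x) \<partial>M) \<le>
        (\<integral>x. f x * min 1 (a n * f x) + f x * min 1 (b n * F n x) \<partial>M)"
    proof (rule integral_mono[OF i Bochner_Integration.integrable_add[OF i1 i2]])
      fix x
      have "f x * min 1 (a n * f x + b n * F n x) \<le> f x * (min 1 (a n * f x) + min 1 (b n * F n x))"
        using f(2) a(2) b F0 by (intro mult_left_mono m) auto
      then show "f x * min 1 (a n * f x + b n * F n x) \<le> f x * min 1 (a n * f x) + f x * min 1 (b n * F n x)"
        by (simp only: distrib_left)
    qed
    then show ?thesis using Bochner_Integration.integral_add[OF i1 i2] by simp
  qed
  have N: "0 \<le> (\<integral>x. f x * min 1 (a n * f x + b n * F n x) \<partial>M)" for n
    using f a b F0 by (intro integral_nonneg_AE AE_I2 mult_nonneg_nonneg) auto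
  have L: "(\<lambda>n. (\<integral>x. f x * min 1 (a n * f x) \<partial>M) + (\<integral>x. f x * min 1 (b n * F n x) \<partial>M)) \<longlonglongrightarrow> 0"
    using tendsto_add[OF 1 2] by simp
  show ?thesis
  proof (rule Lim_null_comparison[OF always_eventually[OF allI] L])
    show "norm (\<integral>x. f x * min 1 (a n * f x + b n * F n x) \<partial>M) \<le>
        (\<integral>x. f x * min 1 (a n * f x) \<partial>M) + (\<integral>x. f x * min 1 (b n * F n x) \<partial>M)" for n
      using B[of n] N[of n] by (simp only: real_norm_def abs_of_nonneg)
  qed
qed

section \<open>Measurability of the stabilization bounds\<close>

text \<open>Inserting the point moves \<open>(x, S)\<close> into the set of pairs on which \<open>\<xi>\<close> is measurable.\<close>

lemma measurable_eval_at:
  fixes \<xi> :: "'a::euclidean_space \<Rightarrow> 'a set \<Rightarrow> real"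
  assumes \<xi>: "measurable_functional \<xi>" and F: "F \<in> measurable A point_sets" and u: "u \<in> measurable A borel"
  shows "(\<lambda>a. eval_at \<xi> (u a) (F a)) \<in> borel_measurable A"
proof -
  have "(\<lambda>a. (u a, insert (u a) (F a))) \<in> measurable A (restrict_space (borel \<Otimes>\<^sub>M point_sets) {(x, S). x \<in> S})"
    using u measurable_insert_point[OF F u] by (intro measurable_restrict_space2 measurable_Pair) auto
  from measurable_compose[OF this \<xi>[unfolded measurable_functional_def]]
  show ?thesis by (simp add: eval_at_def)
qed

lemma measurable_sample_points:
  fixes Q :: "'a::euclidean_space measure"
  assumes "finite J" "J \<subseteq> I" "sets Q = sets borel"
  shows "(\<lambda>y::'i \<Rightarrow> 'a. y ` J) \<in> measurable (\<Pi>\<^sub>M j\<in>I. Q) point_sets"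
  using assms by (intro measurable_finite_image measurable_component_borel) auto

lemma outer_tuples_sets:
  fixes n m :: nat shows
  "{y \<in> space (Pi\<^sub>M {1..n} (\<lambda>_. lborel)). inj_on y {1..n} \<and> y ` {1..n} \<inter> cball (0::'a::euclidean_space) (real m) = {}}
    \<in> sets (Pi\<^sub>M {1..n} (\<lambda>_. lborel))"
proof -
  let ?P = "Pi\<^sub>M {1..n} (\<lambda>_. lborel :: 'a measure)"
  have m[measurable]: "(\<lambda>y. y i) \<in> borel_measurable ?P" if "i \<in> {1..n}" for i
    using measurable_component_borel[of lborel i "{1..n}"] that by simp
  have "{y \<in> space ?P. inj_on y {1..n} \<and> y ` {1..n} \<inter> cball 0 (real m) = {}} =
    {y \<in> space ?P. \<forall>i\<in>{1..n}. \<forall>j\<in>{1..n}. i \<noteq> j \<longrightarrow> y i - y j \<noteq> 0} \<inter> {y \<in> space ?P. y ` {1..n} \<inter> cball 0 (real m) = {}}"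
    by (auto simp: inj_on_def)
  also have "\<dots> \<in> sets ?P"
  proof (intro sets.Int sets.sets_Collect_finite_All void_pred measurable_sample_points)
    fix i j assume ij: "i \<in> {1..n}" "j \<in> {1..n}"
    have "(\<lambda>y. y i - y j) \<in> borel_measurable ?P" using m[OF ij(1)] m[OF ij(2)] by (rule borel_measurable_diff)
    then have "{y \<in> space ?P. y i - y j \<noteq> 0} \<in> sets ?P" by measurable
    then show "{y \<in> space ?P. i \<noteq> j \<longrightarrow> y i - y j \<noteq> 0} \<in> sets ?P" by (cases "i = j") auto
  qed auto
  finally show ?thesis .
qed

lemma space_outer_tuples:
  "space (outer_tuples m n) = {y \<in> space (Pi\<^sub>M {1..n} (\<lambda>_. lborel)). inj_on y {1..n} \<and> y ` {1..n} \<inter> cball (0::'a::euclidean_space) (real m) = {}}"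
  by (auto simp: outer_tuples_def space_restrict_space)

lemma outer_tuples_Int:
  fixes n m :: nat shows
  "{y. inj_on y {1..n} \<and> y ` {1..n} \<inter> cball 0 (real m) = {}} \<inter> space (Pi\<^sub>M {1..n} (\<lambda>_. lborel :: 'a::euclidean_space measure))
    = space (outer_tuples m n)"
  by (auto simp: space_outer_tuples)

lemma AE_outer_tuples:
  "(AE y in outer_tuples m n. Q y) \<longleftrightarrow>
   (AE y in Pi\<^sub>M {1..n} (\<lambda>_. lborel :: 'a::euclidean_space measure). inj_on y {1..n} \<and> y ` {1..n} \<inter> cball 0 (real m) = {} \<longrightarrow> Q y)"
proof -
  have "{y. inj_on y {1..n} \<and> y ` {1..n} \<inter> cball 0 (real m) = {}} \<inter> space (Pi\<^sub>M {1..n} (\<lambda>_. lborel :: 'a measure))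
      \<in> sets (Pi\<^sub>M {1..n} (\<lambda>_. lborel))"
    unfolding outer_tuples_Int space_outer_tuples by (rule outer_tuples_sets)
  from AE_restrict_space_iff[OF this, of Q] show ?thesis by (simp only: outer_tuples_def mem_Collect_eq)
qed

lemma measurable_outer_eval:
  fixes \<xi> :: "'a::euclidean_space \<Rightarrow> 'a set \<Rightarrow> real" and n :: nat
  assumes \<xi>: "measurable_functional \<xi>"
  shows "(\<lambda>(S, y). ennreal (eval_at \<xi> 0 ((S \<inter> cball 0 (real m)) \<union> y ` {1..n}))) \<in>
     borel_measurable (point_sets \<Otimes>\<^sub>M Pi\<^sub>M {1..n} (\<lambda>_. lborel))"
proof -
  have r: "(\<lambda>S::'a set. S \<inter> cball 0 (real m)) \<in> measurable point_sets point_sets"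
    by (rule measurable_restrict_region) auto
  have i: "(\<lambda>y::nat \<Rightarrow> 'a. y ` {1..n}) \<in> measurable (Pi\<^sub>M {1..n} (\<lambda>_. lborel)) point_sets"
    by (rule measurable_sample_points) auto
  have "(\<lambda>p. (fst p \<inter> cball (0::'a) (real m)) \<union> snd p ` {1..n}) \<in>
      measurable (point_sets \<Otimes>\<^sub>M Pi\<^sub>M {1..n} (\<lambda>_. lborel)) point_sets"
    using measurable_compose[OF measurable_Pair[OF measurable_compose[OF measurable_fst r] measurable_compose[OF measurable_snd i]] measurable_superpose]
    by (simp only: prod.case)
  from measurable_eval_at[OF \<xi> this measurable_const[of 0]] show ?thesis
    by (simp add: case_prod_beta')
qed

lemma measurable_outer_eval_section:
  fixes \<xi> :: "'a::euclidean_space \<Rightarrow> 'a set \<Rightarrow> real"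
  assumes \<xi>: "measurable_functional \<xi>" and S: "locally_finite S"
  shows "(\<lambda>y. ennreal (eval_at \<xi> 0 ((S \<inter> cball 0 (real m)) \<union> y ` {1..n}))) \<in> borel_measurable (outer_tuples m n)"
proof -
  have "(\<lambda>y. (S, y)) \<in> measurable (Pi\<^sub>M {1..n} (\<lambda>_. lborel)) (point_sets \<Otimes>\<^sub>M Pi\<^sub>M {1..n} (\<lambda>_. lborel))"
    using S by (intro measurable_Pair1') (simp add: space_point_sets)
  from measurable_compose[OF this measurable_outer_eval[OF \<xi>]] show ?thesis
    unfolding outer_tuples_def by (intro measurable_restrict_space1) simp
qed

lemma less_esssup_iff:
  assumes "f \<in> borel_measurable M"
  shows "z < esssup M f \<longleftrightarrow> emeasure M {x \<in> space M. z < f x} \<noteq> 0"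
proof
  assume "z < esssup M f"
  moreover have "esssup M f \<le> z" if "emeasure M {x \<in> space M. z < f x} = 0"
    using that assms by (auto simp: esssup_eq intro: Inf_lower)
  ultimately show "emeasure M {x \<in> space M. z < f x} \<noteq> 0" by (auto simp: not_le[symmetric])
next
  assume ne: "emeasure M {x \<in> space M. z < f x} \<noteq> 0"
  show "z < esssup M f"
  proof (rule ccontr)
    assume "\<not> z < esssup M f"
    then have "AE x in M. f x \<le> z" using esssup_AE[where M=M and f=f] by (auto elim!: eventually_mono)
    then have "emeasure M {x \<in> space M. z < f x} = 0"
      using assms by (subst (asm) AE_iff_measurable[OF _ refl]) (auto simp: not_le)
    with ne show False by simp
  qed
qed

text \<open>The essential supremum over outer tuples exceeds \<open>z\<close> if and only if the tuples with value above \<open>z\<close> have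
  positive measure, and this measure depends measurably on the configuration by Fubini.\<close>

lemma measurable_upper_stab:
  fixes \<xi> :: "'a::euclidean_space \<Rightarrow> 'a set \<Rightarrow> real"
  assumes \<xi>: "measurable_functional \<xi>"
  shows "(\<lambda>S. upper_stab \<xi> S m) \<in> borel_measurable point_sets"
  unfolding upper_stab_def
proof (rule borel_measurable_SUP)
  fix n :: nat
  let ?P = "Pi\<^sub>M {1..n} (\<lambda>_. lborel :: 'a measure)"
  let ?f = "\<lambda>S y. ennreal (eval_at \<xi> 0 ((S \<inter> cball 0 (real m)) \<union> y ` {1..n}))"
  interpret product_sigma_finite "\<lambda>_::nat. lborel :: 'a measure" ..
  interpret sigma_finite_measure ?P by (rule sigma_finite) simp
  show "(\<lambda>S. esssup (outer_tuples m n) (?f S)) \<in> borel_measurable point_sets"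
  proof (rule borel_measurableI_greater)
    fix z
    let ?Q = "{p \<in> space (point_sets \<Otimes>\<^sub>M ?P). snd p \<in> space (outer_tuples m n) \<and> z < ?f (fst p) (snd p)}"
    have "?Q = (snd -` space (outer_tuples m n) \<inter> space (point_sets \<Otimes>\<^sub>M ?P)) \<inter>
        {p \<in> space (point_sets \<Otimes>\<^sub>M ?P). z < (\<lambda>(S, y). ?f S y) p}" by auto
    also have "\<dots> \<in> sets (point_sets \<Otimes>\<^sub>M ?P)"
    proof (rule sets.Int)
      show "snd -` space (outer_tuples m n) \<inter> space (point_sets \<Otimes>\<^sub>M ?P) \<in> sets (point_sets \<Otimes>\<^sub>M ?P)"
        using outer_tuples_sets[of n m] by (intro measurable_sets[OF measurable_snd]) (simp add: space_outer_tuples)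
      show "{p \<in> space (point_sets \<Otimes>\<^sub>M ?P). z < (\<lambda>(S, y). ?f S y) p} \<in> sets (point_sets \<Otimes>\<^sub>M ?P)"
        using measurable_outer_eval[OF \<xi>, of m n] by measurable
    qed
    finally have Q: "?Q \<in> sets (point_sets \<Otimes>\<^sub>M ?P)" .
    have eq: "z < esssup (outer_tuples m n) (?f S) \<longleftrightarrow> emeasure ?P (Pair S -` ?Q) \<noteq> 0" if "S \<in> space point_sets" for S
    proof -
      have lf: "locally_finite S" using that by (simp add: space_point_sets)
      have "Pair S -` ?Q = {y \<in> space (outer_tuples m n). z < ?f S y}"
        using that by (auto simp: space_pair_measure space_outer_tuples)
      moreover have "emeasure (outer_tuples m n) {y \<in> space (outer_tuples m n). z < ?f S y} = emeasure ?P {y \<in> space (outer_tuples m n). z < ?f S y}"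
      proof -
        have "{y. inj_on y {1..n} \<and> y ` {1..n} \<inter> cball 0 (real m) = {}} \<inter> space ?P \<in> sets ?P"
          unfolding outer_tuples_Int space_outer_tuples by (rule outer_tuples_sets)
        moreover have "{y \<in> space (outer_tuples m n). z < ?f S y} \<subseteq> {y. inj_on y {1..n} \<and> y ` {1..n} \<inter> cball 0 (real m) = {}}"
          by (auto simp: space_outer_tuples)
        ultimately show ?thesis by (subst outer_tuples_def) (rule emeasure_restrict_space)
      qed
      ultimately show ?thesis
        using less_esssup_iff[OF measurable_outer_eval_section[OF \<xi> lf, of m n], of z] by simp
    qed
    have "{S \<in> space point_sets. z < esssup (outer_tuples m n) (?f S)} = {S \<in> space point_sets. emeasure ?P (Pair S -` ?Q) \<noteq> 0}"
      using eq by blast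
    also have "\<dots> \<in> sets point_sets"
      using measurable_emeasure_Pair[OF Q] by measurable
    finally show "{S \<in> space point_sets. z < esssup (outer_tuples m n) (?f S)} \<in> sets point_sets" .
  qed
qed auto

lemma upper_stab_local: "upper_stab \<xi> (S \<inter> cball 0 (real m)) m = upper_stab \<xi> S m"
  by (simp add: upper_stab_def Int_assoc)

section \<open>Distinct points and unions of index sets\<close>

lemma AE_PiM_unionI:
  assumes "product_sigma_finite M" and I: "finite I" "finite J" "I \<inter> J = {}"
    and P: "{u \<in> space (Pi\<^sub>M (I \<union> J) M). P u} \<in> sets (Pi\<^sub>M (I \<union> J) M)"
    and ae: "AE s in Pi\<^sub>M I M. AE y in Pi\<^sub>M J M. P (merge I J (s, y))"
  shows "AE u in Pi\<^sub>M (I \<union> J) M. P u"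
proof -
  interpret product_sigma_finite M by fact
  interpret I: sigma_finite_measure "Pi\<^sub>M I M" using I(1) by (rule sigma_finite)
  interpret J: sigma_finite_measure "Pi\<^sub>M J M" using I(2) by (rule sigma_finite)
  interpret pair_sigma_finite "Pi\<^sub>M I M" "Pi\<^sub>M J M" ..
  have m: "merge I J \<in> measurable (Pi\<^sub>M I M \<Otimes>\<^sub>M Pi\<^sub>M J M) (Pi\<^sub>M (I \<union> J) M)" by (rule measurable_merge)
  have "{p \<in> space (Pi\<^sub>M I M \<Otimes>\<^sub>M Pi\<^sub>M J M). P (merge I J p)} \<in> sets (Pi\<^sub>M I M \<Otimes>\<^sub>M Pi\<^sub>M J M)"
    using measurable_sets[OF m P] measurable_space[OF m]
    by (auto simp: vimage_def Int_def conj_commute cong: conj_cong)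
  from AE_pair_measure[OF this ae] have "AE p in Pi\<^sub>M I M \<Otimes>\<^sub>M Pi\<^sub>M J M. P (merge I J p)" .
  then show ?thesis
    by (subst distr_merge[OF I(3,1,2), symmetric], subst AE_distr_iff[OF m P])
qed

lemma product_sigma_finite_lborel: "product_sigma_finite (\<lambda>_::'i. lborel :: 'a::euclidean_space measure)"
  ..

lemma AE_inj_on_lborel:
  assumes J: "finite J"
  shows "AE u in Pi\<^sub>M J (\<lambda>_. lborel :: 'a::euclidean_space measure). inj_on u J"
proof -
  interpret product_sigma_finite "\<lambda>_. lborel :: 'a measure" by (rule product_sigma_finite_lborel)
  have m: "(\<lambda>y. y i) \<in> borel_measurable (Pi\<^sub>M I (\<lambda>_. lborel :: 'a measure))" if "i \<in> I" for i I
    using measurable_component_borel[of lborel i I] that by simp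
  have "AE u in Pi\<^sub>M J (\<lambda>_. lborel :: 'a measure). u i \<noteq> u j" if ij: "i \<in> J" "j \<in> J" "i \<noteq> j" for i j
  proof -
    have eq: "J = (J - {i}) \<union> {i}" using ij by auto
    have "AE u in Pi\<^sub>M ((J - {i}) \<union> {i}) (\<lambda>_. lborel :: 'a measure). u i - u j \<noteq> 0"
    proof (rule AE_PiM_unionI[OF product_sigma_finite_lborel])
      have "(\<lambda>u. u i - u j) \<in> borel_measurable (Pi\<^sub>M ((J - {i}) \<union> {i}) (\<lambda>_. lborel :: 'a measure))"
        using ij by (intro borel_measurable_diff m) auto
      then show "{u \<in> space (Pi\<^sub>M ((J - {i}) \<union> {i}) (\<lambda>_. lborel)). u i - u j \<noteq> 0} \<in> sets (Pi\<^sub>M ((J - {i}) \<union> {i}) (\<lambda>_. lborel :: 'a measure))"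
        by measurable
      show "AE s in Pi\<^sub>M (J - {i}) (\<lambda>_. lborel). AE y in Pi\<^sub>M {i} (\<lambda>_. lborel :: 'a measure). merge (J - {i}) {i} (s, y) i - merge (J - {i}) {i} (s, y) j \<noteq> 0"
      proof (rule AE_I2)
        fix s :: "'b \<Rightarrow> 'a"
        have "AE x in lborel. x \<noteq> s j" by (rule AE_lborel_singleton)
        then have "AE x in distr (Pi\<^sub>M {i} (\<lambda>_. lborel :: 'a measure)) lborel (\<lambda>x. x i). x \<noteq> s j"
          by (subst distr_singleton)
        then have "AE y in Pi\<^sub>M {i} (\<lambda>_. lborel :: 'a measure). y i \<noteq> s j"
          by (subst (asm) AE_distr_iff) auto
        then show "AE y in Pi\<^sub>M {i} (\<lambda>_. lborel :: 'a measure). merge (J - {i}) {i} (s, y) i - merge (J - {i}) {i} (s, y) j \<noteq> 0"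
          using ij by (auto simp: merge_def)
      qed
    qed (use J in auto)
    then have "AE u in Pi\<^sub>M J (\<lambda>_. lborel :: 'a measure). u i - u j \<noteq> 0" unfolding eq[symmetric] .
    then show ?thesis by simp
  qed
  then have "AE u in Pi\<^sub>M J (\<lambda>_. lborel :: 'a measure). \<forall>i\<in>J. \<forall>j\<in>J. i \<noteq> j \<longrightarrow> u i \<noteq> u j"
    using J by (intro AE_finite_allI) auto
  then show ?thesis by eventually_elim (auto simp: inj_on_def)
qed

lemma distr_reindex_lborel:
  assumes t: "bij_betw t K J" and K: "finite K"
  shows "distr (Pi\<^sub>M J (\<lambda>_. lborel :: 'a::euclidean_space measure)) (Pi\<^sub>M K (\<lambda>_. lborel)) (\<lambda>y. \<lambda>k\<in>K. y (t k)) = Pi\<^sub>M K (\<lambda>_. lborel)"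
proof -
  interpret J: product_sigma_finite "\<lambda>_::'c. lborel :: 'a measure" by (rule product_sigma_finite_lborel)
  interpret K: product_sigma_finite "\<lambda>_::'b. lborel :: 'a measure" by (rule product_sigma_finite_lborel)
  have J: "finite J" using t K by (simp add: bij_betw_finite)
  have tJ: "t k \<in> J" if "k \<in> K" for k using t that by (auto simp: bij_betw_def)
  have m: "(\<lambda>y. \<lambda>k\<in>K. y (t k)) \<in> measurable (Pi\<^sub>M J (\<lambda>_. lborel :: 'a measure)) (Pi\<^sub>M K (\<lambda>_. lborel))"
    using tJ by (intro measurable_restrict measurable_component_singleton) auto
  show ?thesis
  proof (rule K.PiM_eqI[OF K])
    fix A :: "'b \<Rightarrow> 'a set" assume A: "\<And>k. k \<in> K \<Longrightarrow> A k \<in> sets lborel"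
    let ?s = "the_inv_into K t"
    have s: "?s (t k) = k" if "k \<in> K" for k using t that by (auto simp: bij_betw_def the_inv_into_f_f)
    have sK: "?s j \<in> K" "t (?s j) = j" if "j \<in> J" for j
      using t that by (auto simp: bij_betw_def the_inv_into_into f_the_inv_into_f)
    have pre: "(\<lambda>y. \<lambda>k\<in>K. y (t k)) -` Pi\<^sub>E K A \<inter> space (Pi\<^sub>M J (\<lambda>_. lborel :: 'a measure)) = Pi\<^sub>E J (\<lambda>j. A (?s j))"
    proof (intro set_eqI iffI)
      fix y assume "y \<in> (\<lambda>y. \<lambda>k\<in>K. y (t k)) -` Pi\<^sub>E K A \<inter> space (Pi\<^sub>M J (\<lambda>_. lborel :: 'a measure))"
      then have y: "(\<lambda>k\<in>K. y (t k)) \<in> Pi\<^sub>E K A" "y \<in> space (Pi\<^sub>M J (\<lambda>_. lborel :: 'a measure))" by auto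
      have "y j \<in> A (?s j)" if "j \<in> J" for j
        using PiE_mem[OF y(1) sK(1)[OF that]] sK[OF that] by simp
      then show "y \<in> Pi\<^sub>E J (\<lambda>j. A (?s j))" using y(2) by (auto simp: space_PiM PiE_iff)
    next
      fix y assume y: "y \<in> Pi\<^sub>E J (\<lambda>j. A (?s j))"
      then have "y (t k) \<in> A k" if "k \<in> K" for k using PiE_mem[OF y tJ[OF that]] s[OF that] by simp
      then have "(\<lambda>k\<in>K. y (t k)) \<in> Pi\<^sub>E K A" by auto
      moreover have "y \<in> space (Pi\<^sub>M J (\<lambda>_. lborel :: 'a measure))" using y by (auto simp: space_PiM PiE_iff)
      ultimately show "y \<in> (\<lambda>y. \<lambda>k\<in>K. y (t k)) -` Pi\<^sub>E K A \<inter> space (Pi\<^sub>M J (\<lambda>_. lborel :: 'a measure))" by simp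
    qed
    have "emeasure (distr (Pi\<^sub>M J (\<lambda>_. lborel :: 'a measure)) (Pi\<^sub>M K (\<lambda>_. lborel)) (\<lambda>y. \<lambda>k\<in>K. y (t k))) (Pi\<^sub>E K A) =
        emeasure (Pi\<^sub>M J (\<lambda>_. lborel :: 'a measure)) (Pi\<^sub>E J (\<lambda>j. A (?s j)))"
      using A K by (subst emeasure_distr[OF m]) (auto simp: pre intro!: sets_PiM_I_finite)
    also have "\<dots> = (\<Prod>j\<in>J. emeasure lborel (A (?s j)))"
      using A J sK by (intro J.emeasure_PiM) auto
    also have "\<dots> = (\<Prod>k\<in>K. emeasure lborel (A k))"
      by (subst prod.reindex_bij_betw[OF t, symmetric]) (auto simp: s intro!: prod.cong)
    finally show "emeasure (distr (Pi\<^sub>M J (\<lambda>_. lborel :: 'a measure)) (Pi\<^sub>M K (\<lambda>_. lborel)) (\<lambda>y. \<lambda>k\<in>K. y (t k))) (Pi\<^sub>E K A) =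
        (\<Prod>k\<in>K. emeasure lborel (A k))" .
  qed simp
qed

text \<open>A limit superior commutes with continuous monotone functions along a proper filter only, so the
  outer tuples have to be shown to form a set of positive measure.\<close>

lemma outer_tuples_nontrivial:
  assumes n: "1 \<le> n"
  shows "ae_filter (outer_tuples m n :: (nat \<Rightarrow> 'a::euclidean_space) measure) \<noteq> bot"
proof
  let ?P = "Pi\<^sub>M {1..n} (\<lambda>_. lborel :: 'a measure)"
  interpret product_sigma_finite "\<lambda>_::nat. lborel :: 'a measure" by (rule product_sigma_finite_lborel)
  assume "ae_filter (outer_tuples m n :: (nat \<Rightarrow> 'a) measure) = bot"
  then have "eventually (\<lambda>_. False) (ae_filter (outer_tuples m n :: (nat \<Rightarrow> 'a) measure))"
    by (simp only: eventually_bot)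
  then have "AE y in ?P. \<not> (inj_on y {1..n} \<and> y ` {1..n} \<inter> cball 0 (real m) = {})"
    unfolding AE_outer_tuples by auto
  moreover have "AE y in ?P. inj_on y {1..n}" by (rule AE_inj_on_lborel) simp
  ultimately have "AE y in ?P. y \<notin> Pi\<^sub>E {1..n} (\<lambda>_. - cball 0 (real m))"
    by eventually_elim (auto simp: PiE_iff)
  moreover have "Pi\<^sub>E {1..n} (\<lambda>_. - cball 0 (real m)) \<in> sets ?P" by (intro sets_PiM_I_finite) auto
  ultimately have "emeasure ?P (Pi\<^sub>E {1..n} (\<lambda>_. - cball 0 (real m))) = 0"
    by (metis AE_iff_null_sets null_setsD1)
  then have "(\<Prod>i\<in>{1..n}. emeasure lborel (- cball 0 (real m) :: 'a set)) = 0"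
    by (subst (asm) emeasure_PiM) auto
  then have "emeasure lborel (- cball 0 (real m) :: 'a set) = 0" using n by simp
  moreover have "emeasure lborel (UNIV :: 'a set) \<le> emeasure lborel (cball 0 (real m) :: 'a set) + emeasure lborel (- cball 0 (real m) :: 'a set)"
    using emeasure_subadditive[of "cball 0 (real m) :: 'a set" lborel "- cball 0 (real m)"] by simp
  moreover have "emeasure lborel (cball 0 (real m) :: 'a set) < \<infinity>"
    by (rule emeasure_bounded_finite) simp
  ultimately show False by simp
qed

section \<open>Finite configurations below the upper stabilization bound\<close>

text \<open>Split the indices according to whether their point lies in the ball. With the inner points fixed,
  the outer ones form a tuple over which the essential supremum is taken.\<close>

lemma eval_le_upper_stab:
  fixes \<xi> :: "'a::euclidean_space \<Rightarrow> 'a set \<Rightarrow> real"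
  assumes \<xi>: "measurable_functional \<xi>" and J: "finite J"
  shows "AE u in Pi\<^sub>M J (\<lambda>_. lborel). (\<exists>j\<in>J. u j \<notin> cball 0 (real m)) \<longrightarrow>
     ennreal (eval_at \<xi> 0 (u ` J)) \<le> upper_stab \<xi> (u ` J) m"
proof -
  let ?L = "\<lambda>_. lborel :: 'a measure" and ?C = "cball 0 (real m) :: 'a set"
  let ?le = "\<lambda>S. ennreal (eval_at \<xi> 0 S) \<le> upper_stab \<xi> S m"
  have split: "AE u in Pi\<^sub>M (I \<union> K) ?L. (\<forall>i\<in>I. u i \<in> ?C) \<and> (\<forall>k\<in>K. u k \<notin> ?C) \<longrightarrow> ?le (u ` (I \<union> K))"
    if I: "finite I" "finite K" "I \<inter> K = {}" "K \<noteq> {}" for I K :: "'b set"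
  proof (rule AE_PiM_unionI[OF product_sigma_finite_lborel I(1,2,3)])
    let ?P = "Pi\<^sub>M (I \<union> K) ?L"
    have m: "(\<lambda>u. u ` (I \<union> K)) \<in> measurable ?P point_sets"
      using I by (intro measurable_sample_points) auto
    have c: "(\<lambda>u. u i) \<in> borel_measurable ?P" if "i \<in> I \<union> K" for i
      using measurable_component_borel[of lborel i "I \<union> K"] that by simp
    have "{u \<in> space ?P. ?le (u ` (I \<union> K))} \<in> sets ?P"
      using measurable_compose[OF m measurable_upper_stab[OF \<xi>, of m]] measurable_eval_at[OF \<xi> m measurable_const[of 0]]
      by measurable
    moreover have "{u \<in> space ?P. \<forall>i\<in>I. u i \<in> ?C} \<in> sets ?P" "{u \<in> space ?P. \<forall>k\<in>K. u k \<notin> ?C} \<in> sets ?P"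
      using I c by (auto intro!: sets.sets_Collect_finite_All)
    ultimately show "{u \<in> space ?P. (\<forall>i\<in>I. u i \<in> ?C) \<and> (\<forall>k\<in>K. u k \<notin> ?C) \<longrightarrow> ?le (u ` (I \<union> K))} \<in> sets ?P"
      by (intro sets.sets_Collect_imp sets.sets_Collect_conj) auto
    show "AE s in Pi\<^sub>M I ?L. AE y in Pi\<^sub>M K ?L. (\<forall>i\<in>I. merge I K (s, y) i \<in> ?C) \<and> (\<forall>k\<in>K. merge I K (s, y) k \<notin> ?C)
        \<longrightarrow> ?le (merge I K (s, y) ` (I \<union> K))"
    proof (rule AE_I2)
      fix s :: "'b \<Rightarrow> 'a"
      define n where "n = card K"
      have n: "1 \<le> n" using I by (simp add: n_def Suc_le_eq card_gt_0_iff)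
      obtain t where t: "bij_betw t {1..n} K"
        using ex_bij_betw_nat_finite_1[OF I(2)] by (auto simp: n_def)
      let ?r = "\<lambda>y. \<lambda>k\<in>{1..n}. y (t k)"
      let ?S = "s ` I"
      have lf: "locally_finite ?S" using I by (intro locally_finite_finite) auto
      let ?F = "\<lambda>y. ennreal (eval_at \<xi> 0 ((?S \<inter> ?C) \<union> y ` {1..n}))"
      have le: "esssup (outer_tuples m n) ?F \<le> upper_stab \<xi> ?S m"
        unfolding upper_stab_def using n by (intro SUP_upper) auto
      have "AE y in outer_tuples m n. ?F y \<le> upper_stab \<xi> ?S m"
        using esssup_AE[where M="outer_tuples m n" and f="?F"] by eventually_elim (use le in auto)
      then have "AE y in Pi\<^sub>M {1..n} ?L. inj_on y {1..n} \<and> y ` {1..n} \<inter> ?C = {} \<longrightarrow> ?F y \<le> upper_stab \<xi> ?S m"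
        by (simp only: AE_outer_tuples)
      then have "AE y in distr (Pi\<^sub>M K ?L) (Pi\<^sub>M {1..n} ?L) ?r. inj_on y {1..n} \<and> y ` {1..n} \<inter> ?C = {} \<longrightarrow> ?F y \<le> upper_stab \<xi> ?S m"
        by (simp only: distr_reindex_lborel[OF t finite_atLeastAtMost])
      then have "AE y in Pi\<^sub>M K ?L. inj_on (?r y) {1..n} \<and> ?r y ` {1..n} \<inter> ?C = {} \<longrightarrow> ?F (?r y) \<le> upper_stab \<xi> ?S m"
        using t by (intro AE_distrD[where f="?r"]) (auto simp: bij_betw_def intro!: measurable_restrict measurable_component_singleton)
      moreover have "AE y in Pi\<^sub>M K ?L. inj_on y K" using I(2) by (rule AE_inj_on_lborel)
      ultimately show "AE y in Pi\<^sub>M K ?L. (\<forall>i\<in>I. merge I K (s, y) i \<in> ?C) \<and> (\<forall>k\<in>K. merge I K (s, y) k \<notin> ?C)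
        \<longrightarrow> ?le (merge I K (s, y) ` (I \<union> K))"
      proof eventually_elim
        case (elim y)
        have tK: "t ` {1..n} = K" "inj_on t {1..n}" using t by (auto simp: bij_betw_def)
        have "?r y ` {1..n} = (\<lambda>k. y (t k)) ` {1..n}" by (rule image_cong) auto
        then have im: "?r y ` {1..n} = y ` K" using tK(1) by (metis image_image)
        have "inj_on (y \<circ> t) {1..n}" using comp_inj_on[of t "{1..n}" y] tK elim(2) by metis
        moreover have "inj_on (?r y) {1..n} = inj_on (y \<circ> t) {1..n}" by (rule inj_on_cong) simp
        ultimately have inj: "inj_on (?r y) {1..n}" by simp
        have mIK: "\<And>i. i \<in> I \<Longrightarrow> merge I K (s, y) i = s i" "\<And>k. k \<in> K \<Longrightarrow> merge I K (s, y) k = y k"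
          using I(3) by (auto simp: merge_def)
        then have "merge I K (s, y) ` I = s ` I" "merge I K (s, y) ` K = y ` K"
          by (intro image_cong refl; simp)+
        note mg = image_Un[of "merge I K (s, y)" I K, unfolded this] mIK
        show ?case
        proof (intro impI, elim conjE)
          assume "\<forall>i\<in>I. merge I K (s, y) i \<in> ?C" and "\<forall>k\<in>K. merge I K (s, y) k \<notin> ?C"
          then have s: "?S \<inter> ?C = ?S" and y: "y ` K \<inter> ?C = {}" by (auto simp: mg)
          have "?F (?r y) \<le> upper_stab \<xi> ?S m" using elim(1) inj y im by simp
          moreover have "upper_stab \<xi> ?S m = upper_stab \<xi> (?S \<union> y ` K) m"
            using upper_stab_local[of \<xi> "?S \<union> y ` K" m] y s by (simp add: Int_Un_distrib2)
          ultimately show "?le (merge I K (s, y) ` (I \<union> K))" using s im by (simp add: mg)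
        qed
      qed
    qed
  qed
  have "AE u in Pi\<^sub>M J ?L. \<forall>I\<in>Pow J - {J}. (\<forall>i\<in>I. u i \<in> ?C) \<and> (\<forall>k\<in>J - I. u k \<notin> ?C) \<longrightarrow> ?le (u ` J)"
  proof (rule AE_finite_allI)
    fix I assume "I \<in> Pow J - {J}"
    then have I: "finite I" "J - I \<noteq> {}" "I \<union> (J - I) = J" using J by (auto simp: finite_subset)
    then show "AE u in Pi\<^sub>M J ?L. (\<forall>i\<in>I. u i \<in> ?C) \<and> (\<forall>k\<in>J - I. u k \<notin> ?C) \<longrightarrow> ?le (u ` J)"
      using split[of I "J - I", unfolded I(3)] J by simp
  qed (use J in auto)
  then show ?thesis
  proof eventually_elim
    case (elim u)
    show ?case
    proof
      assume "\<exists>j\<in>J. u j \<notin> ?C"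
      then have "{i \<in> J. u i \<in> ?C} \<in> Pow J - {J}" by auto
      from elim[rule_format, OF this] show "?le (u ` J)" by auto
    qed
  qed
qed

section \<open>Two points of the sample\<close>

definition magnify :: "real \<Rightarrow> 'a \<Rightarrow> 'a \<Rightarrow> 'a::euclidean_space" where
  "magnify c x z = c *\<^sub>R (z - x)"

lemma measurable_magnify[measurable]: "magnify c x \<in> borel_measurable borel"
  by (simp add: magnify_def[abs_def])

lemma magnify_vimage_sets: "B \<in> sets borel \<Longrightarrow> magnify c x -` B \<in> sets borel"
  using measurable_sets[OF measurable_magnify, of B c x] by simp

text \<open>Values in \<open>[0, 1]\<close> make the difference of two means at most the probability that the
  functional sees a difference inside the ball.\<close>

definition local_functional :: "real \<Rightarrow> ('a::euclidean_space set \<Rightarrow> real) \<Rightarrow> bool" where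
  "local_functional m g \<longleftrightarrow> g \<in> borel_measurable point_sets \<and>
     (\<forall>S. locally_finite S \<longrightarrow> 0 \<le> g S \<and> g S \<le> 1 \<and> g (S \<inter> cball 0 m) = g S)"

lemma local_functionalD:
  assumes "local_functional m g"
  shows "g \<in> borel_measurable point_sets" "\<And>S. locally_finite S \<Longrightarrow> 0 \<le> g S \<and> g S \<le> 1"
    "\<And>S. locally_finite S \<Longrightarrow> g (S \<inter> cball 0 m) = g S"
  using assms by (auto simp: local_functional_def)

lemma local_functional_1: "local_functional m (\<lambda>_. 1)"
  by (simp add: local_functional_def)

lemma locally_finite_magnify: "0 < c \<Longrightarrow> locally_finite S \<Longrightarrow> locally_finite (magnify c x ` S)"
  using locally_finite_affine[of S c x] by (simp add: magnify_def[abs_def])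

lemma local_functional_magnify:
  fixes x :: "'a::euclidean_space"
  assumes g: "local_functional m g" and c: "0 < c"
    and A: "magnify c x -` cball 0 m \<subseteq> A" and S: "locally_finite S"
  shows "g (magnify c x ` (S \<inter> A)) = g (magnify c x ` S)"
proof -
  have "magnify c x ` (S \<inter> A) \<inter> cball 0 m = magnify c x ` S \<inter> cball 0 m" using A by auto
  then show ?thesis
    using local_functionalD(3)[OF g locally_finite_magnify[OF c S]]
      local_functionalD(3)[OF g locally_finite_magnify[OF c locally_finite_Int[OF S]]] by metis
qed

lemma abs_diff_mult_le:
  fixes a b a' b' :: real
  assumes "0 \<le> a" "a \<le> 1" "0 \<le> b'" "b' \<le> 1" 
  shows "\<bar>a * b - a' * b'\<bar> \<le> \<bar>a - a'\<bar> + \<bar>b - b'\<bar>"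
proof -
  have "a * b - a' * b' = a * (b - b') + (a - a') * b'" by (simp add: algebra_simps)
  then have "\<bar>a * b - a' * b'\<bar> \<le> \<bar>a * (b - b')\<bar> + \<bar>(a - a') * b'\<bar>" by (metis abs_triangle_ineq)
  also have "\<dots> = a * \<bar>b - b'\<bar> + \<bar>a - a'\<bar> * b'" using assms by (simp add: abs_mult)
  also have "\<dots> \<le> \<bar>b - b'\<bar> + \<bar>a - a'\<bar>"
    using assms by (intro add_mono mult_left_le mult_left_le_one_le) auto
  finally show ?thesis by simp
qed

lemma (in prob_space) expectation_01:
  fixes g :: "'a \<Rightarrow> real"
  assumes "g \<in> borel_measurable M" "\<And>x. x \<in> space M \<Longrightarrow> 0 \<le> g x \<and> g x \<le> 1"
  shows "integrable M g" "0 \<le> expectation g" "expectation g \<le> 1"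
proof -
  show i: "integrable M g"
    using assms by (intro integrable_const_bound[where B=1]) auto
  show "0 \<le> expectation g" using assms by (intro integral_nonneg_AE AE_I2) auto
  show "expectation g \<le> 1" using assms i by (intro integral_le_const) auto
qed

text \<open>The mean over a family of Poisson laws is a Lipschitz function of the intensity.\<close>

lemma continuous_poisson_mean:
  fixes g :: "'a::euclidean_space set \<Rightarrow> real"
  assumes L: "\<And>\<tau>. 0 < \<tau> \<Longrightarrow> poisson_law (\<lambda>B. \<tau> * measure lborel B) (L \<tau>)" and g: "local_functional m g"
  shows "continuous_on {0<..} (\<lambda>\<tau>. \<integral>S. g S \<partial>L \<tau>)"
proof (rule lipschitz_on_continuous_on[OF lipschitz_onI])
  let ?W = "cball 0 m :: 'a set"
  have Wf: "emeasure lborel ?W < \<infinity>" by (rule emeasure_bounded_finite) simp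
  fix \<sigma> \<tau> :: real assume st: "\<sigma> \<in> {0<..}" "\<tau> \<in> {0<..}"
  have "\<bar>(\<integral>S. g S \<partial>L \<sigma>) - (\<integral>S. g S \<partial>L \<tau>)\<bar> \<le> (LINT u:?W|lborel. \<bar>\<sigma> - \<tau>\<bar>)"
    by (rule poisson_density_error[OF L L])
       (use st Wf local_functionalD[OF g] in \<open>auto simp: set_integrable_def set_lebesgue_integral_def\<close>)
  also have "\<dots> = measure lborel ?W * \<bar>\<sigma> - \<tau>\<bar>"
    by (simp add: set_lebesgue_integral_def)
  finally show "dist (\<integral>S. g S \<partial>L \<sigma>) (\<integral>S. g S \<partial>L \<tau>) \<le> measure lborel ?W * dist \<sigma> \<tau>"
    by (simp add: dist_real_def)
qed simp

locale sample_density =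
  fixes f :: "'a::euclidean_space \<Rightarrow> real"
  assumes f_int: "integrable lborel f" and f_nonneg: "\<And>x. 0 \<le> f x" and f_mass: "(\<integral>x. f x \<partial>lborel) = 1"
begin

definition Q :: "'a measure" where
  "Q = density lborel (\<lambda>x. ennreal (f x))"

definition scale :: "nat \<Rightarrow> real" where
  "scale n = real n powr (1 / real DIM('a))"

definition oscillation :: "nat \<Rightarrow> nat \<Rightarrow> 'a \<Rightarrow> real" where
  "oscillation m n x = (LINT u:cball 0 (real m)|lborel. \<bar>f (x + (1 / scale n) *\<^sub>R u) - f x\<bar>)"

text \<open>The first summand and the factor of the second that vanishes with \<open>n\<close> come from Poissonization, the rest
  from replacing the density near \<open>x\<close> by the constant \<open>f x\<close>.\<close>

definition local_error :: "nat \<Rightarrow> nat \<Rightarrow> 'a \<Rightarrow> real" where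
  "local_error m n x =
     sqrt (real n + 4) / real n * measure lborel (cball 0 (real m) :: 'a set) * f x +
     (sqrt (real n + 4) / real n + 1) * oscillation m n x"

lemma f_measurable[measurable]: "f \<in> borel_measurable borel"
  using f_int by auto

lemma sets_Q[measurable_cong, simp]: "sets Q = sets borel"
  by (simp add: Q_def)

lemma space_Q[simp]: "space Q = UNIV"
  by (simp add: Q_def)

lemma prob_space_Q: "prob_space Q"
proof (rule prob_spaceI)
  have "emeasure Q (space Q) = (\<integral>\<^sup>+x. ennreal (f x) \<partial>lborel)"
    by (simp add: Q_def emeasure_density)
  also have "\<dots> = 1"
    using nn_integral_eq_integral[OF f_int] f_nonneg f_mass by simp
  finally show "emeasure Q (space Q) = 1" .
qed

sublocale Q: prob_space Q
  by (rule prob_space_Q)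

lemma integral_Q: "h \<in> borel_measurable borel \<Longrightarrow> (\<integral>x. h x \<partial>Q) = (\<integral>x. f x * h x \<partial>lborel)" for h :: "'a \<Rightarrow> real"
  unfolding Q_def by (subst integral_density) (auto simp: f_nonneg)

lemma AE_Q_pos: "AE x in Q. 0 < f x"
  unfolding Q_def by (subst AE_density) (auto simp: ennreal_eq_0_iff less_le f_nonneg)

lemma scale_pos: "1 \<le> n \<Longrightarrow> 0 < scale n"
  by (simp add: scale_def)

lemma scale_power: "1 \<le> n \<Longrightarrow> scale n ^ DIM('a) = real n"
  by (simp add: scale_def powr_realpow[symmetric] powr_powr)

lemma scale_at_top: "filterlim scale at_top sequentially"
proof -
  have "0 < 1 / real DIM('a)" by simp
  then show ?thesis unfolding scale_def[abs_def] by real_asymp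
qed

lemma oscillation_nonneg: "0 \<le> oscillation m n x"
  unfolding oscillation_def set_lebesgue_integral_def by (rule integral_nonneg_AE) simp

lemma oscillation_measurable[measurable]: "oscillation m n \<in> borel_measurable borel"
proof -
  have [measurable]: "cball 0 (real m) \<in> sets (borel :: 'a measure)" by simp
  have "oscillation m n \<in> borel_measurable lborel"
    unfolding oscillation_def[abs_def] set_lebesgue_integral_def by measurable
  then show ?thesis by simp
qed

lemma local_error_nonneg: "0 \<le> local_error m n x"
  unfolding local_error_def
  by (intro add_nonneg_nonneg mult_nonneg_nonneg oscillation_nonneg f_nonneg divide_nonneg_nonneg) auto

lemma local_error_measurable[measurable]: "local_error m n \<in> borel_measurable borel"
  unfolding local_error_def[abs_def] by measurable

text \<open>On the magnified scale the mass is the integral of \<open>f (x + u / c)\<close> over the ball.\<close>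

lemma ball_mass_le:
  assumes n: "1 \<le> n"
  shows "real n * measure Q (magnify (scale n) x -` cball 0 (real m)) \<le>
     measure lborel (cball 0 (real m) :: 'a set) * f x + oscillation m n x"
proof -
  let ?W = "cball 0 (real m) :: 'a set"
  have Wf: "emeasure lborel ?W < \<infinity>" by (rule emeasure_bounded_finite) simp
  have i: "set_integrable lborel ?W (\<lambda>u. f (x + (1 / scale n) *\<^sub>R u))" "set_integrable lborel ?W (\<lambda>u. f x)"
  proof -
    show "set_integrable lborel ?W (\<lambda>u. f (x + (1 / scale n) *\<^sub>R u))"
      unfolding set_integrable_def using scale_pos[OF n]
      by (intro integrable_mult_indicator integrable_affine f_int) auto
    show "set_integrable lborel ?W (\<lambda>u. f x)"
      using Wf by (simp add: set_integrable_def)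
  qed
  have "real n * measure Q (magnify (scale n) x -` ?W) = (LINT u:?W|lborel. f (x + (1 / scale n) *\<^sub>R u))"
    using magnified_mass[OF f_int f_nonneg scale_pos[OF n], of ?W x] n
    by (simp add: scale_power Q_def magnify_def[abs_def])
  also have "\<dots> \<le> (LINT u:?W|lborel. f x + \<bar>f (x + (1 / scale n) *\<^sub>R u) - f x\<bar>)"
    by (rule set_integral_mono[OF i(1)])
       (use i in \<open>auto intro!: set_integral_add set_integrable_abs set_integral_diff\<close>)
  also have "\<dots> = (LINT u:?W|lborel. f x) + oscillation m n x"
    unfolding oscillation_def using i by (intro set_integral_add set_integrable_abs set_integral_diff)
  also have "(LINT u:?W|lborel. f x) = measure lborel ?W * f x" by (simp add: set_lebesgue_integral_def)
  finally show ?thesis .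
qed

text \<open>Seen from two well separated points, the rest of the sample looks like two independent Poisson
  processes: Poissonization makes the regions around the points independent, and in each of them the
  density of the sample may be replaced by its value at the point.\<close>

lemma two_point_error:
  fixes J :: "'i set" and g k :: "'a set \<Rightarrow> real"
  assumes n: "1 \<le> n" and J: "finite J" "card J + 2 = n"
    and g: "local_functional (real m) g" and k: "local_functional (real m) k"
    and Lx: "poisson_law (\<lambda>B. f x * measure lborel B) Lx" and Ly: "poisson_law (\<lambda>B. f y * measure lborel B) Ly"
    and sep: "2 * real m < scale n * dist x y"
  shows "\<bar>(\<integral>w. g (magnify (scale n) x ` w ` J) * k (magnify (scale n) y ` w ` J) \<partial>(\<Pi>\<^sub>M j\<in>J. Q)) -
      (\<integral>S. g S \<partial>Lx) * (\<integral>S. k S \<partial>Ly)\<bar> \<le> local_error m n x + local_error m n y"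
proof -
  let ?c = "scale n" and ?B = "cball 0 (real m) :: 'a set"
  let ?A = "magnify ?c x -` ?B" and ?A' = "magnify ?c y -` ?B"
  let ?g = "\<lambda>S. g (magnify ?c x ` S)" and ?k = "\<lambda>S. k (magnify ?c y ` S)"
  have c: "0 < ?c" using n by (rule scale_pos)
  have mm: "(\<lambda>S. magnify ?c x ` S) \<in> measurable point_sets point_sets" for x :: 'a
    using measurable_affine_point_sets[of ?c x] c by (simp add: magnify_def[abs_def])
  have AS: "?A \<in> sets borel" "?A' \<in> sets borel" by (auto intro: magnify_vimage_sets)
  have disj: "?A \<inter> ?A' = {}"
  proof (rule ccontr)
    assume "?A \<inter> ?A' \<noteq> {}"
    then obtain z where z: "norm (?c *\<^sub>R (z - x)) \<le> real m" "norm (?c *\<^sub>R (z - y)) \<le> real m"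
      by (auto simp: magnify_def)
    have "?c * dist x y = norm (?c *\<^sub>R (z - y) - ?c *\<^sub>R (z - x))"
      using c by (simp add: dist_norm flip: scaleR_diff_right)
    also have "\<dots> \<le> 2 * real m" using z norm_triangle_ineq4[of "?c *\<^sub>R (z - y)" "?c *\<^sub>R (z - x)"] by simp
    finally show False using sep by simp
  qed
  note gm = measurable_compose[OF mm[of x] local_functionalD(1)[OF g]]
  note km = measurable_compose[OF mm[of y] local_functionalD(1)[OF k]]
  have g01: "0 \<le> ?g S \<and> ?g S \<le> 1" and k01: "0 \<le> ?k S \<and> ?k S \<le> 1" if "locally_finite S" for S
    using local_functionalD(2)[OF g] local_functionalD(2)[OF k] locally_finite_magnify[OF c that] by auto
  have gloc: "?g (S \<inter> A) = ?g S" if "?A \<subseteq> A" "locally_finite S" for S A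
    using local_functional_magnify[OF g c that] .
  have kloc: "?k (S \<inter> A) = ?k S" if "?A' \<subseteq> A" "locally_finite S" for S A
    using local_functional_magnify[OF k c that] .
  let ?P = "poissonized (real n) Q"
  have P: "poisson_law (\<lambda>B. real n * measure Q B) ?P"
    using n by (intro poisson_law_poissonized prob_space_Q) auto
  have P': "poisson_law (\<lambda>B. ?c ^ DIM('a) * measure (density lborel (\<lambda>z. ennreal (f z))) B) ?P"
    using P n by (simp add: scale_power Q_def)
  have 1: "\<bar>(\<integral>w. ?g (w ` J) * ?k (w ` J) \<partial>(\<Pi>\<^sub>M j\<in>J. Q)) - (\<integral>S. ?g S * ?k S \<partial>?P)\<bar> \<le>
      measure Q (?A \<union> ?A') * sqrt (real n + (real n - real (card J))\<^sup>2)"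
  proof (rule poissonization_error[OF prob_space_Q sets_Q _ J(1)])
    show "(\<lambda>S. ?g S * ?k S) \<in> borel_measurable point_sets" using gm km by (rule borel_measurable_times)
    show "0 \<le> ?g S * ?k S \<and> ?g S * ?k S \<le> 1" if "locally_finite S" for S
      using g01[OF that] k01[OF that] by (auto intro: mult_le_one)
    show "?g (S \<inter> (?A \<union> ?A')) * ?k (S \<inter> (?A \<union> ?A')) = ?g S * ?k S" if "locally_finite S" for S
      using gloc[of "?A \<union> ?A'" S] kloc[of "?A \<union> ?A'" S] that by simp
  qed (use n AS in auto)
  have 2: "(\<integral>S. ?g S * ?k S \<partial>?P) = (\<integral>S. ?g S \<partial>?P) * (\<integral>S. ?k S \<partial>?P)"
  proof (rule poisson_independent_regions[OF P AS(1) _ gm g01 _ km k01])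
    fix B :: "'a set" assume B: "B \<in> sets borel"
    have "measure Q B = measure Q ((B \<inter> ?A) \<union> (B - ?A))" by (simp add: Int_Diff_Un)
    also have "\<dots> = measure Q (B \<inter> ?A) + measure Q (B - ?A)"
      using B AS by (intro Q.finite_measure_Union) auto
    finally show "real n * measure Q B = real n * measure Q (B \<inter> ?A) + real n * measure Q (B - ?A)"
      by (simp add: distrib_left)
  next
    show "?k (S - ?A) = ?k S" if "locally_finite S" for S
    proof -
      have "?A' \<subseteq> - ?A" using disj by blast
      from kloc[OF this that] show ?thesis by (simp only: Diff_eq)
    qed
  qed (use gloc in auto)
  have 3: "\<bar>(\<integral>S. ?g S \<partial>?P) - (\<integral>S. g S \<partial>Lx)\<bar> \<le> oscillation m n x"
    unfolding oscillation_def magnify_def[abs_def]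
    by (rule poisson_local_error[OF f_int f_nonneg c P' Lx f_nonneg]) (use local_functionalD[OF g] in auto)
  have 4: "\<bar>(\<integral>S. ?k S \<partial>?P) - (\<integral>S. k S \<partial>Ly)\<bar> \<le> oscillation m n y"
    unfolding oscillation_def magnify_def[abs_def]
    by (rule poisson_local_error[OF f_int f_nonneg c P' Ly f_nonneg]) (use local_functionalD[OF k] in auto)
  interpret P: prob_space ?P using P by (rule poisson_law_prob)
  interpret Ly: prob_space Ly using Ly by (rule poisson_law_prob)
  have 5: "\<bar>(\<integral>S. ?g S \<partial>?P) * (\<integral>S. ?k S \<partial>?P) - (\<integral>S. g S \<partial>Lx) * (\<integral>S. k S \<partial>Ly)\<bar> \<le>
      \<bar>(\<integral>S. ?g S \<partial>?P) - (\<integral>S. g S \<partial>Lx)\<bar> + \<bar>(\<integral>S. ?k S \<partial>?P) - (\<integral>S. k S \<partial>Ly)\<bar>"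
  proof (rule abs_diff_mult_le)
    show "0 \<le> (\<integral>S. ?g S \<partial>?P)" "(\<integral>S. ?g S \<partial>?P) \<le> 1"
      using P.expectation_01[OF poisson_law_measurable[OF P gm]] g01 poisson_law_space[OF P] by auto
    show "0 \<le> (\<integral>S. k S \<partial>Ly)" "(\<integral>S. k S \<partial>Ly) \<le> 1"
      using Ly.expectation_01[OF poisson_law_measurable[OF Ly local_functionalD(1)[OF k]]]
        local_functionalD(2)[OF k] poisson_law_space[OF Ly] by auto
  qed
  \<comment> \<open>two of the \<open>n\<close> points are taken out, which turns the variance \<open>n\<close> of the Poisson sample size into \<open>n + 2\<^sup>2\<close>\<close>
  have nJ: "real n - real (card J) = 2" using J(2) by linarith
  have "measure Q (?A \<union> ?A') \<le> measure Q ?A + measure Q ?A'"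
    using AS by (intro measure_Un_le) auto
  also have "\<dots> = (real n * measure Q ?A + real n * measure Q ?A') / real n"
    using n by (simp add: field_simps)
  also have "\<dots> \<le> ((measure lborel ?B * f x + oscillation m n x) + (measure lborel ?B * f y + oscillation m n y)) / real n"
    using ball_mass_le[OF n] by (intro divide_right_mono add_mono) auto
  finally have "measure Q (?A \<union> ?A') * sqrt (real n + 4) \<le>
      ((measure lborel ?B * f x + oscillation m n x) + (measure lborel ?B * f y + oscillation m n y)) / real n * sqrt (real n + 4)"
    by (rule mult_right_mono) simp
  also have "\<dots> + oscillation m n x + oscillation m n y = local_error m n x + local_error m n y"
    unfolding local_error_def by (simp add: add_divide_distrib algebra_simps)
  finally have "measure Q (?A \<union> ?A') * sqrt (real n + 4) + oscillation m n x + oscillation m n y \<le>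
      local_error m n x + local_error m n y" by simp
  then show ?thesis using 1 2 3 4 5 by (simp add: nJ)
qed

text \<open>The local error combines \<open>f\<close>, with a vanishing coefficient, and its oscillation, which vanishes in
  \<open>L\<^sup>1\<close>, with a bounded one.\<close>

lemma mean_local_error_tendsto_0: "(\<lambda>n. \<integral>x. min 1 (local_error m n x) \<partial>Q) \<longlonglongrightarrow> 0"
proof -
  let ?V = "measure lborel (cball 0 (real m) :: 'a set)"
  have a: "(\<lambda>n. sqrt (real n + 4) / real n * ?V) \<longlonglongrightarrow> 0"
  proof -
    have "(\<lambda>n. sqrt (real n + 4) / real n) \<longlonglongrightarrow> 0" by real_asymp
    then show ?thesis by (rule tendsto_mult_left_zero)
  qed
  have b: "0 \<le> sqrt (real n + 4) / real n + 1 \<and> sqrt (real n + 4) / real n + 1 \<le> 6" for n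
  proof (cases "n = 0")
    case False
    have "sqrt (real n + 4) \<le> real n + 4"
      by (rule real_le_lsqrt) (auto simp: power2_eq_square algebra_simps)
    also have "\<dots> \<le> 5 * real n" using False by simp
    finally show ?thesis using False by (simp add: divide_simps)
  qed simp
  have "(\<lambda>n. \<integral>x. f x * min 1 (sqrt (real n + 4) / real n * ?V * f x + (sqrt (real n + 4) / real n + 1) * oscillation m n x) \<partial>lborel) \<longlonglongrightarrow> 0"
  proof (rule weighted_truncation_tendsto_0[OF f_int f_nonneg _ oscillation_nonneg _ a _ b])
    show "(\<lambda>n. \<integral>\<^sup>+x. ennreal (oscillation m n x) \<partial>lborel) \<longlonglongrightarrow> 0"
      unfolding oscillation_def by (rule L1_local_oscillation[OF f_int _ _ scale_at_top]) auto
  qed auto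
  then show ?thesis
    by (subst integral_Q) (auto simp: local_error_def)
qed

lemma nn_integral_PiM_two:
  assumes I: "finite I" "i \<notin> I" "j \<notin> I" "i \<noteq> j"
    and \<Phi>[measurable]: "\<Phi> \<in> borel_measurable (\<Pi>\<^sub>M l\<in>insert i (insert j I). Q)"
  shows "(\<integral>\<^sup>+z. \<Phi> z \<partial>(\<Pi>\<^sub>M l\<in>insert i (insert j I). Q)) =
     (\<integral>\<^sup>+x. \<integral>\<^sup>+y. \<integral>\<^sup>+w. \<Phi> (w(j := y, i := x)) \<partial>(\<Pi>\<^sub>M l\<in>I. Q) \<partial>Q \<partial>Q)"
proof -
  interpret product_sigma_finite "\<lambda>_. Q" ..
  have "(\<integral>\<^sup>+z. \<Phi> z \<partial>(\<Pi>\<^sub>M l\<in>insert i (insert j I). Q)) =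
      (\<integral>\<^sup>+x. \<integral>\<^sup>+w. \<Phi> (w(i := x)) \<partial>(\<Pi>\<^sub>M l\<in>insert j I. Q) \<partial>Q)"
    using I by (intro product_nn_integral_insert_rev \<Phi>) auto
  also have "\<dots> = (\<integral>\<^sup>+x. \<integral>\<^sup>+y. \<integral>\<^sup>+w. \<Phi> (w(j := y, i := x)) \<partial>(\<Pi>\<^sub>M l\<in>I. Q) \<partial>Q \<partial>Q)"
  proof (rule nn_integral_cong)
    fix x
    have "(\<lambda>w. \<Phi> (w(i := x))) \<in> borel_measurable (\<Pi>\<^sub>M l\<in>insert j I. Q)"
      by (rule measurable_compose[OF _ \<Phi>]) (auto intro!: measurable_fun_upd simp: insert_commute)
    then show "(\<integral>\<^sup>+w. \<Phi> (w(i := x)) \<partial>(\<Pi>\<^sub>M l\<in>insert j I. Q)) =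
        (\<integral>\<^sup>+y. \<integral>\<^sup>+w. \<Phi> (w(j := y, i := x)) \<partial>(\<Pi>\<^sub>M l\<in>I. Q) \<partial>Q)"
      using I by (intro product_nn_integral_insert_rev)
  qed
  finally show ?thesis .
qed

text \<open>The indicator removes the points with \<open>f x = 0\<close>, where there is no Poisson law to refer to; they are
  null for \<open>Q\<close>.\<close>

definition limit_average :: "(real \<Rightarrow> 'a set measure) \<Rightarrow> ('a set \<Rightarrow> real) \<Rightarrow> real" where
  "limit_average L g = (\<integral>x. indicator {0<..} (f x) * (\<integral>S. g S \<partial>L (f x)) \<partial>Q)"

context
  fixes L :: "real \<Rightarrow> 'a set measure"
  assumes L: "\<And>\<tau>. 0 < \<tau> \<Longrightarrow> poisson_law (\<lambda>B. \<tau> * measure lborel B) (L \<tau>)"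
begin

lemma poisson_mean_measurable:
  assumes g: "local_functional m g"
  shows "(\<lambda>x. indicator {0<..} (f x) * (\<integral>S. g S \<partial>L (f x))) \<in> borel_measurable borel"
proof -
  have "(\<lambda>\<tau>. indicator {0<..} \<tau> *\<^sub>R (\<integral>S. g S \<partial>L \<tau>)) \<in> borel_measurable borel"
    by (rule borel_measurable_continuous_on_indicator[OF _ continuous_poisson_mean[OF L g]]) auto
  from measurable_compose[OF f_measurable this] show ?thesis by simp
qed

lemma poisson_mean_01:
  assumes g: "local_functional m g"
  shows "0 \<le> indicator {0<..} (f x) * (\<integral>S. g S \<partial>L (f x)) \<and> indicator {0<..} (f x) * (\<integral>S. g S \<partial>L (f x)) \<le> (1::real)"
proof (cases "0 < f x")
  case True
  interpret Lx: prob_space "L (f x)" using L[OF True] by (rule poisson_law_prob)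
  show ?thesis
    using Lx.expectation_01[OF poisson_law_measurable[OF L[OF True] local_functionalD(1)[OF g]]]
        local_functionalD(2)[OF g] poisson_law_space[OF L[OF True]] by (auto simp: indicator_def)
qed (simp add: indicator_def)

text \<open>The error at two separated points is integrated over both of them. Being a difference of numbers in
  \<open>[0, 1]\<close> it may first be truncated by \<open>1\<close>, which makes its mean vanish for every density.\<close>

lemma two_point_mean_le:
  fixes g k :: "'a set \<Rightarrow> real"
  assumes n: "2 \<le> n" and g: "local_functional (real m) g" and k: "local_functional (real m) k"
  shows "(\<integral>\<^sup>+z. ennreal (indicator {z. 2 * real m < scale n * dist (z 1) (z 2)} z *
       (g (magnify (scale n) (z 1) ` z ` {3..n}) * k (magnify (scale n) (z 2) ` z ` {3..n}))) \<partial>(\<Pi>\<^sub>M i\<in>{1..n}. Q)) \<le>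
     ennreal (limit_average L g * limit_average L k + 2 * (\<integral>x. min 1 (local_error m n x) \<partial>Q))"
proof -
  let ?D = "{z :: nat \<Rightarrow> 'a. 2 * real m < scale n * dist (z 1) (z 2)}"
  let ?F = "\<lambda>x y w. g (magnify (scale n) x ` w ` {3..n}) * k (magnify (scale n) y ` w ` {3..n})"
  define \<gamma> where "\<gamma> g x = indicator {0<..} (f x) * (\<integral>S. g S \<partial>L (f x))" for g :: "'a set \<Rightarrow> real" and x
  define e where "e x = min 1 (local_error m n x)" for x
  have c: "0 < scale n" using n by (intro scale_pos) auto
  have [measurable]: "\<gamma> g \<in> borel_measurable borel" "\<gamma> k \<in> borel_measurable borel" "e \<in> borel_measurable borel"
    using poisson_mean_measurable[OF g] poisson_mean_measurable[OF k] by (auto simp: \<gamma>_def[abs_def] e_def[abs_def])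
  have \<gamma>01: "0 \<le> \<gamma> g x \<and> \<gamma> g x \<le> 1" "0 \<le> \<gamma> k x \<and> \<gamma> k x \<le> 1" for x
    unfolding \<gamma>_def using poisson_mean_01[OF g] poisson_mean_01[OF k] by auto
  have e01: "0 \<le> e x \<and> e x \<le> 1" for x using local_error_nonneg by (auto simp: e_def)
  have iQ: "integrable Q (\<gamma> g)" "integrable Q (\<gamma> k)" "integrable Q e"
    using \<gamma>01 e01 by (auto intro!: Q.expectation_01)
  have eq: "{1..n} = insert 1 (insert 2 {3..n})" using n by auto
  have comp: "(\<lambda>z. z i) \<in> measurable (\<Pi>\<^sub>M i\<in>I. Q) borel" if "i \<in> I" for i and I :: "nat set"
    using that by (intro measurable_component_borel) auto
  have mg: "(\<lambda>z. h (magnify (scale n) (a z) ` z ` {3..n})) \<in> borel_measurable (\<Pi>\<^sub>M i\<in>I. Q)"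
    if h: "local_functional (real m) h" and a: "a \<in> borel_measurable (\<Pi>\<^sub>M i\<in>I. Q)" and I: "{3..n} \<subseteq> I" for h a and I :: "nat set"
  proof -
    have "(\<lambda>z. (\<lambda>j. magnify (scale n) (a z) (z j)) ` {3..n}) \<in> measurable (\<Pi>\<^sub>M i\<in>I. Q) point_sets"
      using a I comp[of _ I] unfolding magnify_def by (intro measurable_finite_image) (auto intro!: borel_measurable_scaleR borel_measurable_diff)
    from measurable_compose[OF this local_functionalD(1)[OF h]] show ?thesis by (simp add: image_image)
  qed
  have D: "(\<lambda>z. indicator ?D z :: real) \<in> borel_measurable (\<Pi>\<^sub>M i\<in>{1..n}. Q)"
  proof -
    have [measurable]: "(\<lambda>z. z 1) \<in> measurable (\<Pi>\<^sub>M i\<in>{1..n}. Q) borel" "(\<lambda>z. z 2) \<in> measurable (\<Pi>\<^sub>M i\<in>{1..n}. Q) borel"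
      using n by (auto intro!: comp)
    have "(\<lambda>z. scale n * dist (z 1) (z 2)) \<in> borel_measurable (\<Pi>\<^sub>M i\<in>{1..n}. Q)" by measurable
    then have "{z \<in> space (\<Pi>\<^sub>M i\<in>{1..n}. Q). 2 * real m < scale n * dist (z 1) (z 2)} \<in> sets (\<Pi>\<^sub>M i\<in>{1..n}. Q)" by measurable
    then show ?thesis by (intro borel_measurable_indicator') simp
  qed
  have inner: "AE y in Q. (\<integral>\<^sup>+w. ennreal (indicator ?D (w(2 := y, 1 := x)) * ?F x y (w(2 := y, 1 := x))) \<partial>(\<Pi>\<^sub>M i\<in>{3..n}. Q))
      \<le> ennreal (\<gamma> g x * \<gamma> k y + e x + e y)" if fx: "0 < f x" for x
    using AE_Q_pos
  proof eventually_elim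
    case (elim y)
    have im: "w(2 := y, 1 := x) ` {3..n} = w ` {3..n}" for w by (rule image_cong) auto
    show ?case
    proof (cases "2 * real m < scale n * dist x y")
      case True
      let ?\<Pi> = "\<Pi>\<^sub>M i\<in>{3..n}. Q"
      interpret \<Pi>: prob_space ?\<Pi> by (rule prob_space_PiM) (rule prob_space_Q)
      have F01: "0 \<le> ?F x y w \<and> ?F x y w \<le> 1" for w
      proof -
        have lf: "locally_finite (magnify (scale n) v ` w ` {3..n})" for v
          by (intro locally_finite_finite) auto
        from local_functionalD(2)[OF g lf[of x]] local_functionalD(2)[OF k lf[of y]] show ?thesis
          by (auto intro: mult_le_one)
      qed
      have Fm: "?F x y \<in> borel_measurable ?\<Pi>"
        using mg[OF g measurable_const, of x "{3..n}"] mg[OF k measurable_const, of y "{3..n}"] by simp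
      have "(\<integral>w. ?F x y w \<partial>?\<Pi>) - \<gamma> g x * \<gamma> k y \<le> local_error m n x + local_error m n y"
        using two_point_error[OF _ _ _ g k L[OF fx] L[OF elim] True, of "{3..n}"] n fx elim
        by (simp add: \<gamma>_def abs_le_iff)
      moreover have "(\<integral>w. ?F x y w \<partial>?\<Pi>) \<le> 1" using \<Pi>.expectation_01(3)[OF Fm] F01 by auto
      moreover have "0 \<le> \<gamma> g x * \<gamma> k y" using \<gamma>01 by auto
      ultimately have "(\<integral>w. ?F x y w \<partial>?\<Pi>) \<le> \<gamma> g x * \<gamma> k y + e x + e y"
        using local_error_nonneg[of m n x] local_error_nonneg[of m n y] unfolding e_def by linarith
      moreover have "(\<integral>\<^sup>+w. ennreal (?F x y w) \<partial>?\<Pi>) = ennreal (\<integral>w. ?F x y w \<partial>?\<Pi>)"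
        using \<Pi>.expectation_01(1)[OF Fm] F01 by (intro nn_integral_eq_integral) auto
      ultimately show ?thesis using True by (simp add: im ennreal_leI)
    qed (simp add: indicator_def)
  qed
  have "(\<integral>\<^sup>+z. ennreal (indicator ?D z * ?F (z 1) (z 2) z) \<partial>(\<Pi>\<^sub>M i\<in>{1..n}. Q)) =
     (\<integral>\<^sup>+x. \<integral>\<^sup>+y. \<integral>\<^sup>+w. ennreal (indicator ?D (w(2 := y, 1 := x)) * ?F x y (w(2 := y, 1 := x))) \<partial>(\<Pi>\<^sub>M i\<in>{3..n}. Q) \<partial>Q \<partial>Q)"
  proof -
    have "(\<lambda>z. ennreal (indicator ?D z * ?F (z 1) (z 2) z)) \<in> borel_measurable (\<Pi>\<^sub>M i\<in>{1..n}. Q)"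
      using D mg[OF g comp[of 1 "{1..n}"]] mg[OF k comp[of 2 "{1..n}"]] n by auto
    from nn_integral_PiM_two[of "{3..n}" 1 2, OF _ _ _ _ this[unfolded eq]] show ?thesis
      unfolding eq by simp
  qed
  also have "\<dots> \<le> (\<integral>\<^sup>+x. \<integral>\<^sup>+y. ennreal (\<gamma> g x * \<gamma> k y + e x + e y) \<partial>Q \<partial>Q)"
    by (rule nn_integral_mono_AE) (use AE_Q_pos inner in \<open>auto elim!: eventually_mono intro!: nn_integral_mono_AE\<close>)
  also have "\<dots> = (\<integral>\<^sup>+x. ennreal (\<gamma> g x * (\<integral>y. \<gamma> k y \<partial>Q) + e x + (\<integral>y. e y \<partial>Q)) \<partial>Q)"
  proof (rule nn_integral_cong)
    fix x
    have "(\<integral>\<^sup>+y. ennreal (\<gamma> g x * \<gamma> k y + e x + e y) \<partial>Q) = ennreal (\<integral>y. \<gamma> g x * \<gamma> k y + e x + e y \<partial>Q)"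
      using iQ \<gamma>01 e01 by (intro nn_integral_eq_integral) (auto intro!: AE_I2 add_nonneg_nonneg)
    also have "(\<integral>y. \<gamma> g x * \<gamma> k y + e x + e y \<partial>Q) = \<gamma> g x * (\<integral>y. \<gamma> k y \<partial>Q) + e x + (\<integral>y. e y \<partial>Q)"
      using iQ Q.prob_space by simp
    finally show "(\<integral>\<^sup>+y. ennreal (\<gamma> g x * \<gamma> k y + e x + e y) \<partial>Q) = ennreal (\<gamma> g x * (\<integral>y. \<gamma> k y \<partial>Q) + e x + (\<integral>y. e y \<partial>Q))" .
  qed
  also have "\<dots> = ennreal (\<integral>x. \<gamma> g x * (\<integral>y. \<gamma> k y \<partial>Q) + e x + (\<integral>y. e y \<partial>Q) \<partial>Q)"
    using iQ \<gamma>01 e01 by (intro nn_integral_eq_integral) (auto intro!: AE_I2 add_nonneg_nonneg mult_nonneg_nonneg integral_nonneg_AE)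
  also have "(\<integral>x. \<gamma> g x * (\<integral>y. \<gamma> k y \<partial>Q) + e x + (\<integral>y. e y \<partial>Q) \<partial>Q) =
      (\<integral>x. \<gamma> g x \<partial>Q) * (\<integral>y. \<gamma> k y \<partial>Q) + 2 * (\<integral>y. e y \<partial>Q)"
    using iQ Q.prob_space by simp
  finally show ?thesis by (simp add: limit_average_def \<gamma>_def e_def)
qed

end

end

section \<open>Absolute continuity of product measures\<close>

lemma AE_singleton_index:
  fixes M :: "'a measure"
  assumes "sigma_finite_measure M" and ae: "AE s in Pi\<^sub>M {i} (\<lambda>_. M). R s"
  shows "AE x in M. R (\<lambda>j\<in>{i}. x)"
proof -
  interpret sigma_finite_measure M by fact
  interpret product_sigma_finite "\<lambda>_. M" ..
  have m: "(\<lambda>x. \<lambda>j\<in>{i}. x) \<in> measurable M (Pi\<^sub>M {i} (\<lambda>_. M))" by measurable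
  have eq: "distr M (Pi\<^sub>M {i} (\<lambda>_. M)) (\<lambda>x. \<lambda>j\<in>{i}. x) = Pi\<^sub>M {i} (\<lambda>_. M)"
  proof (rule PiM_eqI)
    fix A assume A: "\<And>j. j \<in> {i} \<Longrightarrow> A j \<in> sets M"
    then have "(\<lambda>x. \<lambda>j\<in>{i}. x) -` Pi\<^sub>E {i} A \<inter> space M = A i"
      using sets.sets_into_space[of "A i" M] by auto
    then show "emeasure (distr M (Pi\<^sub>M {i} (\<lambda>_. M)) (\<lambda>x. \<lambda>j\<in>{i}. x)) (Pi\<^sub>E {i} A) = (\<Prod>j\<in>{i}. emeasure M (A j))"
      using A by (subst emeasure_distr[OF m]) (auto intro!: sets_PiM_I_finite)
  qed auto
  then have "AE s in distr M (Pi\<^sub>M {i} (\<lambda>_. M)) (\<lambda>x. \<lambda>j\<in>{i}. x). R s" using ae by (simp only: eq)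
  then show ?thesis by (rule AE_distrD[OF m])
qed

text \<open>Absolute continuity of the factors passes to the products, one coordinate at a time by Fubini.\<close>

lemma AE_PiM_transfer:
  fixes Q :: "'b measure" and R :: "'c measure" and J :: "'i set"
  assumes Q: "prob_space Q" and R: "sigma_finite_measure R" and T: "T \<in> measurable Q R"
    and ac: "\<And>N. N \<in> null_sets R \<Longrightarrow> T -` N \<inter> space Q \<in> null_sets Q"
    and J: "finite J"
    and P: "{u \<in> space (Pi\<^sub>M J (\<lambda>_. R)). P u} \<in> sets (Pi\<^sub>M J (\<lambda>_. R))"
    and ae: "AE u in Pi\<^sub>M J (\<lambda>_. R). P u"
  shows "AE z in Pi\<^sub>M J (\<lambda>_. Q). P (\<lambda>j\<in>J. T (z j))"
  using J P ae
proof (induction J arbitrary: P rule: finite_induct)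
  case empty
  have "P (\<lambda>_. undefined)"
    using empty(2) unfolding PiM_empty AE_count_space by simp
  then show ?case unfolding PiM_empty AE_count_space by (simp add: restrict_def)
next
  case (insert i J)
  interpret Q: prob_space Q by fact
  interpret R: sigma_finite_measure R by fact
  interpret PR: product_sigma_finite "\<lambda>_::'i. R" ..
  interpret PQ: product_sigma_finite "\<lambda>_::'i. Q" ..
  let ?Ri = "Pi\<^sub>M {i} (\<lambda>_. R)" and ?RJ = "Pi\<^sub>M J (\<lambda>_. R)"
  have eq: "insert i J = {i} \<union> J" by simp
  have dis: "{i} \<inter> J = {}" using insert.hyps by simp
  interpret Ri: sigma_finite_measure ?Ri by (rule PR.sigma_finite) simp
  interpret RJ: sigma_finite_measure ?RJ by (rule PR.sigma_finite) (rule insert.hyps)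
  interpret pair_sigma_finite ?Ri ?RJ ..
  have mg: "merge {i} J \<in> measurable (?Ri \<Otimes>\<^sub>M ?RJ) (Pi\<^sub>M ({i} \<union> J) (\<lambda>_. R))" by (rule measurable_merge)
  have D: "distr (?Ri \<Otimes>\<^sub>M ?RJ) (Pi\<^sub>M ({i} \<union> J) (\<lambda>_. R)) (merge {i} J) = Pi\<^sub>M ({i} \<union> J) (\<lambda>_. R)"
    by (rule PR.distr_merge[OF dis _ insert.hyps(1)]) simp
  have "AE u in distr (?Ri \<Otimes>\<^sub>M ?RJ) (Pi\<^sub>M ({i} \<union> J) (\<lambda>_. R)) (merge {i} J). P u"
    using insert.prems(2) unfolding D eq .
  from AE_pair[OF AE_distrD[OF mg this]]
  have "AE s in ?Ri. AE y in ?RJ. P (merge {i} J (s, y))" .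
  then have "AE s in ?Ri. AE z in Pi\<^sub>M J (\<lambda>_. Q). P (merge {i} J (s, \<lambda>j\<in>J. T (z j)))"
    using AE_space
  proof eventually_elim
    fix s assume s: "s \<in> space ?Ri" and ae: "AE y in ?RJ. P (merge {i} J (s, y))"
    have "(\<lambda>y. merge {i} J (s, y)) \<in> measurable ?RJ (Pi\<^sub>M ({i} \<union> J) (\<lambda>_. R))"
      using measurable_compose[OF measurable_Pair1'[OF s] mg] by simp
    from measurable_sets[OF this insert.prems(1)[unfolded eq]] measurable_space[OF this]
    have M: "{y \<in> space ?RJ. P (merge {i} J (s, y))} \<in> sets ?RJ"
      by (simp add: vimage_def Int_def conj_commute cong: conj_cong)
    from insert.IH[OF M ae] show "AE z in Pi\<^sub>M J (\<lambda>_. Q). P (merge {i} J (s, \<lambda>j\<in>J. T (z j)))" .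
  qed
  from AE_singleton_index[OF R this]
  have "AE x in R. AE z in Pi\<^sub>M J (\<lambda>_. Q). P (merge {i} J (\<lambda>j\<in>{i}. x, \<lambda>j\<in>J. T (z j)))" .
  then obtain N where N: "{x \<in> space R. \<not> (AE z in Pi\<^sub>M J (\<lambda>_. Q). P (merge {i} J (\<lambda>j\<in>{i}. x, \<lambda>j\<in>J. T (z j))))} \<subseteq> N"
      "emeasure R N = 0" "N \<in> sets R" by (rule AE_E)
  have "AE x in Q. AE z in Pi\<^sub>M J (\<lambda>_. Q). P (merge {i} J (\<lambda>j\<in>{i}. T x, \<lambda>j\<in>J. T (z j)))"
  proof (rule AE_I')
    show "T -` N \<inter> space Q \<in> null_sets Q" using N by (intro ac) (auto intro: null_setsI)
    show "{x \<in> space Q. \<not> (AE z in Pi\<^sub>M J (\<lambda>_. Q). P (merge {i} J (\<lambda>j\<in>{i}. T x, \<lambda>j\<in>J. T (z j))))} \<subseteq> T -` N \<inter> space Q"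
      using N(1) measurable_space[OF T] by auto
  qed
  then have "AE x in distr (Pi\<^sub>M {i} (\<lambda>_. Q)) Q (\<lambda>z. z i). AE z in Pi\<^sub>M J (\<lambda>_. Q). P (merge {i} J (\<lambda>j\<in>{i}. T x, \<lambda>j\<in>J. T (z j)))"
    by (simp only: PQ.distr_singleton)
  then have "AE z1 in Pi\<^sub>M {i} (\<lambda>_. Q). AE z in Pi\<^sub>M J (\<lambda>_. Q). P (merge {i} J (\<lambda>j\<in>{i}. T (z1 i), \<lambda>j\<in>J. T (z j)))"
    by (rule AE_distrD[rotated]) simp
  moreover have "merge {i} J (\<lambda>j\<in>{i}. T (z1 i), \<lambda>j\<in>J. T (z j)) = (\<lambda>j\<in>{i} \<union> J. T (merge {i} J (z1, z) j))" for z1 z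
    using dis by (auto simp: merge_def fun_eq_iff)
  ultimately have fin: "AE z1 in Pi\<^sub>M {i} (\<lambda>_. Q). AE z in Pi\<^sub>M J (\<lambda>_. Q). P (\<lambda>j\<in>{i} \<union> J. T (merge {i} J (z1, z) j))"
    by simp
  have mT: "(\<lambda>z. \<lambda>j\<in>{i} \<union> J. T (z j)) \<in> measurable (Pi\<^sub>M ({i} \<union> J) (\<lambda>_. Q)) (Pi\<^sub>M ({i} \<union> J) (\<lambda>_. R))"
    by (intro measurable_restrict measurable_compose[OF _ T] measurable_component_singleton)
  have "{z \<in> space (Pi\<^sub>M ({i} \<union> J) (\<lambda>_. Q)). P (\<lambda>j\<in>{i} \<union> J. T (z j))} \<in> sets (Pi\<^sub>M ({i} \<union> J) (\<lambda>_. Q))"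
    using measurable_sets[OF mT insert.prems(1)[unfolded eq]] measurable_space[OF mT]
    by (simp add: vimage_def Int_def conj_commute cong: conj_cong)
  from AE_PiM_unionI[OF PQ.product_sigma_finite_axioms _ insert.hyps(1) dis this fin] show ?case
    unfolding eq by simp
qed

lemma null_sets_affine:
  fixes N :: "'a::euclidean_space set"
  assumes N: "N \<in> null_sets lborel" and c: "c \<noteq> 0"
  shows "magnify c x -` N \<in> null_sets lborel"
proof -
  have Ns: "N \<in> sets borel" using N by (simp add: null_sets_def)
  have eq: "magnify c x -` N = {u. (- c *\<^sub>R x) + c *\<^sub>R u \<in> N}" by (auto simp: magnify_def algebra_simps)
  have "0 = (\<integral>\<^sup>+z. indicator N z \<partial>lborel)" using N Ns by (simp add: null_setsD1)
  also have "\<dots> = ennreal (\<bar>c\<bar> ^ DIM('a)) * (\<integral>\<^sup>+u. indicator N ((- c *\<^sub>R x) + c *\<^sub>R u) \<partial>lborel)"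
    using Ns c by (intro nn_integral_affine) auto
  also have "(\<integral>\<^sup>+u. indicator N ((- c *\<^sub>R x) + c *\<^sub>R u) \<partial>lborel) = (\<integral>\<^sup>+u. indicator (magnify c x -` N) u \<partial>lborel)"
    unfolding eq by (intro nn_integral_cong) (auto simp: indicator_def)
  finally have "emeasure lborel (magnify c x -` N) = 0"
    using c magnify_vimage_sets[OF Ns, of c x] by (auto simp: zero_less_power)
  then show ?thesis using magnify_vimage_sets[OF Ns] by (simp add: null_sets_def)
qed

context sample_density
begin

lemma null_sets_Q: "N \<in> null_sets lborel \<Longrightarrow> N \<in> null_sets Q"
  unfolding Q_def using absolutely_continuousI_density[of "\<lambda>x. ennreal (f x)" lborel]
  by (auto simp: absolutely_continuous_def)

lemma AE_inj_on_sample: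
  fixes J :: "'i set"
  assumes J: "finite J"
  shows "AE z in (\<Pi>\<^sub>M j\<in>J. Q). inj_on z J"
proof -
  have m: "(\<lambda>y. y i) \<in> borel_measurable (Pi\<^sub>M J (\<lambda>_. lborel :: 'a measure))" if "i \<in> J" for i
    using measurable_component_borel[of lborel i J] that by simp
  have "{u \<in> space (Pi\<^sub>M J (\<lambda>_. lborel :: 'a measure)). i = j \<or> u i - u j \<noteq> 0} \<in> sets (Pi\<^sub>M J (\<lambda>_. lborel))"
    if ij: "i \<in> J" "j \<in> J" for i j
  proof -
    have "(\<lambda>u. u i - u j) \<in> borel_measurable (Pi\<^sub>M J (\<lambda>_. lborel :: 'a measure))"
      using ij by (intro borel_measurable_diff m)
    then have "{u \<in> space (Pi\<^sub>M J (\<lambda>_. lborel :: 'a measure)). u i - u j \<noteq> 0} \<in> sets (Pi\<^sub>M J (\<lambda>_. lborel))" by measurable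
    then show ?thesis by (cases "i = j") auto
  qed
  then have "{u \<in> space (Pi\<^sub>M J (\<lambda>_. lborel :: 'a measure)). \<forall>i\<in>J. \<forall>j\<in>J. i = j \<or> u i - u j \<noteq> 0} \<in> sets (Pi\<^sub>M J (\<lambda>_. lborel))"
    using J by (intro sets.sets_Collect_finite_All) auto
  moreover have "AE u in Pi\<^sub>M J (\<lambda>_. lborel :: 'a measure). \<forall>i\<in>J. \<forall>j\<in>J. i = j \<or> u i - u j \<noteq> 0"
    using AE_inj_on_lborel[OF J] by eventually_elim (auto simp: inj_on_def)
  ultimately have "AE z in (\<Pi>\<^sub>M j\<in>J. Q). \<forall>i\<in>J. \<forall>j\<in>J. i = j \<or> (\<lambda>j\<in>J. id (z j)) i - (\<lambda>j\<in>J. id (z j)) j \<noteq> 0"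
    using J null_sets_Q
    by (intro AE_PiM_transfer[where R="lborel" and T=id] prob_space_Q lborel.sigma_finite_measure_axioms) auto
  then show ?thesis by eventually_elim (auto simp: inj_on_def)
qed

lemma sample_eval_le_upper_stab:
  fixes J :: "'i set" and \<zeta> :: "'a \<Rightarrow> 'a set \<Rightarrow> real"
  assumes \<zeta>: "measurable_functional \<zeta>" and J: "finite J" and c: "0 < c"
  shows "AE w in (\<Pi>\<^sub>M j\<in>J. Q). (\<exists>j\<in>J. magnify c x (w j) \<notin> cball 0 (real m)) \<longrightarrow>
    ennreal (eval_at \<zeta> 0 (magnify c x ` w ` J)) \<le> upper_stab \<zeta> (magnify c x ` w ` J) m"
proof -
  let ?P = "\<lambda>u::'i \<Rightarrow> 'a. (\<exists>j\<in>J. u j \<notin> cball 0 (real m)) \<longrightarrow> ennreal (eval_at \<zeta> 0 (u ` J)) \<le> upper_stab \<zeta> (u ` J) m"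
  let ?L = "Pi\<^sub>M J (\<lambda>_. lborel :: 'a measure)"
  have "AE w in (\<Pi>\<^sub>M j\<in>J. Q). ?P (\<lambda>j\<in>J. magnify c x (w j))"
  proof (rule AE_PiM_transfer[where R="lborel"])
    show "{u \<in> space ?L. ?P u} \<in> sets ?L"
    proof -
      have ms: "(\<lambda>u. u ` J) \<in> measurable ?L point_sets" using J by (intro measurable_sample_points) auto
      have cm: "(\<lambda>u. u i) \<in> borel_measurable ?L" if "i \<in> J" for i
        using measurable_component_borel[of lborel i J] that by simp
      have "{u \<in> space ?L. ennreal (eval_at \<zeta> 0 (u ` J)) \<le> upper_stab \<zeta> (u ` J) m} \<in> sets ?L"
        using measurable_compose[OF ms measurable_upper_stab[OF \<zeta>, of m]] measurable_eval_at[OF \<zeta> ms measurable_const[of 0]]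
        by measurable
      moreover have "{u \<in> space ?L. \<exists>j\<in>J. u j \<notin> cball 0 (real m)} \<in> sets ?L"
        using J cm by (intro sets.sets_Collect_finite_Ex) auto
      ultimately show ?thesis by (intro sets.sets_Collect_imp)
    qed
    show "AE u in ?L. ?P u" by (rule eval_le_upper_stab[OF \<zeta> J])
    show "magnify c x -` N \<inter> space Q \<in> null_sets Q" if "N \<in> null_sets lborel" for N
      using null_sets_Q[OF null_sets_affine[OF that]] c by simp
    show "magnify c x \<in> measurable Q lborel" by (simp add: measurable_cong_sets[OF sets_Q sets_lborel])
  qed (use J in \<open>auto intro: prob_space_Q lborel.sigma_finite_measure_axioms\<close>)
  moreover have "(\<lambda>j\<in>J. magnify c x (w j)) ` J = magnify c x ` w ` J" for w
    by (auto simp: image_image)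
  ultimately show ?thesis by simp
qed

end

section \<open>The law of large numbers for bounded functionals\<close>

text \<open>Translation invariance moves the point to the origin, where the stabilization bounds are defined.\<close>

lemma rescaled_eq_eval_at_0:
  fixes \<xi> :: "'a::euclidean_space \<Rightarrow> 'a set \<Rightarrow> real"
  assumes inv: "translation_invariant \<xi>" and S: "finite S"
  shows "rescaled \<xi> n x S = eval_at \<xi> 0 (magnify (real n powr (1 / real DIM('a))) x ` S)"
proof -
  let ?c = "real n powr (1 / real DIM('a))"
  let ?S = "insert (?c *\<^sub>R x) ((*\<^sub>R) ?c ` S)"
  have "\<xi> (- (?c *\<^sub>R x) + ?c *\<^sub>R x) ((+) (- (?c *\<^sub>R x)) ` ?S) = \<xi> (?c *\<^sub>R x) ?S"
    using inv S unfolding translation_invariant_def by (meson insertI1 finite.insertI finite_imageI locally_finite_finite)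
  moreover have "(+) (- (?c *\<^sub>R x)) ` ?S = insert 0 (magnify ?c x ` S)"
    by (auto simp: magnify_def image_image algebra_simps)
  ultimately show ?thesis by (simp add: rescaled_def eval_at_def Let_def)
qed

locale iid_sample = sample_density f + prob_space M
  for f :: "'a::euclidean_space \<Rightarrow> real" and M :: "'w measure" +
  fixes X :: "nat \<Rightarrow> 'w \<Rightarrow> 'a"
  assumes X_indep: "indep_vars (\<lambda>_. borel) X {1..}"
    and X_density: "\<And>i. 1 \<le> i \<Longrightarrow> distributed M lborel (X i) (\<lambda>x. ennreal (f x))"
begin

definition score :: "('a \<Rightarrow> 'a set \<Rightarrow> real) \<Rightarrow> nat \<Rightarrow> nat \<Rightarrow> 'w \<Rightarrow> real" where
  "score \<zeta> n i \<omega> = rescaled \<zeta> n (X i \<omega>) (sample_set X n \<omega>)"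

lemma X_measurable: "1 \<le> i \<Longrightarrow> X i \<in> borel_measurable M"
  using distributed_measurable[OF X_density, of i] by simp

lemma distr_X: "1 \<le> i \<Longrightarrow> distr M borel (X i) = Q"
  using distributed_distr_eq_density[OF X_density, of i]
  by (simp add: Q_def cong: distr_cong)

lemma sample_measurable: "(\<lambda>\<omega>. \<lambda>i\<in>{1..n}. X i \<omega>) \<in> measurable M (\<Pi>\<^sub>M i\<in>{1..n}. Q)"
  by (intro measurable_restrict) (auto intro: X_measurable simp: measurable_cong_sets[OF refl sets_Q])

lemma distr_sample:
  assumes n: "1 \<le> n"
  shows "distr M (\<Pi>\<^sub>M i\<in>{1..n}. Q) (\<lambda>\<omega>. \<lambda>i\<in>{1..n}. X i \<omega>) = (\<Pi>\<^sub>M i\<in>{1..n}. Q)"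
proof -
  have "indep_vars (\<lambda>_. borel) X {1..n}" by (rule indep_vars_subset[OF X_indep]) auto
  then have "distr M (\<Pi>\<^sub>M i\<in>{1..n}. borel) (\<lambda>\<omega>. \<lambda>i\<in>{1..n}. X i \<omega>) = (\<Pi>\<^sub>M i\<in>{1..n}. distr M borel (X i))"
    using n X_measurable by (subst (asm) indep_vars_iff_distr_eq_PiM') auto
  also have "\<dots> = (\<Pi>\<^sub>M i\<in>{1..n}. Q)" by (intro PiM_cong) (auto simp: distr_X)
  also have "distr M (\<Pi>\<^sub>M i\<in>{1..n}. borel) (\<lambda>\<omega>. \<lambda>i\<in>{1..n}. X i \<omega>) = distr M (\<Pi>\<^sub>M i\<in>{1..n}. Q) (\<lambda>\<omega>. \<lambda>i\<in>{1..n}. X i \<omega>)"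
    by (intro distr_cong sets_PiM_cong) auto
  finally show ?thesis .
qed

lemma nn_integral_sample:
  assumes n: "1 \<le> n" and \<Phi>: "\<Phi> \<in> borel_measurable (\<Pi>\<^sub>M i\<in>{1..n}. Q)"
  shows "(\<integral>\<^sup>+\<omega>. \<Phi> (\<lambda>i\<in>{1..n}. X i \<omega>) \<partial>M) = (\<integral>\<^sup>+z. \<Phi> z \<partial>(\<Pi>\<^sub>M i\<in>{1..n}. Q))"
  using nn_integral_distr[OF sample_measurable, of \<Phi> n] \<Phi> by (simp only: distr_sample[OF n] simp_thms)

lemma AE_sample:
  assumes "1 \<le> n" "AE z in (\<Pi>\<^sub>M i\<in>{1..n}. Q). P z"
  shows "AE \<omega> in M. P (\<lambda>i\<in>{1..n}. X i \<omega>)"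
  using AE_distrD[OF sample_measurable[of n], of P] assms(2) unfolding distr_sample[OF assms(1)] by blast

lemma AE_distinct: "AE \<omega> in M. inj_on (\<lambda>i. X i \<omega>) {1..n}"
proof (cases "1 \<le> n")
  case True
  have "AE \<omega> in M. inj_on (\<lambda>i\<in>{1..n}. X i \<omega>) {1..n}"
    by (rule AE_sample[OF True]) (rule AE_inj_on_sample, simp)
  then show ?thesis by (simp only: inj_on_restrict_eq)
qed simp

text \<open>The value at the \<open>i\<close>-th point as a function of the sample vector, with that point moved to the origin.\<close>

definition config_score :: "('a \<Rightarrow> 'a set \<Rightarrow> real) \<Rightarrow> nat \<Rightarrow> nat \<Rightarrow> (nat \<Rightarrow> 'a) \<Rightarrow> real" where
  "config_score \<zeta> n i z = eval_at \<zeta> 0 (magnify (scale n) (z i) ` z ` {1..n})"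

lemma score_eq_config_score:
  assumes "translation_invariant \<zeta>" "i \<in> {1..n}"
  shows "score \<zeta> n i \<omega> = config_score \<zeta> n i (\<lambda>i\<in>{1..n}. X i \<omega>)"
proof -
  have "(\<lambda>i\<in>{1..n}. X i \<omega>) ` {1..n} = sample_set X n \<omega>" unfolding sample_set_def by (rule image_cong) auto
  then show ?thesis
    using assms by (simp add: score_def config_score_def scale_def rescaled_eq_eval_at_0 sample_set_def)
qed

lemma magnify_sample_measurable:
  fixes i n :: nat
  assumes i: "i \<in> {1..n}" and J: "J \<subseteq> {1..n}"
  shows "(\<lambda>z. magnify c (z i) ` z ` J) \<in> measurable (\<Pi>\<^sub>M i\<in>{1..n}. Q) point_sets"
proof -
  have "(\<lambda>z. (\<lambda>j. magnify c (z i) (z j)) ` J) \<in> measurable (\<Pi>\<^sub>M i\<in>{1..n}. Q) point_sets"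
    unfolding magnify_def using i J finite_subset[OF J finite_atLeastAtMost]
    by (intro measurable_finite_image borel_measurable_scaleR borel_measurable_diff measurable_component_borel) auto
  then show ?thesis by (simp add: image_image)
qed

lemma config_score_measurable:
  assumes \<zeta>: "measurable_functional \<zeta>" and i: "i \<in> {1..n}"
  shows "config_score \<zeta> n i \<in> borel_measurable (\<Pi>\<^sub>M i\<in>{1..n}. Q)"
  unfolding config_score_def[abs_def]
  by (intro measurable_eval_at[OF \<zeta>] magnify_sample_measurable i) auto

lemma score_measurable:
  assumes \<zeta>: "measurable_functional \<zeta>" "translation_invariant \<zeta>" and i: "i \<in> {1..n}"
  shows "score \<zeta> n i \<in> borel_measurable M"
  using measurable_compose[OF sample_measurable config_score_measurable[OF \<zeta>(1) i]] score_eq_config_score[OF \<zeta>(2) i]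
  by (simp cong: measurable_cong)

text \<open>The sample is exchangeable: reordering the indices does not change its law.\<close>

lemma exchangeable:
  fixes \<Psi> :: "real \<Rightarrow> real \<Rightarrow> ennreal"
  assumes \<zeta>: "measurable_functional \<zeta>" "translation_invariant \<zeta>"
    and ij: "i \<in> {1..n}" "j \<in> {1..n}" "i \<noteq> j"
    and \<Psi>: "(\<lambda>(s, t). \<Psi> s t) \<in> borel_measurable (borel \<Otimes>\<^sub>M borel)"
  shows "(\<integral>\<^sup>+\<omega>. \<Psi> (score \<zeta> n i \<omega>) (score \<zeta> n j \<omega>) \<partial>M) = (\<integral>\<^sup>+\<omega>. \<Psi> (score \<zeta> n 1 \<omega>) (score \<zeta> n 2 \<omega>) \<partial>M)"
proof -
  let ?\<Pi> = "\<Pi>\<^sub>M i\<in>{1..n}. Q"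
  have n: "1 \<le> n" "1 \<in> {1..n}" "2 \<in> {1..n}" using ij by auto
  \<comment> \<open>a permutation that takes \<open>1\<close> to \<open>i\<close> and \<open>2\<close> to \<open>j\<close>: the first transposition sends \<open>2\<close> to \<open>a\<close>, the second one corrects this\<close>
  define a where "a = Transposition.transpose 1 i (2::nat)"
  define \<pi> where "\<pi> = Transposition.transpose a j \<circ> Transposition.transpose 1 i"
  have \<pi>: "\<pi> 1 = i" "\<pi> 2 = j"
    using ij(3) by (auto simp: \<pi>_def a_def Transposition.transpose_def)
  have "a \<in> {1..n}" using ij n by (auto simp: a_def Transposition.transpose_def)
  then have bij: "bij_betw \<pi> {1..n} {1..n}"
    unfolding \<pi>_def using ij n by (intro permutes_imp_bij permutes_compose permutes_swap_id) auto
  have D: "distr ?\<Pi> ?\<Pi> (\<lambda>z. \<lambda>k\<in>{1..n}. z (\<pi> k)) = ?\<Pi>"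
    using bij by (intro distr_PiM_reindex[where M="\<lambda>_. Q"]) (auto simp: prob_space_Q bij_betw_def)
  have mD: "(\<lambda>z. \<lambda>k\<in>{1..n}. z (\<pi> k)) \<in> measurable ?\<Pi> ?\<Pi>"
    using bij by (intro measurable_restrict measurable_component_singleton) (auto simp: bij_betw_def)
  have perm: "config_score \<zeta> n k (\<lambda>k\<in>{1..n}. z (\<pi> k)) = config_score \<zeta> n (\<pi> k) z" if "k \<in> {1..n}" for k z
  proof -
    have "(\<lambda>k\<in>{1..n}. z (\<pi> k)) ` {1..n} = (\<lambda>k. z (\<pi> k)) ` {1..n}" by (rule image_cong) auto
    also have "\<dots> = z ` {1..n}" using bij by (metis bij_betw_def image_image)
    finally show ?thesis using that by (simp add: config_score_def)
  qed
  have m: "(\<lambda>z. \<Psi> (config_score \<zeta> n i z) (config_score \<zeta> n j z)) \<in> borel_measurable ?\<Pi>" if "i \<in> {1..n}" "j \<in> {1..n}" for i j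
    using measurable_compose[OF measurable_Pair[OF config_score_measurable[OF \<zeta>(1) that(1)] config_score_measurable[OF \<zeta>(1) that(2)]] \<Psi>] by simp
  have "(\<integral>\<^sup>+\<omega>. \<Psi> (score \<zeta> n i \<omega>) (score \<zeta> n j \<omega>) \<partial>M) = (\<integral>\<^sup>+z. \<Psi> (config_score \<zeta> n i z) (config_score \<zeta> n j z) \<partial>?\<Pi>)"
    using nn_integral_sample[OF n(1) m[OF ij(1,2)]] score_eq_config_score[OF \<zeta>(2)] ij by simp
  also have "\<dots> = (\<integral>\<^sup>+z. \<Psi> (config_score \<zeta> n 1 (\<lambda>k\<in>{1..n}. z (\<pi> k))) (config_score \<zeta> n 2 (\<lambda>k\<in>{1..n}. z (\<pi> k))) \<partial>?\<Pi>)"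
    by (simp only: perm[OF n(2)] perm[OF n(3)] \<pi>)
  also have "\<dots> = (\<integral>\<^sup>+z. \<Psi> (config_score \<zeta> n 1 z) (config_score \<zeta> n 2 z) \<partial>?\<Pi>)"
    by (subst (2) D[symmetric], subst nn_integral_distr[OF mD]) (use m n in simp_all)
  also have "\<dots> = (\<integral>\<^sup>+\<omega>. \<Psi> (score \<zeta> n 1 \<omega>) (score \<zeta> n 2 \<omega>) \<partial>M)"
    using nn_integral_sample[OF n(1) m[OF n(2,3)]] score_eq_config_score[OF \<zeta>(2)] n by simp
  finally show ?thesis .
qed

lemma exchangeable_one:
  assumes \<zeta>: "measurable_functional \<zeta>" "translation_invariant \<zeta>"
    and i: "i \<in> {1..n}" and \<psi>: "\<psi> \<in> borel_measurable borel"
  shows "(\<integral>\<^sup>+\<omega>. \<psi> (score \<zeta> n i \<omega>) \<partial>M) = (\<integral>\<^sup>+\<omega>. \<psi> (score \<zeta> n 1 \<omega>) \<partial>M)"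
proof (cases "n = 1")
  case False
  then obtain j where j: "j \<in> {1..n}" "i \<noteq> j" using i
    by (metis atLeastAtMost_iff le_antisym le_refl order_trans)
  have "(\<lambda>(s, t). \<psi> s) \<in> borel_measurable (borel \<Otimes>\<^sub>M (borel :: real measure))"
    using measurable_compose[OF measurable_fst \<psi>] by (simp add: case_prod_beta')
  from exchangeable[OF \<zeta> i j this] show ?thesis .
qed (use i in auto)

text \<open>Fubini with the \<open>i\<close>-th point fixed: the other points, seen from it, have a density.\<close>

lemma AE_config_score_le_upper_stab:
  assumes \<zeta>: "measurable_functional \<zeta>" and i: "i \<in> {1..n}"
  shows "AE z in (\<Pi>\<^sub>M i\<in>{1..n}. Q). (\<exists>j\<in>{1..n} - {i}. magnify (scale n) (z i) (z j) \<notin> cball 0 (real m)) \<longrightarrow>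
    ennreal (config_score \<zeta> n i z) \<le> upper_stab \<zeta> (magnify (scale n) (z i) ` z ` ({1..n} - {i})) m"
proof -
  let ?J = "{1..n} - {i}" and ?T = "magnify (scale n)"
  let ?P = "\<lambda>z. (\<exists>j\<in>?J. ?T (z i) (z j) \<notin> cball 0 (real m)) \<longrightarrow>
    ennreal (config_score \<zeta> n i z) \<le> upper_stab \<zeta> (?T (z i) ` z ` ?J) m"
  have n: "1 \<le> n" using i by auto
  have eq: "{1..n} = {i} \<union> ?J" using i by auto
  interpret PQ: product_sigma_finite "\<lambda>_::nat. Q" ..
  have im: "{1..n} - {i} = ?J" "insert i ?J = {1..n}" using i by auto
  have config_score: "config_score \<zeta> n i z = eval_at \<zeta> 0 (?T (z i) ` z ` ?J)" for z
  proof -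
    have "z ` {1..n} = insert (z i) (z ` ?J)" using im(2) by (metis image_insert)
    then show ?thesis by (simp add: config_score_def eval_at_def magnify_def)
  qed
  have "AE z in Pi\<^sub>M ({i} \<union> ?J) (\<lambda>_. Q). ?P z"
  proof (rule AE_PiM_unionI[OF PQ.product_sigma_finite_axioms])
    let ?\<Pi> = "\<Pi>\<^sub>M i\<in>{1..n}. Q"
    have "{z \<in> space ?\<Pi>. ?P z} \<in> sets ?\<Pi>"
    proof -
      have "{z \<in> space ?\<Pi>. \<exists>j\<in>?J. ?T (z i) (z j) \<notin> cball 0 (real m)} \<in> sets ?\<Pi>"
      proof (intro sets.sets_Collect_finite_Ex)
        fix j assume j: "j \<in> ?J"
        have "(\<lambda>z. ?T (z i) (z j)) \<in> borel_measurable ?\<Pi>"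
          unfolding magnify_def using i j
          by (intro borel_measurable_scaleR borel_measurable_diff measurable_component_borel) auto
        from measurable_sets[OF this, of "- cball 0 (real m)"]
        show "{z \<in> space ?\<Pi>. ?T (z i) (z j) \<notin> cball 0 (real m)} \<in> sets ?\<Pi>"
          by (simp add: vimage_def Int_def conj_commute)
      qed simp
      moreover have "{z \<in> space ?\<Pi>. ennreal (config_score \<zeta> n i z) \<le> upper_stab \<zeta> (?T (z i) ` z ` ?J) m} \<in> sets ?\<Pi>"
        using config_score_measurable[OF \<zeta> i] measurable_compose[OF magnify_sample_measurable[OF i, of ?J "scale n"] measurable_upper_stab[OF \<zeta>, of m]]
        by measurable
      ultimately show ?thesis by (intro sets.sets_Collect_imp)
    qed
    then show "{z \<in> space (Pi\<^sub>M ({i} \<union> ?J) (\<lambda>_. Q)). ?P z} \<in> sets (Pi\<^sub>M ({i} \<union> ?J) (\<lambda>_. Q))"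
      unfolding eq[symmetric] .
    show "AE s in Pi\<^sub>M {i} (\<lambda>_. Q). AE w in Pi\<^sub>M ?J (\<lambda>_. Q). ?P (merge {i} ?J (s, w))"
    proof (rule AE_I2)
      fix s :: "nat \<Rightarrow> 'a"
      have "merge {i} ?J (s, w) i = s i" for w by (simp add: merge_def)
      moreover have "merge {i} ?J (s, w) ` ?J = w ` ?J" for w by (rule image_cong) (auto simp: merge_def)
      moreover have "(\<exists>j\<in>?J. ?T (s i) (merge {i} ?J (s, w) j) \<notin> cball 0 (real m)) \<longleftrightarrow> (\<exists>j\<in>?J. ?T (s i) (w j) \<notin> cball 0 (real m))" for w
        by (rule bex_cong) (auto simp: merge_def)
      ultimately show "AE w in Pi\<^sub>M ?J (\<lambda>_. Q). ?P (merge {i} ?J (s, w))"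
        using sample_eval_le_upper_stab[OF \<zeta> _ scale_pos[OF n], of ?J "s i" m] unfolding config_score by simp
    qed
  qed auto
  then show ?thesis unfolding eq[symmetric] .
qed

text \<open>Clipping at \<open>1\<close> changes nothing for functionals with values in \<open>[0, 1]\<close>, and it keeps \<^const>\<open>enn2real\<close> from
  mapping the value \<open>\<infinity>\<close> to \<open>0\<close> otherwise.\<close>

definition clipped_upper_stab :: "('a \<Rightarrow> 'a set \<Rightarrow> real) \<Rightarrow> nat \<Rightarrow> 'a set \<Rightarrow> real" where
  "clipped_upper_stab \<zeta> m S = enn2real (min 1 (upper_stab \<zeta> S m))"

lemma local_functional_clipped:
  assumes \<zeta>: "measurable_functional \<zeta>"
  shows "local_functional (real m) (clipped_upper_stab \<zeta> m)"
  unfolding local_functional_def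
proof (intro conjI allI impI)
  show "clipped_upper_stab \<zeta> m \<in> borel_measurable point_sets"
    unfolding clipped_upper_stab_def[abs_def] using measurable_upper_stab[OF \<zeta>, of m] by measurable
  fix S :: "'a set"
  show "0 \<le> clipped_upper_stab \<zeta> m S" by (simp add: clipped_upper_stab_def)
  have "enn2real (min 1 (upper_stab \<zeta> S m)) \<le> enn2real 1" by (rule enn2real_mono) auto
  then show "clipped_upper_stab \<zeta> m S \<le> 1" by (simp add: clipped_upper_stab_def)
  show "clipped_upper_stab \<zeta> m (S \<inter> cball 0 (real m)) = clipped_upper_stab \<zeta> m S"
    by (simp add: clipped_upper_stab_def upper_stab_local)
qed

text \<open>Each of two points that are far apart is an outer point of the configuration seen from the other,
  so that both values lie below the upper stabilization bound, which ignores the other point.\<close>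

lemma AE_config_score_le_clipped:
  fixes i j n m :: nat
  assumes \<zeta>: "measurable_functional \<zeta>" "translation_invariant \<zeta>"
    and le1: "\<And>S. locally_finite S \<Longrightarrow> 0 \<in> S \<Longrightarrow> \<zeta> 0 S \<le> 1"
    and n: "2 \<le> n" and ij: "(i, j) = (1, 2) \<or> (i, j) = (2, 1)"
  shows "AE z in (\<Pi>\<^sub>M i\<in>{1..n}. Q). 2 * real m < scale n * dist (z 1) (z 2) \<longrightarrow>
    config_score \<zeta> n i z \<le> clipped_upper_stab \<zeta> m (magnify (scale n) (z i) ` z ` {3..n})"
proof -
  have i: "i \<in> {1..n}" and j: "j \<in> {1..n} - {i}" and J: "{1..n} - {i} = insert j {3..n}" using ij n by auto
  have c: "0 < scale n" using n by (intro scale_pos) auto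
  show ?thesis using AE_config_score_le_upper_stab[OF \<zeta>(1) i, of m]
  proof eventually_elim
    case (elim z)
    show ?case
    proof
      assume far: "2 * real m < scale n * dist (z 1) (z 2)"
      have "norm (magnify (scale n) (z i) (z j)) = scale n * dist (z 1) (z 2)"
        using ij c by (auto simp: magnify_def dist_norm norm_minus_commute)
      then have out: "magnify (scale n) (z i) (z j) \<notin> cball 0 (real m)" using far by simp
      then have "ennreal (config_score \<zeta> n i z) \<le> upper_stab \<zeta> (magnify (scale n) (z i) ` z ` ({1..n} - {i})) m"
        using elim j by blast
      also have "\<dots> = upper_stab \<zeta> (magnify (scale n) (z i) ` z ` {3..n}) m"
      proof -
        have "magnify (scale n) (z i) ` z ` ({1..n} - {i}) \<inter> cball 0 (real m) =
            magnify (scale n) (z i) ` z ` {3..n} \<inter> cball 0 (real m)"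
          using out unfolding J by auto
        then show ?thesis by (metis upper_stab_local)
      qed
      finally have "ennreal (config_score \<zeta> n i z) \<le> min 1 (upper_stab \<zeta> (magnify (scale n) (z i) ` z ` {3..n}) m)"
        using le1[of "insert 0 (magnify (scale n) (z i) ` z ` {1..n})"]
        by (auto simp: config_score_def eval_at_def locally_finite_finite)
      also have "\<dots> = ennreal (clipped_upper_stab \<zeta> m (magnify (scale n) (z i) ` z ` {3..n}))"
        unfolding clipped_upper_stab_def by (subst ennreal_enn2real) (auto simp: min_less_iff_disj)
      finally show "config_score \<zeta> n i z \<le> clipped_upper_stab \<zeta> m (magnify (scale n) (z i) ` z ` {3..n})"
        by (subst (asm) ennreal_le_iff) (auto simp: clipped_upper_stab_def)
    qed
  qed
qed

text \<open>The second summand is the probability that the first two points are too close to be treated as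
  separated.\<close>

definition pair_error :: "nat \<Rightarrow> nat \<Rightarrow> real" where
  "pair_error m n = 2 * (\<integral>x. min 1 (local_error m n x) \<partial>Q) +
     prob {\<omega> \<in> space M. scale n * dist (X 1 \<omega>) (X 2 \<omega>) \<le> 2 * real m}"

lemma pair_error_tendsto_0: "(\<lambda>n. pair_error m n) \<longlonglongrightarrow> 0"
proof -
  let ?E = "\<lambda>n. {\<omega> \<in> space M. scale n * dist (X 1 \<omega>) (X 2 \<omega>) \<le> 2 * real m}"
  have [measurable]: "X 1 \<in> borel_measurable M" "X 2 \<in> borel_measurable M" by (auto intro: X_measurable)
  have E[measurable]: "?E n \<in> sets M" for n by measurable
  have "(\<lambda>n. \<integral>\<omega>. indicat_real (?E n) \<omega> \<partial>M) \<longlonglongrightarrow> (\<integral>\<omega>. 0 \<partial>M)"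
  proof (rule integral_dominated_convergence[where w="\<lambda>_. 1"])
    show "AE \<omega> in M. (\<lambda>n. indicator (?E n) \<omega> :: real) \<longlonglongrightarrow> 0"
      using AE_distinct[of 2]
    proof eventually_elim
      case (elim \<omega>)
      then have "X 1 \<omega> \<noteq> X 2 \<omega>" using inj_onD[of "\<lambda>i. X i \<omega>" "{1..2}" 1 2] by auto
      then have d: "0 < dist (X 1 \<omega>) (X 2 \<omega>)" by simp
      have "\<forall>\<^sub>F n in sequentially. 2 * real m / dist (X 1 \<omega>) (X 2 \<omega>) < scale n"
        using scale_at_top by (simp add: filterlim_at_top_dense)
      then have "\<forall>\<^sub>F n in sequentially. indicator (?E n) \<omega> = (0::real)"
        by eventually_elim (use d in \<open>auto simp: divide_simps indicator_def\<close>)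
      then show ?case by (rule tendsto_eventually)
    qed
    show "indicat_real (?E n) \<in> borel_measurable M" for n by (rule borel_measurable_indicator[OF E])
  qed (auto simp: indicator_def)
  moreover have "?E n \<inter> space M = ?E n" for n by auto
  ultimately have "(\<lambda>n. prob (?E n)) \<longlonglongrightarrow> 0" by simp
  then have "(\<lambda>n. 2 * (\<integral>x. min 1 (local_error m n x) \<partial>Q) + prob (?E n)) \<longlonglongrightarrow> 2 * 0 + 0"
    by (intro tendsto_intros mean_local_error_tendsto_0)
  then show ?thesis by (simp add: pair_error_def)
qed

context
  fixes L :: "real \<Rightarrow> 'a set measure" and \<zeta> :: "'a \<Rightarrow> 'a set \<Rightarrow> real"
  assumes L: "\<And>\<tau>. 0 < \<tau> \<Longrightarrow> poisson_law (\<lambda>B. \<tau> * measure lborel B) (L \<tau>)"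
    and \<zeta>m: "measurable_functional \<zeta>" and \<zeta>t: "translation_invariant \<zeta>"
    and \<zeta>01: "\<And>S x. locally_finite S \<Longrightarrow> x \<in> S \<Longrightarrow> 0 \<le> \<zeta> x S \<and> \<zeta> x S \<le> 1"
begin

lemma limit_average_1: "limit_average L (\<lambda>_. 1) = 1"
proof -
  have "limit_average L (\<lambda>_. 1) = (\<integral>x. 1 \<partial>Q)"
    unfolding limit_average_def
  proof (rule integral_cong_AE)
    show "AE x in Q. indicator {0<..} (f x) * (\<integral>S. 1 \<partial>L (f x)) = (1::real)"
      using AE_Q_pos
    proof eventually_elim
      case (elim x)
      interpret Lx: prob_space "L (f x)" using L[OF elim] by (rule poisson_law_prob)
      show ?case using elim Lx.prob_space by simp
    qed
    show "(\<lambda>x. indicator {0<..} (f x) * (\<integral>S. (1::real) \<partial>L (f x))) \<in> borel_measurable Q"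
      by (subst measurable_cong_sets[OF sets_Q refl]) (rule poisson_mean_measurable[OF L local_functional_1[of 0]])
  qed simp
  then show ?thesis using Q.prob_space by simp
qed

lemma config_score_01: "0 \<le> config_score \<zeta> n i z \<and> config_score \<zeta> n i z \<le> 1"
  unfolding config_score_def eval_at_def by (rule \<zeta>01) (auto intro!: locally_finite_finite)

lemma score_01: "i \<in> {1..n} \<Longrightarrow> 0 \<le> score \<zeta> n i \<omega> \<and> score \<zeta> n i \<omega> \<le> 1"
  using score_eq_config_score[OF \<zeta>t] config_score_01 by simp

lemma score_integrable:
  assumes "i \<in> {1..n}" "j \<in> {1..n}"
  shows "integrable M (score \<zeta> n i)" "integrable M (\<lambda>\<omega>. score \<zeta> n i \<omega> * score \<zeta> n j \<omega>)"
  using assms score_01[of i n] score_01[of j n] score_measurable[OF \<zeta>m \<zeta>t]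
  by (auto intro!: expectation_01(1) mult_le_one)

text \<open>For both bounds of the next lemma: \<open>h\<close> is the clipped bound at the second point for a product of two
  values, and \<open>1\<close> for a single value.\<close>

lemma pair_mean_le_aux:
  assumes n: "2 \<le> n" and h: "local_functional (real m) h"
    and \<Phi>: "\<Phi> \<in> borel_measurable (\<Pi>\<^sub>M i\<in>{1..n}. Q)" "\<And>z. 0 \<le> \<Phi> z \<and> \<Phi> z \<le> 1"
    and le: "AE z in (\<Pi>\<^sub>M i\<in>{1..n}. Q). 2 * real m < scale n * dist (z 1) (z 2) \<longrightarrow>
      \<Phi> z \<le> clipped_upper_stab \<zeta> m (magnify (scale n) (z 1) ` z ` {3..n}) * h (magnify (scale n) (z 2) ` z ` {3..n})"
  shows "expectation (\<lambda>\<omega>. \<Phi> (\<lambda>i\<in>{1..n}. X i \<omega>)) \<le>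
    limit_average L (clipped_upper_stab \<zeta> m) * limit_average L h + pair_error m n"
proof -
  let ?\<Pi> = "\<Pi>\<^sub>M i\<in>{1..n}. Q"
  let ?D = "{z :: nat \<Rightarrow> 'a. 2 * real m < scale n * dist (z 1) (z 2)}"
  let ?C = "{z \<in> space ?\<Pi>. scale n * dist (z 1) (z 2) \<le> 2 * real m}"
  let ?u = "clipped_upper_stab \<zeta> m"
  let ?F = "\<lambda>z. indicator ?D z * (?u (magnify (scale n) (z 1) ` z ` {3..n}) * h (magnify (scale n) (z 2) ` z ` {3..n}))"
  note u = local_functional_clipped[OF \<zeta>m, of m]
  have n1: "1 \<le> n" "1 \<in> {1..n}" "2 \<in> {1..n}" using n by auto
  have [measurable]: "(\<lambda>z. z 1) \<in> measurable ?\<Pi> borel" "(\<lambda>z. z 2) \<in> measurable ?\<Pi> borel"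
    using n1 by (auto intro!: measurable_component_borel)
  have C: "?C \<in> sets ?\<Pi>" by measurable
  have uF: "(\<lambda>z. ?u (magnify (scale n) (z 1) ` z ` {3..n}) * h (magnify (scale n) (z 2) ` z ` {3..n})) \<in> borel_measurable ?\<Pi>"
    using n1 by (intro borel_measurable_times measurable_compose[OF magnify_sample_measurable local_functionalD(1)[OF u]]
        measurable_compose[OF magnify_sample_measurable local_functionalD(1)[OF h]]) auto
  have Dm: "?D \<inter> space ?\<Pi> \<in> sets ?\<Pi>"
  proof -
    have "{z \<in> space ?\<Pi>. 2 * real m < scale n * dist (z 1) (z 2)} \<in> sets ?\<Pi>" by measurable
    then show ?thesis by (simp add: Int_def conj_commute)
  qed
  have Fm: "?F \<in> borel_measurable ?\<Pi>"
    using Dm by (intro borel_measurable_times[OF _ uF]) (simp only: borel_measurable_indicator_iff)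
  have "ennreal (expectation (\<lambda>\<omega>. \<Phi> (\<lambda>i\<in>{1..n}. X i \<omega>))) = (\<integral>\<^sup>+\<omega>. ennreal (\<Phi> (\<lambda>i\<in>{1..n}. X i \<omega>)) \<partial>M)"
    using \<Phi> measurable_compose[OF sample_measurable \<Phi>(1)]
    by (intro nn_integral_eq_integral[symmetric] expectation_01(1)) auto
  also have "\<dots> = (\<integral>\<^sup>+z. ennreal (\<Phi> z) \<partial>?\<Pi>)"
    using \<Phi> by (intro nn_integral_sample[OF n1(1)]) auto
  also have "\<dots> \<le> (\<integral>\<^sup>+z. ennreal (?F z) + indicator ?C z \<partial>?\<Pi>)"
  proof (rule nn_integral_mono_AE)
    show "AE z in ?\<Pi>. ennreal (\<Phi> z) \<le> ennreal (?F z) + indicator ?C z"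
      using le AE_space
    proof eventually_elim
      case (elim z)
      show ?case
      proof (cases "z \<in> ?D")
        case True
        then show ?thesis using elim by (auto intro!: ennreal_leI add_increasing2)
      next
        case False
        then have "z \<in> ?C" using elim by auto
        then show ?thesis using \<Phi>(2)[of z] by (auto intro: add_increasing)
      qed
    qed
  qed
  also have "\<dots> = (\<integral>\<^sup>+z. ennreal (?F z) \<partial>?\<Pi>) + emeasure ?\<Pi> ?C"
    using C Fm by (subst nn_integral_add) auto
  also have "(\<integral>\<^sup>+z. ennreal (?F z) \<partial>?\<Pi>) \<le> ennreal (limit_average L ?u * limit_average L h + 2 * (\<integral>x. min 1 (local_error m n x) \<partial>Q))"
    by (rule two_point_mean_le[OF L n u h])
  also have "emeasure ?\<Pi> ?C = ennreal (prob {\<omega> \<in> space M. scale n * dist (X 1 \<omega>) (X 2 \<omega>) \<le> 2 * real m})"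
  proof -
    have "(\<lambda>\<omega>. \<lambda>i\<in>{1..n}. X i \<omega>) -` ?C \<inter> space M = {\<omega> \<in> space M. scale n * dist (X 1 \<omega>) (X 2 \<omega>) \<le> 2 * real m}"
      using measurable_space[OF sample_measurable[of n]] n1 by auto
    then have "emeasure (distr M ?\<Pi> (\<lambda>\<omega>. \<lambda>i\<in>{1..n}. X i \<omega>)) ?C = emeasure M {\<omega> \<in> space M. scale n * dist (X 1 \<omega>) (X 2 \<omega>) \<le> 2 * real m}"
      by (subst emeasure_distr[OF sample_measurable C]) simp
    then show ?thesis using distr_sample[OF n1(1)] by (simp add: emeasure_eq_measure)
  qed
  finally have fin: "ennreal (expectation (\<lambda>\<omega>. \<Phi> (\<lambda>i\<in>{1..n}. X i \<omega>))) \<le>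
      ennreal (limit_average L ?u * limit_average L h + 2 * (\<integral>x. min 1 (local_error m n x) \<partial>Q)) +
      ennreal (prob {\<omega> \<in> space M. scale n * dist (X 1 \<omega>) (X 2 \<omega>) \<le> 2 * real m})"
    by (simp only: add_right_mono)
  have la: "0 \<le> limit_average L g" if "local_functional (real m) g" for g
    unfolding limit_average_def using poisson_mean_01[OF L that] by (intro integral_nonneg_AE AE_I2) auto
  have e0: "0 \<le> (\<integral>x. min 1 (local_error m n x) \<partial>Q)"
    using local_error_nonneg by (intro integral_nonneg_AE AE_I2) auto
  have "ennreal (expectation (\<lambda>\<omega>. \<Phi> (\<lambda>i\<in>{1..n}. X i \<omega>))) \<le>
    ennreal (limit_average L ?u * limit_average L h + pair_error m n)"
    using fin la[OF u] la[OF h] e0 by (subst (asm) ennreal_plus[symmetric]) (auto simp: pair_error_def add.assoc)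
  moreover have "0 \<le> limit_average L ?u * limit_average L h + pair_error m n"
    using la[OF u] la[OF h] e0 by (simp add: pair_error_def)
  ultimately show ?thesis by (simp add: ennreal_le_iff)
qed

lemma pair_mean_le:
  assumes n: "2 \<le> n"
  shows "expectation (\<lambda>\<omega>. score \<zeta> n 1 \<omega> * score \<zeta> n 2 \<omega>) \<le> (limit_average L (clipped_upper_stab \<zeta> m))\<^sup>2 + pair_error m n"
    and "expectation (score \<zeta> n 1) \<le> limit_average L (clipped_upper_stab \<zeta> m) + pair_error m n"
proof -
  have n1: "1 \<in> {1..n}" "2 \<in> {1..n}" using n by auto
  have le1: "\<And>S. locally_finite S \<Longrightarrow> 0 \<in> S \<Longrightarrow> \<zeta> 0 S \<le> 1" using \<zeta>01 by blast
  note u = local_functional_clipped[OF \<zeta>m, of m]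
  note A1 = AE_config_score_le_clipped[OF \<zeta>m \<zeta>t le1 n, where i=1 and j=2 and m=m, simplified]
  note A2 = AE_config_score_le_clipped[OF \<zeta>m \<zeta>t le1 n, where i=2 and j=1 and m=m, simplified]
  have u0: "0 \<le> clipped_upper_stab \<zeta> m S" for S by (simp add: clipped_upper_stab_def)
  have "expectation (\<lambda>\<omega>. (\<lambda>z. config_score \<zeta> n 1 z * config_score \<zeta> n 2 z) (\<lambda>i\<in>{1..n}. X i \<omega>)) \<le>
      limit_average L (clipped_upper_stab \<zeta> m) * limit_average L (clipped_upper_stab \<zeta> m) + pair_error m n"
  proof (rule pair_mean_le_aux[OF n u])
    show "(\<lambda>z. config_score \<zeta> n 1 z * config_score \<zeta> n 2 z) \<in> borel_measurable (\<Pi>\<^sub>M i\<in>{1..n}. Q)"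
      using n1 by (intro borel_measurable_times config_score_measurable[OF \<zeta>m])
    show "0 \<le> config_score \<zeta> n 1 z * config_score \<zeta> n 2 z \<and> config_score \<zeta> n 1 z * config_score \<zeta> n 2 z \<le> 1" for z
      using config_score_01 by (auto intro: mult_le_one)
    show "AE z in (\<Pi>\<^sub>M i\<in>{1..n}. Q). 2 * real m < scale n * dist (z 1) (z 2) \<longrightarrow>
      config_score \<zeta> n 1 z * config_score \<zeta> n 2 z \<le> clipped_upper_stab \<zeta> m (magnify (scale n) (z 1) ` z ` {3..n}) * clipped_upper_stab \<zeta> m (magnify (scale n) (z 2) ` z ` {3..n})"
      using A1 A2 by eventually_elim (use config_score_01 u0 in \<open>auto intro!: mult_mono\<close>)
  qed
  then show "expectation (\<lambda>\<omega>. score \<zeta> n 1 \<omega> * score \<zeta> n 2 \<omega>) \<le> (limit_average L (clipped_upper_stab \<zeta> m))\<^sup>2 + pair_error m n"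
    using score_eq_config_score[OF \<zeta>t n1(1)] score_eq_config_score[OF \<zeta>t n1(2)] by (simp add: power2_eq_square)
  have "expectation (\<lambda>\<omega>. (\<lambda>z. config_score \<zeta> n 1 z) (\<lambda>i\<in>{1..n}. X i \<omega>)) \<le>
      limit_average L (clipped_upper_stab \<zeta> m) * limit_average L (\<lambda>_. 1) + pair_error m n"
  proof (rule pair_mean_le_aux[OF n local_functional_1])
    show "config_score \<zeta> n 1 \<in> borel_measurable (\<Pi>\<^sub>M i\<in>{1..n}. Q)" using n1 by (intro config_score_measurable[OF \<zeta>m])
  qed (use config_score_01 A1 in auto)
  note le = this
  show "expectation (score \<zeta> n 1) \<le> limit_average L (clipped_upper_stab \<zeta> m) + pair_error m n"
  proof -
    have "score \<zeta> n 1 = (\<lambda>\<omega>. config_score \<zeta> n 1 (\<lambda>i\<in>{1..n}. X i \<omega>))" using score_eq_config_score[OF \<zeta>t n1(1)] by (rule ext)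
    then show ?thesis using le by (simp only: limit_average_1 mult_1_right)
  qed
qed

end

text \<open>The second moment of the average is governed by pairs of distinct points, so upper bounds on
  \<open>\<zeta>\<close> for pairs and on \<open>1 - \<zeta>\<close> for single points together leave no room for a positive variance.\<close>

lemma bounded_lln:
  assumes L: "\<And>\<tau>. 0 < \<tau> \<Longrightarrow> poisson_law (\<lambda>B. \<tau> * measure lborel B) (L \<tau>)"
    and \<zeta>m: "measurable_functional \<zeta>" and \<zeta>t: "translation_invariant \<zeta>"
    and \<zeta>01: "\<And>S x. locally_finite S \<Longrightarrow> x \<in> S \<Longrightarrow> 0 \<le> \<zeta> x S \<and> \<zeta> x S \<le> 1"
    and up: "(\<lambda>m. limit_average L (clipped_upper_stab \<zeta> m)) \<longlonglongrightarrow> \<mu>"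
    and low: "(\<lambda>m. limit_average L (clipped_upper_stab (\<lambda>x S. 1 - \<zeta> x S) m)) \<longlonglongrightarrow> 1 - \<mu>"
  shows "(\<lambda>n. expectation (score \<zeta> n 1)) \<longlonglongrightarrow> \<mu>"
    and "(\<lambda>n. expectation (\<lambda>\<omega>. ((\<Sum>i=1..n. score \<zeta> n i \<omega>) / real n - \<mu>)\<^sup>2)) \<longlonglongrightarrow> 0"
proof -
  let ?\<zeta>' = "\<lambda>x S. 1 - \<zeta> x S"
  have \<zeta>'m: "measurable_functional ?\<zeta>'"
    using \<zeta>m unfolding measurable_functional_def by (simp add: case_prod_beta')
  have \<zeta>'t: "translation_invariant ?\<zeta>'" using \<zeta>t by (simp add: translation_invariant_def)
  have \<zeta>'01: "\<And>S x. locally_finite S \<Longrightarrow> x \<in> S \<Longrightarrow> 0 \<le> ?\<zeta>' x S \<and> ?\<zeta>' x S \<le> 1" using \<zeta>01 by auto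
  have score': "score ?\<zeta>' n i \<omega> = 1 - score \<zeta> n i \<omega>" for n i \<omega> by (simp add: score_def rescaled_def eval_at_def Let_def)
  have V01: "0 \<le> score \<zeta> n i \<omega> \<and> score \<zeta> n i \<omega> \<le> 1" if "i \<in> {1..n}" for n i \<omega>
    using score_01[OF L \<zeta>m \<zeta>t \<zeta>01 that] by blast
  have Vint: "integrable M (score \<zeta> n i)" "integrable M (\<lambda>\<omega>. score \<zeta> n i \<omega> * score \<zeta> n j \<omega>)"
    if "i \<in> {1..n}" "j \<in> {1..n}" for n i j
    using score_integrable[OF L \<zeta>m \<zeta>t \<zeta>01 that] by blast+
  define e where "e n = expectation (score \<zeta> n 1)" for n
  define s where "s n = expectation (\<lambda>\<omega>. score \<zeta> n 1 \<omega> * score \<zeta> n 2 \<omega>)" for n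
  have e_le: "e n \<le> limit_average L (clipped_upper_stab \<zeta> m) + pair_error m n" if "2 \<le> n" for m n
    unfolding e_def by (rule pair_mean_le(2)[OF L \<zeta>m \<zeta>t \<zeta>01 that])
  have e_ge: "1 - e n \<le> limit_average L (clipped_upper_stab ?\<zeta>' m) + pair_error m n" if "2 \<le> n" for m n
  proof -
    have "score ?\<zeta>' n 1 = (\<lambda>\<omega>. 1 - score \<zeta> n 1 \<omega>)" by (rule ext) (rule score')
    then have "expectation (score ?\<zeta>' n 1) = 1 - e n"
      using Vint(1)[of 1 n 1] that prob_space by (simp add: e_def)
    then show ?thesis using pair_mean_le(2)[OF L \<zeta>'m \<zeta>'t \<zeta>'01 that, of m] by simp
  qed
  have s_le: "s n \<le> (limit_average L (clipped_upper_stab \<zeta> m))\<^sup>2 + pair_error m n" if "2 \<le> n" for m n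
    unfolding s_def by (rule pair_mean_le(1)[OF L \<zeta>m \<zeta>t \<zeta>01 that])
  have ev: "\<forall>\<^sub>F n in sequentially. a n < b + r"
    if le: "\<And>m n. 2 \<le> n \<Longrightarrow> a n \<le> c m + pair_error m n" and c: "c \<longlonglongrightarrow> b" and r: "0 < r"
    for a c :: "nat \<Rightarrow> real" and b r
  proof -
    have "\<forall>\<^sub>F m in sequentially. c m < b + r / 2" using r by (intro order_tendstoD(2)[OF c]) auto
    then obtain m where m: "c m < b + r / 2" by (auto dest: eventually_happens)
    have "\<forall>\<^sub>F n in sequentially. pair_error m n < r / 2"
      using r by (intro order_tendstoD(2)[OF pair_error_tendsto_0]) auto
    then show ?thesis using eventually_ge_at_top[of 2]
    proof eventually_elim
      case (elim n)
      then show ?case using le[of n m] m by simp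
    qed
  qed
  have "e \<longlonglongrightarrow> \<mu>"
  proof (rule order_tendstoI)
    fix a assume "a < \<mu>"
    then show "\<forall>\<^sub>F n in sequentially. a < e n"
      using ev[of "\<lambda>n. 1 - e n", OF e_ge low, of "\<mu> - a"] by (auto elim!: eventually_mono)
  next
    fix a assume "\<mu> < a"
    then show "\<forall>\<^sub>F n in sequentially. e n < a"
      using ev[OF e_le up, of "a - \<mu>"] by (auto elim!: eventually_mono)
  qed
  then show e: "(\<lambda>n. expectation (score \<zeta> n 1)) \<longlonglongrightarrow> \<mu>" unfolding e_def[abs_def] .
  have EV: "expectation (score \<zeta> n i) = e n" if i: "i \<in> {1..n}" for n i
  proof -
    have "ennreal (expectation (score \<zeta> n i)) = (\<integral>\<^sup>+\<omega>. ennreal (score \<zeta> n i \<omega>) \<partial>M)" if "i \<in> {1..n}" for i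
      using V01[OF that] by (intro nn_integral_eq_integral[symmetric] Vint(1)[OF that that]) auto
    moreover have "(\<integral>\<^sup>+\<omega>. ennreal (score \<zeta> n i \<omega>) \<partial>M) = (\<integral>\<^sup>+\<omega>. ennreal (score \<zeta> n 1 \<omega>) \<partial>M)"
      by (rule exchangeable_one[OF \<zeta>m \<zeta>t i]) simp
    ultimately have "ennreal (expectation (score \<zeta> n i)) = ennreal (e n)" using i by (simp add: e_def)
    moreover have "0 \<le> expectation (score \<zeta> n i)" "0 \<le> e n"
      using V01[of _ n] i by (auto simp: e_def intro!: integral_nonneg_AE)
    ultimately show ?thesis by simp
  qed
  have EVV: "expectation (\<lambda>\<omega>. score \<zeta> n i \<omega> * score \<zeta> n j \<omega>) = s n" if ij: "i \<in> {1..n}" "j \<in> {1..n}" "i \<noteq> j" for n i j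
  proof -
    have n: "1 \<in> {1..n}" "2 \<in> {1..n}" using ij by auto
    have "ennreal (expectation (\<lambda>\<omega>. score \<zeta> n i \<omega> * score \<zeta> n j \<omega>)) = (\<integral>\<^sup>+\<omega>. ennreal (score \<zeta> n i \<omega> * score \<zeta> n j \<omega>) \<partial>M)"
      if "i \<in> {1..n}" "j \<in> {1..n}" for i j
      using V01[OF that(1)] V01[OF that(2)] by (intro nn_integral_eq_integral[symmetric] Vint(2)[OF that]) auto
    moreover have "(\<integral>\<^sup>+\<omega>. ennreal (score \<zeta> n i \<omega> * score \<zeta> n j \<omega>) \<partial>M) = (\<integral>\<^sup>+\<omega>. ennreal (score \<zeta> n 1 \<omega> * score \<zeta> n 2 \<omega>) \<partial>M)"
      by (rule exchangeable[OF \<zeta>m \<zeta>t ij]) measurable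
    ultimately have "ennreal (expectation (\<lambda>\<omega>. score \<zeta> n i \<omega> * score \<zeta> n j \<omega>)) = ennreal (s n)" using ij n by (simp add: s_def)
    moreover have "0 \<le> expectation (\<lambda>\<omega>. score \<zeta> n i \<omega> * score \<zeta> n j \<omega>)" "0 \<le> s n"
      using V01[of _ n] ij n by (auto simp: s_def intro!: integral_nonneg_AE)
    ultimately show ?thesis by simp
  qed
  \<comment> \<open>the \<open>n\<close> diagonal terms are at most \<open>1\<close>, all others have the common mean \<open>s n\<close>\<close>
  have T: "expectation (\<lambda>\<omega>. ((\<Sum>i=1..n. score \<zeta> n i \<omega>) / real n - \<mu>)\<^sup>2) \<le> 1 / real n + s n - 2 * \<mu> * e n + \<mu>\<^sup>2" if n: "2 \<le> n" for n
  proof -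
    have s0: "0 \<le> s n" using V01[of _ n] n by (auto simp: s_def intro!: integral_nonneg_AE)
    have n0: "0 < real n" using n by simp
    have sq: "((\<Sum>i=1..n. score \<zeta> n i \<omega>) / real n - \<mu>)\<^sup>2 =
        (\<Sum>i=1..n. \<Sum>j=1..n. score \<zeta> n i \<omega> * score \<zeta> n j \<omega>) / (real n)\<^sup>2 - 2 * \<mu> / real n * (\<Sum>i=1..n. score \<zeta> n i \<omega>) + \<mu>\<^sup>2" for \<omega>
    proof -
      have "(a / b - c)\<^sup>2 = a * a / b\<^sup>2 - 2 * c / b * a + c\<^sup>2" if "0 < b" for a b c :: real
        using that by (simp add: power2_eq_square field_simps)
      from this[OF n0] show ?thesis by (simp only: sum_product)
    qed
    have i2: "integrable M (\<lambda>\<omega>. \<Sum>i=1..n. \<Sum>j=1..n. score \<zeta> n i \<omega> * score \<zeta> n j \<omega>)" and i1: "integrable M (\<lambda>\<omega>. \<Sum>i=1..n. score \<zeta> n i \<omega>)"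
      using Vint by (auto intro!: Bochner_Integration.integrable_sum)
    have "expectation (\<lambda>\<omega>. \<Sum>i=1..n. \<Sum>j=1..n. score \<zeta> n i \<omega> * score \<zeta> n j \<omega>) =
        (\<Sum>i=1..n. \<Sum>j=1..n. expectation (\<lambda>\<omega>. score \<zeta> n i \<omega> * score \<zeta> n j \<omega>))"
      using Vint by (subst Bochner_Integration.integral_sum) (auto intro!: Bochner_Integration.integrable_sum sum.cong Bochner_Integration.integral_sum)
    also have "\<dots> \<le> (\<Sum>i=1..n. \<Sum>j=1..n. (if i = j then 1 else 0) + s n)"
    proof (intro sum_mono)
      fix i j assume ij: "i \<in> {1..n}" "j \<in> {1..n}"
      have "expectation (\<lambda>\<omega>. score \<zeta> n i \<omega> * score \<zeta> n j \<omega>) \<le> 1"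
        using V01[OF ij(1)] V01[OF ij(2)] Vint(2)[OF ij] by (intro integral_le_const) (auto intro: mult_le_one)
      then show "expectation (\<lambda>\<omega>. score \<zeta> n i \<omega> * score \<zeta> n j \<omega>) \<le> (if i = j then 1 else 0) + s n"
        using EVV[OF ij] s0 by (cases "i = j") auto
    qed
    also have "\<dots> = real n + (real n)\<^sup>2 * s n"
      by (simp add: sum.distrib power2_eq_square algebra_simps)
    finally have E2: "expectation (\<lambda>\<omega>. \<Sum>i=1..n. \<Sum>j=1..n. score \<zeta> n i \<omega> * score \<zeta> n j \<omega>) \<le> real n + (real n)\<^sup>2 * s n" .
    have E1: "expectation (\<lambda>\<omega>. \<Sum>i=1..n. score \<zeta> n i \<omega>) = real n * e n"
      using Vint EV by (subst Bochner_Integration.integral_sum) auto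
    have "expectation (\<lambda>\<omega>. ((\<Sum>i=1..n. score \<zeta> n i \<omega>) / real n - \<mu>)\<^sup>2) =
        expectation (\<lambda>\<omega>. \<Sum>i=1..n. \<Sum>j=1..n. score \<zeta> n i \<omega> * score \<zeta> n j \<omega>) / (real n)\<^sup>2 - 2 * \<mu> / real n * (real n * e n) + \<mu>\<^sup>2"
      unfolding sq E1[symmetric] using i1 i2 prob_space by simp
    also have "\<dots> \<le> (real n + (real n)\<^sup>2 * s n) / (real n)\<^sup>2 - 2 * \<mu> / real n * (real n * e n) + \<mu>\<^sup>2"
      using E2 by (intro add_right_mono diff_right_mono divide_right_mono) auto
    also have "\<dots> = 1 / real n + s n - 2 * \<mu> * e n + \<mu>\<^sup>2"
      using n0 by (simp add: power2_eq_square field_simps)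
    finally show ?thesis .
  qed
  show "(\<lambda>n. expectation (\<lambda>\<omega>. ((\<Sum>i=1..n. score \<zeta> n i \<omega>) / real n - \<mu>)\<^sup>2)) \<longlonglongrightarrow> 0"
  proof (rule order_tendstoI)
    fix a :: real assume "a < 0"
    then show "\<forall>\<^sub>F n in sequentially. a < expectation (\<lambda>\<omega>. ((\<Sum>i=1..n. score \<zeta> n i \<omega>) / real n - \<mu>)\<^sup>2)"
      by (intro always_eventually allI) (rule order_less_le_trans[OF _ integral_nonneg_AE], auto)
  next
    fix a :: real assume a: "0 < a"
    have "(\<lambda>n. 1 / real n - 2 * \<mu> * e n + \<mu>\<^sup>2) \<longlonglongrightarrow> 0 - 2 * \<mu> * \<mu> + \<mu>\<^sup>2"
      using \<open>e \<longlonglongrightarrow> \<mu>\<close> by (intro tendsto_intros lim_1_over_n)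
    then have "\<forall>\<^sub>F n in sequentially. 1 / real n - 2 * \<mu> * e n + \<mu>\<^sup>2 < - \<mu>\<^sup>2 + a / 2"
      using a by (intro order_tendstoD(2)) (auto simp: power2_eq_square)
    moreover have "\<forall>\<^sub>F n in sequentially. s n < \<mu>\<^sup>2 + a / 2"
      using a by (intro ev[OF s_le tendsto_power[OF up]]) auto
    ultimately show "\<forall>\<^sub>F n in sequentially. expectation (\<lambda>\<omega>. ((\<Sum>i=1..n. score \<zeta> n i \<omega>) / real n - \<mu>)\<^sup>2) < a"
      using eventually_ge_at_top[of 2]
    proof eventually_elim
      case (elim n)
      then show ?case using T[of n] by simp
    qed
  qed
qed

end

section \<open>Truncation and stabilization\<close>

text \<open>Essential suprema and suprema commute with continuous increasing functions; a decreasing function turns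
  the lower bound into an upper one. In this way upper bounds for \<open>1 - \<xi>\<close> are lower bounds for \<open>\<xi>\<close>.\<close>

lemma upper_stab_compose:
  fixes \<xi> \<zeta> :: "'a::euclidean_space \<Rightarrow> 'a set \<Rightarrow> real"
  assumes \<xi>: "measurable_functional \<xi>" and \<zeta>: "measurable_functional \<zeta>" and S: "locally_finite S"
    and cont: "continuous_on UNIV \<Phi>"
    and eq: "\<And>T. locally_finite T \<Longrightarrow> 0 \<in> T \<Longrightarrow> ennreal (\<zeta> 0 T) = \<Phi> (ennreal (\<xi> 0 T))"
  shows "mono \<Phi> \<Longrightarrow> upper_stab \<zeta> S m = \<Phi> (upper_stab \<xi> S m)"
    and "antimono \<Phi> \<Longrightarrow> upper_stab \<zeta> S m = \<Phi> (lower_stab \<xi> S m)"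
proof -
  let ?F = "\<lambda>(n::nat) y. ennreal (eval_at \<xi> 0 ((S \<inter> cball 0 (real m)) \<union> y ` {1..n}))"
  let ?G = "\<lambda>(n::nat) y. ennreal (eval_at \<zeta> 0 ((S \<inter> cball 0 (real m)) \<union> y ` {1..n}))"
  have FG: "?G n = (\<lambda>y. \<Phi> (?F n y))" for n
  proof
    fix y :: "nat \<Rightarrow> 'a"
    have "locally_finite (insert 0 (S \<inter> cball 0 (real m) \<union> y ` {1..n}))"
      using locally_finite_Un[OF locally_finite_Int[OF S] locally_finite_finite[of "insert 0 (y ` {1..n})"], of "cball 0 (real m)"]
      by simp
    from eq[OF this] show "?G n y = \<Phi> (?F n y)" by (simp add: eval_at_def)
  qed
  have es: "esssup (outer_tuples m n) (?G n) = Limsup (ae_filter (outer_tuples m n)) (\<lambda>y. \<Phi> (?F n y))"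
    "esssup (outer_tuples m n) (?F n) = Limsup (ae_filter (outer_tuples m n)) (?F n)"
    "essinf (outer_tuples m n) (?F n) = Liminf (ae_filter (outer_tuples m n)) (?F n)" for n
    using measurable_outer_eval_section[OF \<xi> S, of m n] measurable_outer_eval_section[OF \<zeta> S, of m n]
    unfolding esssup_def essinf_def FG by simp_all
  have cw: "continuous (at x within A) \<Phi>" for x A
    using cont by (rule continuous_on_imp_continuous_within) auto
  {
    assume \<Phi>: "mono \<Phi>"
    have "upper_stab \<zeta> S m = (SUP n\<in>{1..}. \<Phi> (esssup (outer_tuples m n) (?F n)))"
      unfolding upper_stab_def es(1,2) using outer_tuples_nontrivial[where 'a='a]
      by (intro SUP_cong refl Limsup_compose_continuous_mono[OF cont \<Phi>]) auto
    also have "\<dots> = \<Phi> (upper_stab \<xi> S m)"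
      unfolding upper_stab_def using continuous_at_Sup_mono[OF \<Phi> cw, of "(\<lambda>n. esssup (outer_tuples m n) (?F n)) ` {1..}"]
      by (simp add: image_image)
    finally show "upper_stab \<zeta> S m = \<Phi> (upper_stab \<xi> S m)" .
  next
    assume \<Phi>: "antimono \<Phi>"
    have "upper_stab \<zeta> S m = (SUP n\<in>{1..}. \<Phi> (essinf (outer_tuples m n) (?F n)))"
      unfolding upper_stab_def es(1,3) using outer_tuples_nontrivial[where 'a='a]
      by (intro SUP_cong refl Limsup_compose_continuous_antimono[OF cont \<Phi>]) auto
    also have "\<dots> = \<Phi> (lower_stab \<xi> S m)"
      unfolding lower_stab_def using continuous_at_Inf_antimono[OF \<Phi> cw, of "(\<lambda>n. essinf (outer_tuples m n) (?F n)) ` {1..}"]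
      by (simp add: image_image)
    finally show "upper_stab \<zeta> S m = \<Phi> (lower_stab \<xi> S m)" .
  }
qed

definition truncated :: "real \<Rightarrow> ('a::euclidean_space \<Rightarrow> 'a set \<Rightarrow> real) \<Rightarrow> 'a \<Rightarrow> 'a set \<Rightarrow> real" where
  "truncated K \<xi> x S = min 1 (\<xi> x S / K)"

text \<open>The same operation on extended values, applied to the stabilization bounds.\<close>

definition truncation :: "real \<Rightarrow> ennreal \<Rightarrow> ennreal" where
  "truncation K t = min 1 (ennreal (1 / K) * t)"

lemma truncated_measurable:
  assumes "measurable_functional \<xi>"
  shows "measurable_functional (truncated K \<xi>)" "measurable_functional (\<lambda>x S. 1 - truncated K \<xi> x S)"
  using assms unfolding measurable_functional_def truncated_def by (simp_all add: case_prod_beta')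

lemma truncated_translation_invariant: "translation_invariant \<xi> \<Longrightarrow> translation_invariant (truncated K \<xi>)"
  by (simp add: translation_invariant_def truncated_def)

lemma truncated_01:
  assumes "nonneg_functional \<xi>" "0 < K" "locally_finite S" "x \<in> S"
  shows "0 \<le> truncated K \<xi> x S \<and> truncated K \<xi> x S \<le> 1"
  using assms by (auto simp: truncated_def nonneg_functional_def)

lemma truncation_le_1: "truncation K t \<le> 1"
  by (simp add: truncation_def)

lemma truncation_less_top: "truncation K t < top"
  by (rule order_le_less_trans[OF truncation_le_1]) simp

lemma continuous_truncation: "continuous_on UNIV (truncation K)"
  unfolding truncation_def[abs_def]
  by (intro continuous_on_min continuous_on_const ennreal_continuous_on_cmult continuous_on_id) simp

lemma mono_truncation: "mono (truncation K)"
  unfolding truncation_def by (intro monoI min.mono mult_left_mono) auto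

lemma continuous_truncation_compl: "continuous_on UNIV (\<lambda>t. 1 - truncation K t)"
  using continuous_truncation truncation_less_top
  by (intro continuous_on_diff_ennreal continuous_on_const) (auto simp: less_top)

lemma antimono_truncation_compl: "antimono (\<lambda>t. 1 - truncation K t)"
  using mono_truncation by (intro antimonoI ennreal_minus_mono) (auto dest: monoD)

lemma ennreal_truncated:
  assumes "nonneg_functional \<xi>" "0 < K" "locally_finite S" "x \<in> S"
  shows "ennreal (truncated K \<xi> x S) = truncation K (ennreal (\<xi> x S))"
    and "ennreal (1 - truncated K \<xi> x S) = 1 - truncation K (ennreal (\<xi> x S))"
proof -
  have "0 \<le> \<xi> x S" using assms by (auto simp: nonneg_functional_def)
  then show 1: "ennreal (truncated K \<xi> x S) = truncation K (ennreal (\<xi> x S))"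
    using assms by (simp add: truncated_def truncation_def ennreal_mult[symmetric] min_ennreal flip: ennreal_1)
  show "ennreal (1 - truncated K \<xi> x S) = 1 - truncation K (ennreal (\<xi> x S))"
    using truncated_01[OF assms] by (simp add: 1[symmetric] ennreal_minus flip: ennreal_1)
qed

context iid_sample
begin

lemma clipped_truncated:
  assumes \<xi>: "measurable_functional \<xi>" "nonneg_functional \<xi>" and K: "0 < K" and S: "locally_finite S"
  shows "clipped_upper_stab (truncated K \<xi>) m S = enn2real (truncation K (upper_stab \<xi> S m))"
    and "clipped_upper_stab (\<lambda>x S. 1 - truncated K \<xi> x S) m S = 1 - enn2real (truncation K (lower_stab \<xi> S m))"
proof -
  have "upper_stab (truncated K \<xi>) S m = truncation K (upper_stab \<xi> S m)"
    by (rule upper_stab_compose(1)[OF \<xi>(1) truncated_measurable(1)[OF \<xi>(1)] S continuous_truncation _ mono_truncation])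
       (rule ennreal_truncated(1)[OF \<xi>(2) K])
  then show "clipped_upper_stab (truncated K \<xi>) m S = enn2real (truncation K (upper_stab \<xi> S m))"
    using truncation_le_1 by (simp add: clipped_upper_stab_def min_absorb2)
  have "upper_stab (\<lambda>x S. 1 - truncated K \<xi> x S) S m = 1 - truncation K (lower_stab \<xi> S m)"
    by (rule upper_stab_compose(2)[OF \<xi>(1) truncated_measurable(2)[OF \<xi>(1)] S continuous_truncation_compl _ antimono_truncation_compl])
       (rule ennreal_truncated(2)[OF \<xi>(2) K])
  moreover have "enn2real (1 - truncation K t) = 1 - enn2real (truncation K t)" for t
    using truncation_le_1[of K t] truncation_less_top[of K t] enn2real_mono[of "truncation K t" 1]
    by (cases "truncation K t") (auto simp: ennreal_minus simp flip: ennreal_1)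
  ultimately show "clipped_upper_stab (\<lambda>x S. 1 - truncated K \<xi> x S) m S = 1 - enn2real (truncation K (lower_stab \<xi> S m))"
    by (simp add: clipped_upper_stab_def min_absorb2)
qed

end

locale stabilizing_setting = iid_sample f M X
  for f :: "'a::euclidean_space \<Rightarrow> real" and M :: "'w measure" and X :: "nat \<Rightarrow> 'w \<Rightarrow> 'a" +
  fixes \<xi> :: "'a \<Rightarrow> 'a set \<Rightarrow> real" and N :: "real \<Rightarrow> 'v measure" and P :: "real \<Rightarrow> 'v \<Rightarrow> 'a set"
  assumes xi_measurable: "measurable_functional \<xi>"
    and xi_nonneg: "nonneg_functional \<xi>"
    and xi_translation: "translation_invariant \<xi>"
    and poisson: "\<And>\<tau>. 0 < \<tau> \<Longrightarrow> homogeneous_poisson (N \<tau>) \<tau> (P \<tau>)"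
    and stabilizing: "\<And>\<tau>. 0 < \<tau> \<Longrightarrow> AE v in N \<tau>. stabilizes_on \<xi> (P \<tau> v)"
begin

definition L :: "real \<Rightarrow> 'a set measure" where
  "L \<tau> = distr (N \<tau>) point_sets (P \<tau>)"

lemma L: "0 < \<tau> \<Longrightarrow> poisson_law (\<lambda>B. \<tau> * measure lborel B) (L \<tau>)"
  unfolding L_def using poisson by (rule homogeneous_poisson_law)

lemma P_measurable: "0 < \<tau> \<Longrightarrow> P \<tau> \<in> measurable (N \<tau>) point_sets"
  using poisson by (simp add: homogeneous_poisson_def)

lemma N_prob: "0 < \<tau> \<Longrightarrow> prob_space (N \<tau>)"
  using poisson by (simp add: homogeneous_poisson_def)

lemma P_locally_finite: "0 < \<tau> \<Longrightarrow> v \<in> space (N \<tau>) \<Longrightarrow> locally_finite (P \<tau> v)"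
  using measurable_space[OF P_measurable] by (auto simp: space_point_sets)

lemma limit_functional_measurable:
  "0 < \<tau> \<Longrightarrow> (\<lambda>v. limit_functional \<xi> (P \<tau> v)) \<in> borel_measurable (N \<tau>)"
  unfolding limit_functional_def
  by (intro borel_measurable_limsup measurable_compose[OF P_measurable measurable_upper_stab[OF xi_measurable]])

definition truncated_mean :: "real \<Rightarrow> real \<Rightarrow> real" where
  "truncated_mean K \<tau> = (\<integral>v. enn2real (truncation K (limit_functional \<xi> (P \<tau> v))) \<partial>N \<tau>)"

lemma truncation_measurable: "0 < \<tau> \<Longrightarrow> (\<lambda>v. truncation K (limit_functional \<xi> (P \<tau> v))) \<in> borel_measurable (N \<tau>)"
  using limit_functional_measurable[of \<tau>] unfolding truncation_def by measurable

lemma enn2real_truncation_01: "0 \<le> enn2real (truncation K t)" "enn2real (truncation K t) \<le> 1"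
  using enn2real_mono[OF truncation_le_1, of K t] by auto

lemma truncated_mean_01:
  assumes "0 < \<tau>"
  shows "0 \<le> truncated_mean K \<tau>" "truncated_mean K \<tau> \<le> 1"
    "integrable (N \<tau>) (\<lambda>v. enn2real (truncation K (limit_functional \<xi> (P \<tau> v))))"
proof -
  interpret N: prob_space "N \<tau>" using assms by (rule N_prob)
  show "0 \<le> truncated_mean K \<tau>" "truncated_mean K \<tau> \<le> 1"
    "integrable (N \<tau>) (\<lambda>v. enn2real (truncation K (limit_functional \<xi> (P \<tau> v))))"
    unfolding truncated_mean_def
    using N.expectation_01[of "\<lambda>v. enn2real (truncation K (limit_functional \<xi> (P \<tau> v)))"]
      truncation_measurable[OF assms, of K] enn2real_truncation_01 by auto
qed

text \<open>Almost every configuration of the Poisson process is one on which \<open>\<xi>\<close> stabilizes, so the bounds of the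
  truncated functional converge to the truncated limit, with bounded integrands.\<close>

lemma tendsto_clipped_mean:
  assumes \<tau>: "0 < \<tau>" and K: "0 < K"
  shows "(\<lambda>m. \<integral>S. clipped_upper_stab (truncated K \<xi>) m S \<partial>L \<tau>) \<longlonglongrightarrow> truncated_mean K \<tau>"
    and "(\<lambda>m. \<integral>S. clipped_upper_stab (\<lambda>x S. 1 - truncated K \<xi> x S) m S \<partial>L \<tau>) \<longlonglongrightarrow> 1 - truncated_mean K \<tau>"
proof -
  interpret N: prob_space "N \<tau>" using \<tau> by (rule N_prob)
  let ?g = "\<lambda>m. clipped_upper_stab (truncated K \<xi>) m" and ?h = "\<lambda>m. clipped_upper_stab (\<lambda>x S. 1 - truncated K \<xi> x S) m"
  let ?l = "\<lambda>v. enn2real (truncation K (limit_functional \<xi> (P \<tau> v)))"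
  note g = local_functionalD[OF local_functional_clipped[OF truncated_measurable(1)[OF xi_measurable], of m K for m]]
  note h = local_functionalD[OF local_functional_clipped[OF truncated_measurable(2)[OF xi_measurable], of m K for m]]
  have lim: "(\<lambda>m. enn2real (truncation K (a m))) \<longlonglongrightarrow> enn2real (truncation K b)" if "a \<longlonglongrightarrow> b" for a :: "nat \<Rightarrow> ennreal" and b
  proof -
    have "isCont (truncation K) b" using continuous_truncation by (simp add: continuous_on_eq_continuous_at)
    then have "(\<lambda>m. truncation K (a m)) \<longlonglongrightarrow> truncation K b" using that by (rule isCont_tendsto_compose)
    also have "truncation K b = ennreal (enn2real (truncation K b))" using truncation_less_top[of K b] by simp
    finally show ?thesis by (rule tendsto_enn2real) simp
  qed
  have m1: "(\<integral>S. ?g m S \<partial>L \<tau>) = (\<integral>v. ?g m (P \<tau> v) \<partial>N \<tau>)" and m2: "(\<integral>S. ?h m S \<partial>L \<tau>) = (\<integral>v. ?h m (P \<tau> v) \<partial>N \<tau>)" for m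
    unfolding L_def using g(1) h(1) by (auto intro!: integral_distr[OF P_measurable[OF \<tau>]])
  note tm = truncated_mean_01(3)[OF \<tau>, of K]
  have "(\<lambda>m. \<integral>v. ?g m (P \<tau> v) \<partial>N \<tau>) \<longlonglongrightarrow> (\<integral>v. ?l v \<partial>N \<tau>)"
  proof (rule integral_dominated_convergence[where w="\<lambda>_. 1"])
    show "AE v in N \<tau>. (\<lambda>m. ?g m (P \<tau> v)) \<longlonglongrightarrow> ?l v"
      using stabilizing[OF \<tau>] AE_space
    proof eventually_elim
      case (elim v)
      then show ?case
        using lim[of "upper_stab \<xi> (P \<tau> v)"] clipped_truncated(1)[OF xi_measurable xi_nonneg K P_locally_finite[OF \<tau>]]
        by (simp add: stabilizes_on_def)
    qed
    show "AE v in N \<tau>. norm (?g m (P \<tau> v)) \<le> 1" for m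
      by (rule AE_I2) (use g(2)[OF P_locally_finite[OF \<tau>]] in auto)
    show "(\<lambda>v. ?g m (P \<tau> v)) \<in> borel_measurable (N \<tau>)" for m
      by (rule measurable_compose[OF P_measurable[OF \<tau>] g(1)])
  qed (use tm in auto)
  then show "(\<lambda>m. \<integral>S. ?g m S \<partial>L \<tau>) \<longlonglongrightarrow> truncated_mean K \<tau>" by (simp add: m1 truncated_mean_def)
  have "(\<lambda>m. \<integral>v. ?h m (P \<tau> v) \<partial>N \<tau>) \<longlonglongrightarrow> (\<integral>v. 1 - ?l v \<partial>N \<tau>)"
  proof (rule integral_dominated_convergence[where w="\<lambda>_. 1"])
    show "AE v in N \<tau>. (\<lambda>m. ?h m (P \<tau> v)) \<longlonglongrightarrow> 1 - ?l v"
      using stabilizing[OF \<tau>] AE_space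
    proof eventually_elim
      case (elim v)
      then have "(\<lambda>m. 1 - enn2real (truncation K (lower_stab \<xi> (P \<tau> v) m))) \<longlonglongrightarrow> 1 - ?l v"
        by (intro tendsto_diff tendsto_const lim) (simp add: stabilizes_on_def)
      then show ?case
        using clipped_truncated(2)[OF xi_measurable xi_nonneg K P_locally_finite[OF \<tau>]] elim by simp
    qed
    show "AE v in N \<tau>. norm (?h m (P \<tau> v)) \<le> 1" for m
      by (rule AE_I2) (use h(2)[OF P_locally_finite[OF \<tau>]] in auto)
    show "(\<lambda>v. ?h m (P \<tau> v)) \<in> borel_measurable (N \<tau>)" for m
      by (rule measurable_compose[OF P_measurable[OF \<tau>] h(1)])
  qed (use tm in auto)
  then show "(\<lambda>m. \<integral>S. ?h m S \<partial>L \<tau>) \<longlonglongrightarrow> 1 - truncated_mean K \<tau>"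
    using tm N.prob_space by (simp add: m2 truncated_mean_def)
qed

definition truncated_limit :: "real \<Rightarrow> real" where
  "truncated_limit K = (\<integral>x. indicator {0<..} (f x) * truncated_mean K (f x) \<partial>Q)"

lemma truncated_mean_measurable:
  assumes K: "0 < K"
  shows "(\<lambda>x. indicator {0<..} (f x) * truncated_mean K (f x)) \<in> borel_measurable borel"
proof (rule borel_measurable_LIMSEQ_real)
  show "(\<lambda>m. indicator {0<..} (f x) * (\<integral>S. clipped_upper_stab (truncated K \<xi>) m S \<partial>L (f x))) \<longlonglongrightarrow>
      indicator {0<..} (f x) * truncated_mean K (f x)" for x
    using tendsto_clipped_mean(1)[OF _ K, of "f x"] by (cases "0 < f x") (auto intro!: tendsto_mult)
  show "(\<lambda>x. indicator {0<..} (f x) * (\<integral>S. clipped_upper_stab (truncated K \<xi>) m S \<partial>L (f x))) \<in> borel_measurable borel" for m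
    by (rule poisson_mean_measurable[OF L local_functional_clipped[OF truncated_measurable(1)[OF xi_measurable], of m]])
qed

lemma tendsto_limit_average:
  assumes K: "0 < K"
  shows "(\<lambda>m. limit_average L (clipped_upper_stab (truncated K \<xi>) m)) \<longlonglongrightarrow> truncated_limit K"
    and "(\<lambda>m. limit_average L (clipped_upper_stab (\<lambda>x S. 1 - truncated K \<xi> x S) m)) \<longlonglongrightarrow> 1 - truncated_limit K"
proof -
  let ?i = "\<lambda>x. indicator {0<..} (f x) :: real"
  note g = local_functional_clipped[OF truncated_measurable(1)[OF xi_measurable], of _ K]
  note h = local_functional_clipped[OF truncated_measurable(2)[OF xi_measurable], of _ K]
  note tmm = truncated_mean_measurable[OF K]
  have tm01: "0 \<le> ?i x * truncated_mean K (f x)" "?i x * truncated_mean K (f x) \<le> 1" for x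
    using truncated_mean_01[of "f x" K] by (auto simp: indicator_def)
  have im: "?i \<in> borel_measurable borel" by measurable
  show "(\<lambda>m. limit_average L (clipped_upper_stab (truncated K \<xi>) m)) \<longlonglongrightarrow> truncated_limit K"
    unfolding limit_average_def truncated_limit_def
  proof (rule integral_dominated_convergence[where w="\<lambda>_. 1"])
    show "AE x in Q. (\<lambda>m. ?i x * (\<integral>S. clipped_upper_stab (truncated K \<xi>) m S \<partial>L (f x))) \<longlonglongrightarrow> ?i x * truncated_mean K (f x)"
      using tendsto_clipped_mean(1)[OF _ K] by (intro AE_I2) (auto intro!: tendsto_mult simp: indicator_def)
    show "AE x in Q. norm (?i x * (\<integral>S. clipped_upper_stab (truncated K \<xi>) m S \<partial>L (f x))) \<le> 1" for m
      using poisson_mean_01[OF L g] by (intro AE_I2) (simp only: real_norm_def abs_of_nonneg)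
  qed (use poisson_mean_measurable[OF L g] tmm in \<open>auto simp: measurable_cong_sets[OF sets_Q refl]\<close>)
  have "(\<lambda>m. limit_average L (clipped_upper_stab (\<lambda>x S. 1 - truncated K \<xi> x S) m)) \<longlonglongrightarrow> (\<integral>x. ?i x * (1 - truncated_mean K (f x)) \<partial>Q)"
    unfolding limit_average_def
  proof (rule integral_dominated_convergence[where w="\<lambda>_. 1"])
    show "AE x in Q. (\<lambda>m. ?i x * (\<integral>S. clipped_upper_stab (\<lambda>x S. 1 - truncated K \<xi> x S) m S \<partial>L (f x))) \<longlonglongrightarrow> ?i x * (1 - truncated_mean K (f x))"
      using tendsto_clipped_mean(2)[OF _ K] by (intro AE_I2) (auto intro!: tendsto_mult simp: indicator_def)
    show "AE x in Q. norm (?i x * (\<integral>S. clipped_upper_stab (\<lambda>x S. 1 - truncated K \<xi> x S) m S \<partial>L (f x))) \<le> 1" for m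
      using poisson_mean_01[OF L h] by (intro AE_I2) (simp only: real_norm_def abs_of_nonneg)
    show "(\<lambda>x. ?i x * (1 - truncated_mean K (f x))) \<in> borel_measurable Q"
      using borel_measurable_diff[OF im tmm] by (simp add: measurable_cong_sets[OF sets_Q refl] right_diff_distrib)
  qed (use poisson_mean_measurable[OF L h] in \<open>auto simp: measurable_cong_sets[OF sets_Q refl]\<close>)
  also have "(\<integral>x. ?i x * (1 - truncated_mean K (f x)) \<partial>Q) = (\<integral>x. 1 - ?i x * truncated_mean K (f x) \<partial>Q)"
  proof (rule integral_cong_AE)
    show "AE x in Q. ?i x * (1 - truncated_mean K (f x)) = 1 - ?i x * truncated_mean K (f x)"
      using AE_Q_pos by eventually_elim simp
    show "(\<lambda>x. ?i x * (1 - truncated_mean K (f x))) \<in> borel_measurable Q" 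
      using borel_measurable_diff[OF im tmm] by (simp add: measurable_cong_sets[OF sets_Q refl] right_diff_distrib)
  qed (use tmm in \<open>auto simp: measurable_cong_sets[OF sets_Q refl]\<close>)
  also have "\<dots> = 1 - truncated_limit K"
  proof -
    have "integrable Q (\<lambda>x. ?i x * truncated_mean K (f x))"
      using tm01 tmm by (intro Q.expectation_01(1)) (auto simp: measurable_cong_sets[OF sets_Q refl])
    then show ?thesis using Q.prob_space by (simp add: truncated_limit_def)
  qed
  finally show "(\<lambda>m. limit_average L (clipped_upper_stab (\<lambda>x S. 1 - truncated K \<xi> x S) m)) \<longlonglongrightarrow> 1 - truncated_limit K" .
qed

lemma truncated_lln:
  assumes K: "0 < K"
  shows "(\<lambda>n. expectation (score (truncated K \<xi>) n 1)) \<longlonglongrightarrow> truncated_limit K"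
    and "(\<lambda>n. expectation (\<lambda>\<omega>. ((\<Sum>i=1..n. score (truncated K \<xi>) n i \<omega>) / real n - truncated_limit K)\<^sup>2)) \<longlonglongrightarrow> 0"
  using bounded_lln[OF L truncated_measurable(1)[OF xi_measurable] truncated_translation_invariant[OF xi_translation]
      truncated_01[OF xi_nonneg K] tendsto_limit_average[OF K]] by auto

text \<open>Monotone convergence, in the configuration and in the point \<open>x\<close>. The mean with respect to \<open>x\<close> is
  measurable because it is an increasing limit of means of truncated functionals, which are
  limits of continuous functions of the density.\<close>

lemma truncated_limits_tendsto_limit_mean: "(\<lambda>k. ennreal (real (Suc k) * truncated_limit (real (Suc k)))) \<longlonglongrightarrow> limit_mean \<xi> N P f"
proof -
  let ?K = "\<lambda>k. real (Suc k)"
  define A where "A k x = (if f x = 0 then 0 else (\<integral>\<^sup>+v. min (ennreal (?K k)) (limit_functional \<xi> (P (f x) v)) \<partial>N (f x)) * ennreal (f x))" for k x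
  have scale: "ennreal (?K k) * truncation (?K k) t = min (ennreal (?K k)) t" for k t
  proof (cases t)
    case (real r)
    have "min 1 (1 / ?K k * r) * ?K k = min (?K k) r" by (auto simp: min_def divide_simps)
    then show ?thesis using real
      by (simp add: truncation_def ennreal_mult[symmetric] min_ennreal mult.commute flip: ennreal_1 del: of_nat_Suc)
  qed (simp add: truncation_def ennreal_mult_top min_absorb1 del: of_nat_Suc)
  have mean: "(\<integral>\<^sup>+v. min (ennreal (?K k)) (limit_functional \<xi> (P \<tau> v)) \<partial>N \<tau>) = ennreal (?K k * truncated_mean (?K k) \<tau>)"
    if \<tau>: "0 < \<tau>" for k \<tau>
  proof -
    have "(\<integral>\<^sup>+v. min (ennreal (?K k)) (limit_functional \<xi> (P \<tau> v)) \<partial>N \<tau>) =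
        (\<integral>\<^sup>+v. ennreal (?K k) * ennreal (enn2real (truncation (?K k) (limit_functional \<xi> (P \<tau> v)))) \<partial>N \<tau>)"
      by (intro nn_integral_cong) (simp only: ennreal_enn2real[OF truncation_less_top] scale)
    also have "\<dots> = ennreal (?K k) * ennreal (truncated_mean (?K k) \<tau>)"
      unfolding truncated_mean_def
      using truncated_mean_01(3)[OF \<tau>, of "?K k"] by (subst nn_integral_cmult) (auto simp: nn_integral_eq_integral simp del: of_nat_Suc)
    finally show ?thesis using truncated_mean_01[OF \<tau>] by (simp add: ennreal_mult del: of_nat_Suc)
  qed
  have A: "A k x = ennreal (?K k) * ennreal (f x * (indicator {0<..} (f x) * truncated_mean (?K k) (f x)))" for k x
  proof (cases "f x = 0")
    case False
    then have "0 < f x" using f_nonneg[of x] by simp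
    then show ?thesis
      using mean[of "f x" k] truncated_mean_01[of "f x" "?K k"]
      by (simp add: A_def ennreal_mult'[symmetric] ennreal_mult[symmetric] mult_ac del: of_nat_Suc)
  qed (simp add: A_def)
  have Am[measurable]: "A k \<in> borel_measurable borel" for k
    unfolding A using borel_measurable_times[OF f_measurable truncated_mean_measurable[of "?K k"]] by measurable
  have AI: "(\<integral>\<^sup>+x. A k x \<partial>lborel) = ennreal (?K k * truncated_limit (?K k))" for k
  proof -
    let ?t = "\<lambda>x. indicator {0<..} (f x) * truncated_mean (?K k) (f x)"
    have t01: "0 \<le> ?t x" "?t x \<le> 1" for x using truncated_mean_01[of "f x" "?K k"] by (auto simp: indicator_def)
    have tm: "?t \<in> borel_measurable borel" by (rule truncated_mean_measurable) simp
    have "integrable lborel (\<lambda>x. f x * ?t x)"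
    proof (rule Bochner_Integration.integrable_bound[OF f_int])
      have "\<bar>f x * ?t x\<bar> \<le> \<bar>f x\<bar>" for x
        using mult_left_le[OF t01(2) f_nonneg, of x x] t01(1)[of x] f_nonneg[of x] by (simp only: abs_of_nonneg mult_nonneg_nonneg)
      then show "AE x in lborel. norm (f x * ?t x) \<le> norm (f x)" by (simp only: real_norm_def AE_I2)
    qed (use tm in \<open>auto intro!: borel_measurable_times\<close>)
    then have "(\<integral>\<^sup>+x. ennreal (f x * ?t x) \<partial>lborel) = ennreal (\<integral>x. f x * ?t x \<partial>lborel)"
      using t01 f_nonneg by (intro nn_integral_eq_integral) auto
    also have "(\<integral>x. f x * ?t x \<partial>lborel) = truncated_limit (?K k)"
      unfolding truncated_limit_def by (rule integral_Q[OF tm, symmetric])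
    finally have 1: "(\<integral>\<^sup>+x. ennreal (f x * ?t x) \<partial>lborel) = ennreal (truncated_limit (?K k))" .
    have "0 \<le> truncated_limit (?K k)"
      unfolding truncated_limit_def using t01 by (intro integral_nonneg_AE) auto
    moreover have "(\<integral>\<^sup>+x. A k x \<partial>lborel) = ennreal (?K k) * (\<integral>\<^sup>+x. ennreal (f x * ?t x) \<partial>lborel)"
      unfolding A using borel_measurable_times[OF f_measurable tm] by (intro nn_integral_cmult) auto
    ultimately show ?thesis using 1 by (simp add: ennreal_mult del: of_nat_Suc)
  qed
  have incA: "incseq A"
  proof (intro incseq_SucI le_funI)
    fix k x
    show "A k x \<le> A (Suc k) x"
      by (auto simp: A_def intro!: mult_right_mono nn_integral_mono min.mono ennreal_leI)
  qed
  have "limit_mean \<xi> N P f = (\<integral>\<^sup>+x. (SUP k. A k x) \<partial>lborel)"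
    unfolding limit_mean_def
  proof (rule nn_integral_cong)
    fix x
    show "(if f x = 0 then 0 else (\<integral>\<^sup>+v. limit_functional \<xi> (P (f x) v) \<partial>N (f x)) * ennreal (f x)) = (SUP k. A k x)"
    proof (cases "f x = 0")
      case False
      then have \<tau>: "0 < f x" using f_nonneg[of x] by simp
      let ?l = "\<lambda>v. limit_functional \<xi> (P (f x) v)"
      have sup: "(SUP k. min (ennreal (?K k)) t) = t" for t
      proof (rule antisym)
        show "(SUP k. min (ennreal (?K k)) t) \<le> t" by (rule SUP_least) simp
        have "(\<lambda>k. min (ennreal (?K k)) t) \<longlonglongrightarrow> min top t"
          using filterlim_compose[OF of_nat_tendsto_top_ennreal filterlim_Suc]
          by (intro tendsto_min tendsto_const) (simp add: ennreal_of_nat_eq_real_of_nat del: of_nat_Suc)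
        then have "(\<lambda>k. min (ennreal (?K k)) t) \<longlonglongrightarrow> t" by simp
        then show "t \<le> (SUP k. min (ennreal (?K k)) t)"
          by (rule LIMSEQ_le_const2) (intro exI allI impI SUP_upper UNIV_I)
      qed
      have "(\<integral>\<^sup>+v. ?l v \<partial>N (f x)) = (\<integral>\<^sup>+v. (SUP k. min (ennreal (?K k)) (?l v)) \<partial>N (f x))"
        by (simp only: sup)
      also have "\<dots> = (SUP k. \<integral>\<^sup>+v. min (ennreal (?K k)) (?l v) \<partial>N (f x))"
      proof (rule nn_integral_monotone_convergence_SUP)
        show "incseq (\<lambda>k v. min (ennreal (?K k)) (?l v))"
          by (intro incseq_SucI le_funI min.mono ennreal_leI) auto
        show "(\<lambda>v. min (ennreal (?K k)) (?l v)) \<in> borel_measurable (N (f x))" for k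
          using limit_functional_measurable[OF \<tau>] by measurable
      qed
      finally show ?thesis using False by (simp add: A_def SUP_mult_right_ennreal)
    qed (simp add: A_def)
  qed
  also have "\<dots> = (SUP k. \<integral>\<^sup>+x. A k x \<partial>lborel)"
    using incA by (intro nn_integral_monotone_convergence_SUP) auto
  finally have SUP: "limit_mean \<xi> N P f = (SUP k. ennreal (?K k * truncated_limit (?K k)))" by (simp only: AI)
  have "incseq (\<lambda>k. ennreal (?K k * truncated_limit (?K k)))"
    unfolding AI[symmetric] using incA by (auto simp: incseq_def le_fun_def intro!: nn_integral_mono)
  then show "(\<lambda>k. ennreal (?K k * truncated_limit (?K k))) \<longlonglongrightarrow> limit_mean \<xi> N P f"
    unfolding SUP by (rule LIMSEQ_SUP)
qed

end

section \<open>Removing the truncation\<close>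

lemma power_mean:
  fixes a :: "nat \<Rightarrow> real"
  assumes q: "q = 1 \<or> q = 2" and n: "1 \<le> n"
  shows "((\<Sum>i=1..n. a i) / real n) ^ q \<le> (\<Sum>i=1..n. a i ^ q) / real n"
proof (cases "q = 1")
  case False
  have "(\<Sum>i=1..n. a i)\<^sup>2 \<le> (\<Sum>i=1..n. (a i)\<^sup>2) * card {1..n}"
    by (rule sum_squared_le_sum_of_squares) 
  then have "(\<Sum>i=1..n. a i)\<^sup>2 / (real n)\<^sup>2 \<le> ((\<Sum>i=1..n. (a i)\<^sup>2) * real n) / (real n)\<^sup>2"
    by (intro divide_right_mono) auto
  then show ?thesis using False q n by (simp add: power_divide power2_eq_square)
qed simp

lemma power_add3_le:
  fixes a b c :: real
  shows "\<bar>a + b + c\<bar> ^ q \<le> 3 ^ q * (\<bar>a\<bar> ^ q + \<bar>b\<bar> ^ q + \<bar>c\<bar> ^ q)"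
proof -
  define t where "t = max \<bar>a\<bar> (max \<bar>b\<bar> \<bar>c\<bar>)"
  have "\<bar>a + b + c\<bar> \<le> 3 * t" unfolding t_def by linarith
  then have "\<bar>a + b + c\<bar> ^ q \<le> (3 * t) ^ q" by (intro power_mono) auto
  also have "\<dots> = 3 ^ q * t ^ q" by (rule power_mult_distrib)
  also have "t ^ q \<le> \<bar>a\<bar> ^ q + \<bar>b\<bar> ^ q + \<bar>c\<bar> ^ q"
    unfolding t_def max_def by auto
  finally show ?thesis by simp
qed

text \<open>Above the level \<open>K\<close>, \<open>y\<^sup>q\<close> is \<open>y\<^sup>p\<close> times \<open>y\<close> to the negative power \<open>q - p\<close>.\<close>

lemma excess_power_le:
  fixes y K p :: real
  assumes y: "0 \<le> y" and K: "0 < K" and p: "real q < p" and q: "1 \<le> q"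
  shows "(y - min K y) ^ q \<le> y powr p * K powr (real q - p)"
proof (cases "y \<le> K")
  case False
  then have y0: "0 < y" using K by simp
  have "(y - min K y) ^ q \<le> y ^ q" using False K by (intro power_mono) auto
  also have "\<dots> = y powr p * y powr (real q - p)"
    using y0 by (simp add: powr_add[symmetric] powr_realpow)
  also have "\<dots> \<le> y powr p * K powr (real q - p)"
    using False K p by (intro mult_left_mono powr_mono2') auto
  finally show ?thesis .
qed (use q in \<open>simp add: min_absorb2 power_0_left\<close>)

lemma power_le_powr:
  fixes y p :: real
  assumes y: "0 \<le> y" and p: "real q < p"
  shows "y ^ q \<le> 1 + y powr p"
proof (cases "y \<le> 1")
  case True
  then have "y ^ q \<le> 1" using y by (intro power_le_one)
  then show ?thesis using powr_ge_zero[of y p] by linarith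
next
  case False
  then have "y ^ q \<le> y powr p" using p by (simp add: powr_realpow[symmetric])
  then show ?thesis by simp
qed

text \<open>The sum runs over the set of sample points, so each point counts at the first index where it occurs.
  This form holds everywhere and therefore gives measurability on the whole probability space.\<close>

lemma (in iid_sample) total_functional_eq:
  "total_functional (rescaled \<zeta> n) (sample_set X n \<omega>) =
     (\<Sum>i=1..n. if \<forall>j\<in>{1..<i}. X j \<omega> \<noteq> X i \<omega> then score \<zeta> n i \<omega> else 0)"
proof -
  let ?S = "sample_set X n \<omega>"
  let ?F = "{i \<in> {1..n}. \<forall>j\<in>{1..<i}. X j \<omega> \<noteq> X i \<omega>}"
  have inj: "inj_on (\<lambda>i. X i \<omega>) ?F"
  proof (rule inj_onI)
    fix i j assume ij: "i \<in> ?F" "j \<in> ?F" "X i \<omega> = X j \<omega>"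
    show "i = j"
    proof (rule ccontr)
      assume "i \<noteq> j"
      then have "i \<in> {1..<j} \<or> j \<in> {1..<i}" using ij by auto
      then show False using ij by auto
    qed
  qed
  have im: "(\<lambda>i. X i \<omega>) ` ?F = ?S"
  proof
    show "?S \<subseteq> (\<lambda>i. X i \<omega>) ` ?F"
    proof
      fix x assume "x \<in> ?S"
      then have ex: "\<exists>i. i \<in> {1..n} \<and> X i \<omega> = x" by (auto simp: sample_set_def)
      define i where "i = (LEAST i. i \<in> {1..n} \<and> X i \<omega> = x)"
      have i: "i \<in> {1..n}" "X i \<omega> = x" using LeastI_ex[OF ex] by (auto simp: i_def)
      have "X j \<omega> \<noteq> X i \<omega>" if "j \<in> {1..<i}" for j
      proof -
        have "j < i" using that by simp
        then have "\<not> (j \<in> {1..n} \<and> X j \<omega> = x)" unfolding i_def by (rule not_less_Least)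
        then show ?thesis using that i by auto
      qed
      then show "x \<in> (\<lambda>i. X i \<omega>) ` ?F" using i by blast
    qed
  qed (auto simp: sample_set_def)
  have "total_functional (rescaled \<zeta> n) ?S = (\<Sum>x\<in>?S. rescaled \<zeta> n x ?S)"
    unfolding total_functional_def eval_at_def by (intro sum.cong refl) (simp add: insert_absorb)
  also have "\<dots> = (\<Sum>x\<in>(\<lambda>i. X i \<omega>) ` ?F. rescaled \<zeta> n x ?S)" by (simp only: im)
  also have "\<dots> = (\<Sum>i\<in>?F. score \<zeta> n i \<omega>)" by (simp only: sum.reindex[OF inj] score_def o_def)
  also have "\<dots> = (\<Sum>i=1..n. if \<forall>j\<in>{1..<i}. X j \<omega> \<noteq> X i \<omega> then score \<zeta> n i \<omega> else 0)"
    by (rule sum.inter_filter) simp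
  finally show ?thesis .
qed

lemma (in iid_sample) total_functional_measurable:
  assumes "measurable_functional \<zeta>" "translation_invariant \<zeta>"
  shows "(\<lambda>\<omega>. total_functional (rescaled \<zeta> n) (sample_set X n \<omega>)) \<in> borel_measurable M"
  unfolding total_functional_eq
proof (rule borel_measurable_sum)
  fix i assume i: "i \<in> {1..n}"
  have "{\<omega> \<in> space M. \<forall>j\<in>{1..<i}. X j \<omega> \<noteq> X i \<omega>} \<in> sets M"
  proof (intro sets.sets_Collect_finite_All)
    fix j assume "j \<in> {1..<i}"
    then have [measurable]: "X j \<in> borel_measurable M" "X i \<in> borel_measurable M"
      using i by (auto intro: X_measurable)
    have "{\<omega> \<in> space M. X j \<omega> - X i \<omega> \<noteq> 0} \<in> sets M" by measurable
    then show "{\<omega> \<in> space M. X j \<omega> \<noteq> X i \<omega>} \<in> sets M" by simp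
  qed simp
  then show "(\<lambda>\<omega>. if \<forall>j\<in>{1..<i}. X j \<omega> \<noteq> X i \<omega> then score \<zeta> n i \<omega> else 0) \<in> borel_measurable M"
    using score_measurable[OF assms i] by (intro measurable_If) auto
qed

lemma (in iid_sample) AE_total_functional:
  "AE \<omega> in M. total_functional (rescaled \<zeta> n) (sample_set X n \<omega>) = (\<Sum>i=1..n. score \<zeta> n i \<omega>)"
  using AE_distinct[of n]
proof eventually_elim
  case (elim \<omega>)
  have "X j \<omega> \<noteq> X i \<omega>" if "i \<in> {1..n}" "j \<in> {1..<i}" for i j
    using inj_onD[OF elim, of j i] that by auto
  then show ?case unfolding total_functional_eq by (intro sum.cong) auto
qed

context stabilizing_setting
begin

lemma score_nonneg: "0 \<le> score \<xi> n i \<omega>"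
proof -
  have "0 \<le> eval_at \<xi> x (sc ` sample_set X n \<omega>)" for x and sc :: "'a \<Rightarrow> 'a"
  proof -
    have "locally_finite (insert x (sc ` sample_set X n \<omega>))"
      by (rule locally_finite_finite) (simp add: sample_set_def)
    then show ?thesis using xi_nonneg unfolding nonneg_functional_def eval_at_def by blast
  qed
  then show ?thesis by (simp add: score_def rescaled_def Let_def)
qed

lemma score_truncated: "0 < K \<Longrightarrow> K * score (truncated K \<xi>) n i \<omega> = min K (score \<xi> n i \<omega>)"
  by (auto simp: score_def rescaled_def eval_at_def Let_def truncated_def min_def divide_simps)

text \<open>Compare the average with the average of the truncated values, this one with its limit, and the latter
  with the limit for the full functional. The first error is small uniformly in \<open>n\<close>, so the level can be
  fixed before \<open>n\<close> tends to infinity.\<close>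

lemma Lq_convergence:
  fixes q :: nat and p :: real
  assumes q: "q = 1 \<or> q = 2" and p: "real q < p"
    and moments: "(SUP n\<in>{1..}. \<integral>\<^sup>+\<omega>. ennreal (score \<xi> n 1 \<omega> powr p) \<partial>M) < \<infinity>"
  shows "limit_mean \<xi> N P f < \<infinity> \<and>
    converges_in_Lq M q
      (\<lambda>n \<omega>. inverse (real n) * total_functional (rescaled \<xi> n) (sample_set X n \<omega>))
      (\<lambda>_. enn2real (limit_mean \<xi> N P f))"
proof -
  have q1: "1 \<le> q" using q by auto
  define C where "C = enn2real (SUP n\<in>{1..}. \<integral>\<^sup>+\<omega>. ennreal (score \<xi> n 1 \<omega> powr p) \<partial>M)"
  have C0: "0 \<le> C" by (simp add: C_def)
  note Vm = score_measurable[OF xi_measurable xi_translation]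
  have moment: "(\<integral>\<^sup>+\<omega>. ennreal (score \<xi> n i \<omega> powr p) \<partial>M) \<le> ennreal C" if i: "i \<in> {1..n}" for n i
  proof -
    have "(\<integral>\<^sup>+\<omega>. ennreal (score \<xi> n i \<omega> powr p) \<partial>M) = (\<integral>\<^sup>+\<omega>. ennreal (score \<xi> n 1 \<omega> powr p) \<partial>M)"
      by (rule exchangeable_one[OF xi_measurable xi_translation i]) measurable
    also have "\<dots> \<le> (SUP n\<in>{1..}. \<integral>\<^sup>+\<omega>. ennreal (score \<xi> n 1 \<omega> powr p) \<partial>M)"
      using i by (intro SUP_upper) auto
    also have "\<dots> = ennreal C" using moments by (simp add: C_def)
    finally show ?thesis .
  qed
  have pm: "(\<lambda>\<omega>. ennreal (score \<xi> n i \<omega> powr p)) \<in> borel_measurable M" if "i \<in> {1..n}" for n i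
    using Vm[OF that] by measurable
  define A where "A n \<omega> = (\<Sum>i=1..n. score \<xi> n i \<omega>) / real n" for n \<omega>
  have Am[measurable]: "A n \<in> borel_measurable M" for n
    unfolding A_def[abs_def] using Vm by (intro borel_measurable_divide borel_measurable_sum) auto
  have A0: "0 \<le> A n \<omega>" for n \<omega> by (simp add: A_def score_nonneg sum_nonneg)
  \<comment> \<open>a bound on single points passes to the averages by the power mean inequality\<close>
  have avg: "(\<integral>\<^sup>+\<omega>. ennreal (((\<Sum>i=1..n. W i \<omega>) / real n) ^ q) \<partial>M) \<le> ennreal (b + a * C)"
    if n: "1 \<le> n" and W: "\<And>i \<omega>. i \<in> {1..n} \<Longrightarrow> 0 \<le> W i \<omega> \<and> W i \<omega> ^ q \<le> b + a * score \<xi> n i \<omega> powr p" and ab: "0 \<le> a" "0 \<le> b"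
    for n W a b
  proof -
    have le: "((\<Sum>i=1..n. W i \<omega>) / real n) ^ q \<le> (\<Sum>i=1..n. b + a * score \<xi> n i \<omega> powr p) / real n" for \<omega>
    proof -
      have "((\<Sum>i=1..n. W i \<omega>) / real n) ^ q \<le> (\<Sum>i=1..n. W i \<omega> ^ q) / real n" by (rule power_mean[OF q n])
      also have "\<dots> \<le> (\<Sum>i=1..n. b + a * score \<xi> n i \<omega> powr p) / real n"
        using W by (intro divide_right_mono sum_mono) auto
      finally show ?thesis .
    qed
    have "(\<integral>\<^sup>+\<omega>. ennreal (((\<Sum>i=1..n. W i \<omega>) / real n) ^ q) \<partial>M) \<le>
        (\<integral>\<^sup>+\<omega>. ennreal (1 / real n) * (\<Sum>i=1..n. ennreal b + ennreal a * ennreal (score \<xi> n i \<omega> powr p)) \<partial>M)"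
    proof (intro nn_integral_mono)
      fix \<omega>
      have "(\<Sum>i=1..n. ennreal b + ennreal a * ennreal (score \<xi> n i \<omega> powr p)) = (\<Sum>i=1..n. ennreal (b + a * score \<xi> n i \<omega> powr p))"
        using ab by (simp add: ennreal_mult)
      also have "\<dots> = ennreal (\<Sum>i=1..n. b + a * score \<xi> n i \<omega> powr p)"
        using ab by (intro sum_ennreal) simp
      finally have "ennreal (1 / real n) * (\<Sum>i=1..n. ennreal b + ennreal a * ennreal (score \<xi> n i \<omega> powr p)) =
          ennreal ((\<Sum>i=1..n. b + a * score \<xi> n i \<omega> powr p) / real n)"
        using ab by (simp add: ennreal_mult[symmetric] sum_nonneg)
      then show "ennreal (((\<Sum>i=1..n. W i \<omega>) / real n) ^ q) \<le>
          ennreal (1 / real n) * (\<Sum>i=1..n. ennreal b + ennreal a * ennreal (score \<xi> n i \<omega> powr p))"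
        using ennreal_leI[OF le[of \<omega>]] by (simp only:)
    qed
    also have "\<dots> = ennreal (1 / real n) * (\<Sum>i=1..n. ennreal b + ennreal a * (\<integral>\<^sup>+\<omega>. ennreal (score \<xi> n i \<omega> powr p) \<partial>M))"
      using pm by (subst nn_integral_cmult, simp, subst nn_integral_sum)
        (auto simp: nn_integral_add nn_integral_cmult emeasure_space_1 intro!: sum.cong)
    also have "\<dots> \<le> ennreal (1 / real n) * (\<Sum>i=1..n. ennreal b + ennreal a * ennreal C)"
      by (intro mult_left_mono sum_mono add_left_mono moment) auto
    also have "\<dots> = ennreal (1 / real n) * ennreal (real n * (b + a * C))"
      using ab C0 by (simp add: ennreal_mult[symmetric] ennreal_plus[symmetric] ennreal_of_nat_eq_real_of_nat del: ennreal_plus)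
    also have "\<dots> = ennreal (b + a * C)"
      using n ab C0 by (simp add: ennreal_mult[symmetric])
    finally show ?thesis .
  qed
  have Aq: "(\<integral>\<^sup>+\<omega>. ennreal (A n \<omega> ^ q) \<partial>M) \<le> ennreal (1 + 1 * C)" if "1 \<le> n" for n
    unfolding A_def by (rule avg[OF that]) (use score_nonneg power_le_powr[OF score_nonneg p] in auto)
  \<comment> \<open>the truncated limits are bounded by the moments\<close>
  let ?K = "\<lambda>k. real (Suc k)"
  have K0: "0 < ?K k" for k by simp
  have tlim_le: "?K k * truncated_limit (?K k) \<le> 1 + C" for k
  proof (rule LIMSEQ_le_const2)
    show "(\<lambda>n. ?K k * expectation (score (truncated (?K k) \<xi>) n 1)) \<longlonglongrightarrow> ?K k * truncated_limit (?K k)"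
      by (intro tendsto_intros truncated_lln(1) K0)
    show "\<exists>n0. \<forall>n\<ge>n0. ?K k * expectation (score (truncated (?K k) \<xi>) n 1) \<le> 1 + C"
    proof (intro exI[of _ 1] allI impI)
      fix n :: nat assume n: "1 \<le> n"
      then have n1: "1 \<in> {1..n}" by simp
      have p1: "real 1 < p" using p q1 by linarith
      have b: "0 \<le> score (truncated (?K k) \<xi>) n 1 \<omega> \<and> score (truncated (?K k) \<xi>) n 1 \<omega> \<le> 1" for \<omega>
        using score_01[OF L truncated_measurable(1)[OF xi_measurable] truncated_translation_invariant[OF xi_translation]
            truncated_01[OF xi_nonneg K0] n1] by blast
      have i: "integrable M (score (truncated (?K k) \<xi>) n 1)"
        using score_measurable[OF truncated_measurable(1)[OF xi_measurable] truncated_translation_invariant[OF xi_translation] n1] b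
        by (intro expectation_01(1)) auto
      have "ennreal (?K k * expectation (score (truncated (?K k) \<xi>) n 1)) = (\<integral>\<^sup>+\<omega>. ennreal (?K k * score (truncated (?K k) \<xi>) n 1 \<omega>) \<partial>M)"
        using i b by (subst nn_integral_eq_integral) auto
      also have "\<dots> \<le> (\<integral>\<^sup>+\<omega>. 1 + ennreal (score \<xi> n 1 \<omega> powr p) \<partial>M)"
      proof (rule nn_integral_mono)
        fix \<omega>
        have "min (?K k) (score \<xi> n 1 \<omega>) \<le> 1 + score \<xi> n 1 \<omega> powr p"
          using power_le_powr[OF score_nonneg p1, of n 1 \<omega>] by simp
        then have "ennreal (min (?K k) (score \<xi> n 1 \<omega>)) \<le> ennreal (1 + score \<xi> n 1 \<omega> powr p)" by (rule ennreal_leI)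
        also have "\<dots> = 1 + ennreal (score \<xi> n 1 \<omega> powr p)" by simp
        finally show "ennreal (?K k * score (truncated (?K k) \<xi>) n 1 \<omega>) \<le> 1 + ennreal (score \<xi> n 1 \<omega> powr p)"
          unfolding score_truncated[OF K0] .
      qed
      also have "\<dots> = 1 + (\<integral>\<^sup>+\<omega>. ennreal (score \<xi> n 1 \<omega> powr p) \<partial>M)"
        using pm[OF n1] by (subst nn_integral_add) (auto simp: emeasure_space_1)
      also have "\<dots> \<le> 1 + ennreal C" by (intro add_left_mono moment n1)
      also have "\<dots> = ennreal (1 + C)" using C0 by simp
      finally show "?K k * expectation (score (truncated (?K k) \<xi>) n 1) \<le> 1 + C"
        using C0 by (subst (asm) ennreal_le_iff) auto
    qed
  qed
  have "limit_mean \<xi> N P f \<le> ennreal (1 + C)"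
    by (rule LIMSEQ_le_const2[OF truncated_limits_tendsto_limit_mean]) (use tlim_le in \<open>auto intro!: exI[of _ 0] ennreal_leI simp del: of_nat_Suc\<close>)
  then have fin: "limit_mean \<xi> N P f < \<infinity>" by (rule order_le_less_trans) simp
  define \<mu> where "\<mu> = enn2real (limit_mean \<xi> N P f)"
  have \<mu>: "limit_mean \<xi> N P f = ennreal \<mu>" "0 \<le> \<mu>" using fin by (auto simp: \<mu>_def)
  have tl0: "0 \<le> truncated_limit (?K k)" for k
    unfolding truncated_limit_def using truncated_mean_01[of _ "?K k"]
    by (intro integral_nonneg_AE AE_I2) (auto simp: indicator_def)
  have lim\<mu>: "(\<lambda>k. ?K k * truncated_limit (?K k)) \<longlonglongrightarrow> \<mu>"
    using truncated_limits_tendsto_limit_mean tl0 \<mu> by (simp add: tendsto_ennreal_iff del: of_nat_Suc)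
  define AK where "AK k n \<omega> = (\<Sum>i=1..n. min (?K k) (score \<xi> n i \<omega>)) / real n" for k n \<omega>
  have AKm[measurable]: "AK k n \<in> borel_measurable M" for k n
    unfolding AK_def[abs_def] using Vm by (intro borel_measurable_divide borel_measurable_sum borel_measurable_min) auto
  have excess: "(\<integral>\<^sup>+\<omega>. ennreal (\<bar>A n \<omega> - AK k n \<omega>\<bar> ^ q) \<partial>M) \<le> ennreal (?K k powr (real q - p) * C)" if n: "1 \<le> n" for n k
  proof -
    have "\<bar>A n \<omega> - AK k n \<omega>\<bar> = (\<Sum>i=1..n. score \<xi> n i \<omega> - min (?K k) (score \<xi> n i \<omega>)) / real n" for \<omega>
    proof -
      have "A n \<omega> - AK k n \<omega> = (\<Sum>i=1..n. score \<xi> n i \<omega> - min (?K k) (score \<xi> n i \<omega>)) / real n"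
        by (simp add: A_def AK_def sum_subtractf diff_divide_distrib)
      moreover have "0 \<le> (\<Sum>i=1..n. score \<xi> n i \<omega> - min (?K k) (score \<xi> n i \<omega>)) / real n"
        by (intro divide_nonneg_nonneg sum_nonneg) auto
      ultimately show ?thesis by (simp only: abs_of_nonneg)
    qed
    moreover have "(\<integral>\<^sup>+\<omega>. ennreal (((\<Sum>i=1..n. score \<xi> n i \<omega> - min (?K k) (score \<xi> n i \<omega>)) / real n) ^ q) \<partial>M) \<le>
        ennreal (0 + ?K k powr (real q - p) * C)"
      using excess_power_le[OF score_nonneg K0 p q1]
      by (intro avg[OF n]) (auto simp: mult.commute simp del: of_nat_Suc)
    ultimately show ?thesis by simp
  qed
  have bounded: "(\<lambda>n. \<integral>\<^sup>+\<omega>. ennreal (\<bar>AK k n \<omega> - ?K k * truncated_limit (?K k)\<bar> ^ q) \<partial>M) \<longlonglongrightarrow> 0" for k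
  proof -
    let ?Z = "\<lambda>n \<omega>. AK k n \<omega> - ?K k * truncated_limit (?K k)"
    let ?T = "\<lambda>n \<omega>. (\<Sum>i=1..n. score (truncated (?K k) \<xi>) n i \<omega>) / real n - truncated_limit (?K k)"
    have Z: "?Z n \<omega> = ?K k * ?T n \<omega>" for n \<omega>
    proof -
      have "AK k n \<omega> = ?K k * ((\<Sum>i=1..n. score (truncated (?K k) \<xi>) n i \<omega>) / real n)"
        unfolding AK_def score_truncated[OF K0, symmetric] by (simp only: sum_distrib_left[symmetric] times_divide_eq_right)
      then show ?thesis by (simp only: right_diff_distrib)
    qed
    have AKb: "\<bar>AK k n \<omega>\<bar> \<le> ?K k" for n \<omega>
    proof (cases "n = 0")
      case False
      have "(\<Sum>i=1..n. min (?K k) (score \<xi> n i \<omega>)) \<le> (\<Sum>i=1..n. ?K k)" by (intro sum_mono) auto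
      then have "AK k n \<omega> \<le> ?K k" using False by (simp add: AK_def divide_simps mult.commute)
      moreover have "0 \<le> AK k n \<omega>" unfolding AK_def using score_nonneg by (intro divide_nonneg_nonneg sum_nonneg) auto
      ultimately show ?thesis by simp
    qed (simp add: AK_def)
    have Zb: "\<bar>?Z n \<omega>\<bar> \<le> ?K k + ?K k * truncated_limit (?K k)" for n \<omega>
    proof -
      have "0 \<le> ?K k * truncated_limit (?K k)" using tl0 by (intro mult_nonneg_nonneg) auto
      then show ?thesis using AKb[of n \<omega>] by linarith
    qed
    have Zi: "integrable M (\<lambda>\<omega>. \<bar>?Z n \<omega>\<bar> ^ r)" for n r
    proof (rule integrable_const_bound[where B="(?K k + ?K k * truncated_limit (?K k)) ^ r"])
      have "\<bar>?Z n \<omega>\<bar> ^ r \<le> (?K k + ?K k * truncated_limit (?K k)) ^ r" for \<omega>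
        using Zb by (intro power_mono) auto
      then show "AE \<omega> in M. norm (\<bar>?Z n \<omega>\<bar> ^ r) \<le> (?K k + ?K k * truncated_limit (?K k)) ^ r"
        by (intro AE_I2) (simp only: real_norm_def abs_of_nonneg zero_le_power abs_ge_zero)
    qed measurable
    have "(\<lambda>n. (?K k)\<^sup>2 * expectation (\<lambda>\<omega>. (?T n \<omega>)\<^sup>2)) \<longlonglongrightarrow> (?K k)\<^sup>2 * 0"
      by (intro tendsto_mult tendsto_const truncated_lln(2) K0)
    then have sq: "(\<lambda>n. expectation (\<lambda>\<omega>. \<bar>?Z n \<omega>\<bar>\<^sup>2)) \<longlonglongrightarrow> 0"
      unfolding Z by (simp add: power_mult_distrib abs_mult del: of_nat_Suc)
    have "(\<lambda>n. expectation (\<lambda>\<omega>. \<bar>?Z n \<omega>\<bar> ^ q)) \<longlonglongrightarrow> 0"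
    proof (cases "q = 2")
      case False
      then have q': "q = 1" using q by simp
      have sqrt0: "(\<lambda>n. sqrt (expectation (\<lambda>\<omega>. \<bar>?Z n \<omega>\<bar>\<^sup>2))) \<longlonglongrightarrow> 0"
        using tendsto_real_sqrt[OF sq] by simp
      have "norm (expectation (\<lambda>\<omega>. \<bar>?Z n \<omega>\<bar> ^ q)) \<le> sqrt (expectation (\<lambda>\<omega>. \<bar>?Z n \<omega>\<bar>\<^sup>2))" for n
      proof -
        have "(expectation (\<lambda>\<omega>. \<bar>?Z n \<omega>\<bar>))\<^sup>2 \<le> expectation (\<lambda>\<omega>. \<bar>?Z n \<omega>\<bar>\<^sup>2)"
          using variance_positive[of "\<lambda>\<omega>. \<bar>?Z n \<omega>\<bar>"]
            variance_eq[OF Zi[of n 1, unfolded power_one_right] Zi[of n 2]] by linarith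
        then have "expectation (\<lambda>\<omega>. \<bar>?Z n \<omega>\<bar>) \<le> sqrt (expectation (\<lambda>\<omega>. \<bar>?Z n \<omega>\<bar>\<^sup>2))" by (rule real_le_rsqrt)
        then show ?thesis by (simp add: q')
      qed
      then show ?thesis by (intro Lim_null_comparison[OF always_eventually[OF allI] sqrt0])
    qed (use sq in simp)
    then have "(\<lambda>n. ennreal (expectation (\<lambda>\<omega>. \<bar>?Z n \<omega>\<bar> ^ q))) \<longlonglongrightarrow> ennreal 0" by (rule tendsto_ennrealI)
    moreover have "(\<integral>\<^sup>+\<omega>. ennreal (\<bar>?Z n \<omega>\<bar> ^ q) \<partial>M) = ennreal (expectation (\<lambda>\<omega>. \<bar>?Z n \<omega>\<bar> ^ q))" for n
      by (rule nn_integral_eq_integral[OF Zi]) simp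
    ultimately show ?thesis by simp
  qed
  have main: "(\<lambda>n. \<integral>\<^sup>+\<omega>. ennreal (\<bar>A n \<omega> - \<mu>\<bar> ^ q) \<partial>M) \<longlonglongrightarrow> 0"
  proof (rule order_tendstoI)
    fix e :: ennreal assume "0 < e"
    then obtain r where r: "0 < r" "ennreal r < e"
      by (metis ennreal_less_zero_iff dense ennreal_cases less_top_ennreal order_less_trans less_imp_neq top.not_eq_extremum)
    define d where "d = r / (3 * 3 ^ q)"
    have d: "0 < d" using r by (simp add: d_def)
    have l1: "(\<lambda>k. ?K k powr (real q - p) * C) \<longlonglongrightarrow> 0"
    proof -
      have "(\<lambda>k. ?K k powr (real q - p)) \<longlonglongrightarrow> 0"
      proof (rule tendsto_neg_powr)
        show "filterlim ?K at_top sequentially"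
          by (rule filterlim_compose[OF filterlim_real_sequentially filterlim_Suc])
      qed (use p in simp)
      then show ?thesis by (rule tendsto_mult_left_zero)
    qed
    have l2: "(\<lambda>k. \<bar>?K k * truncated_limit (?K k) - \<mu>\<bar> ^ q) \<longlonglongrightarrow> 0"
    proof -
      have "(\<lambda>k. \<bar>?K k * truncated_limit (?K k) - \<mu>\<bar> ^ q) \<longlonglongrightarrow> \<bar>\<mu> - \<mu>\<bar> ^ q"
        by (intro tendsto_intros lim\<mu>)
      then show ?thesis using q1 by (simp add: power_0_left del: of_nat_Suc)
    qed
    have "\<forall>\<^sub>F k in sequentially. ?K k powr (real q - p) * C < d \<and> \<bar>?K k * truncated_limit (?K k) - \<mu>\<bar> ^ q < d"
      using d by (intro eventually_conj order_tendstoD(2)[OF l1] order_tendstoD(2)[OF l2])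
    then obtain k where k: "?K k powr (real q - p) * C < d" "\<bar>?K k * truncated_limit (?K k) - \<mu>\<bar> ^ q < d"
      by (auto dest: eventually_happens)
    have "\<forall>\<^sub>F n in sequentially. (\<integral>\<^sup>+\<omega>. ennreal (\<bar>AK k n \<omega> - ?K k * truncated_limit (?K k)\<bar> ^ q) \<partial>M) < ennreal d"
      using d by (intro order_tendstoD(2)[OF bounded]) simp
    then show "\<forall>\<^sub>F n in sequentially. (\<integral>\<^sup>+\<omega>. ennreal (\<bar>A n \<omega> - \<mu>\<bar> ^ q) \<partial>M) < e"
      using eventually_ge_at_top[of 1]
    proof eventually_elim
      case (elim n)
      let ?b = "?K k * truncated_limit (?K k)"
      have "(\<integral>\<^sup>+\<omega>. ennreal (\<bar>A n \<omega> - \<mu>\<bar> ^ q) \<partial>M) \<le>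
          (\<integral>\<^sup>+\<omega>. ennreal (3 ^ q) * (ennreal (\<bar>A n \<omega> - AK k n \<omega>\<bar> ^ q) + ennreal (\<bar>AK k n \<omega> - ?b\<bar> ^ q) + ennreal (\<bar>?b - \<mu>\<bar> ^ q)) \<partial>M)"
      proof (rule nn_integral_mono)
        fix \<omega>
        have "\<bar>A n \<omega> - \<mu>\<bar> ^ q \<le> 3 ^ q * (\<bar>A n \<omega> - AK k n \<omega>\<bar> ^ q + \<bar>AK k n \<omega> - ?b\<bar> ^ q + \<bar>?b - \<mu>\<bar> ^ q)"
          using power_add3_le[of "A n \<omega> - AK k n \<omega>" "AK k n \<omega> - ?b" "?b - \<mu>" q] by simp
        then show "ennreal (\<bar>A n \<omega> - \<mu>\<bar> ^ q) \<le>
          ennreal (3 ^ q) * (ennreal (\<bar>A n \<omega> - AK k n \<omega>\<bar> ^ q) + ennreal (\<bar>AK k n \<omega> - ?b\<bar> ^ q) + ennreal (\<bar>?b - \<mu>\<bar> ^ q))"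
          by (simp add: ennreal_plus[symmetric] ennreal_mult[symmetric] ennreal_leI del: ennreal_plus of_nat_Suc)
      qed
      also have "\<dots> = ennreal (3 ^ q) * ((\<integral>\<^sup>+\<omega>. ennreal (\<bar>A n \<omega> - AK k n \<omega>\<bar> ^ q) \<partial>M) +
          (\<integral>\<^sup>+\<omega>. ennreal (\<bar>AK k n \<omega> - ?b\<bar> ^ q) \<partial>M) + ennreal (\<bar>?b - \<mu>\<bar> ^ q))"
        by (simp add: nn_integral_cmult nn_integral_add emeasure_space_1 del: of_nat_Suc)
      also have "\<dots> \<le> ennreal (3 ^ q) * (ennreal d + ennreal d + ennreal d)"
      proof (intro mult_left_mono add_mono)
        show "(\<integral>\<^sup>+\<omega>. ennreal (\<bar>A n \<omega> - AK k n \<omega>\<bar> ^ q) \<partial>M) \<le> ennreal d"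
          using excess[of n k] elim(2) k(1) by (meson ennreal_leI less_imp_le order_trans)
        show "(\<integral>\<^sup>+\<omega>. ennreal (\<bar>AK k n \<omega> - ?b\<bar> ^ q) \<partial>M) \<le> ennreal d" using elim(1) by (rule less_imp_le)
        show "ennreal (\<bar>?b - \<mu>\<bar> ^ q) \<le> ennreal d" using k(2) by (intro ennreal_leI less_imp_le)
      qed simp
      also have "\<dots> = ennreal r"
        using d by (simp add: ennreal_plus[symmetric] ennreal_mult[symmetric] d_def del: ennreal_plus)
      finally show ?case using r(2) by (rule order_le_less_trans)
    qed
  qed simp
  let ?Y = "\<lambda>n \<omega>. inverse (real n) * total_functional (rescaled \<xi> n) (sample_set X n \<omega>)"
  have Ym: "?Y n \<in> borel_measurable M" for n
    by (intro borel_measurable_times borel_measurable_const total_functional_measurable xi_measurable xi_translation)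
  have YA: "AE \<omega> in M. ?Y n \<omega> = A n \<omega>" for n
    using AE_total_functional[of \<xi> n] by eventually_elim (simp add: A_def divide_inverse mult.commute)
  have Yi: "integrable M (\<lambda>\<omega>. \<bar>?Y n \<omega>\<bar> ^ q)" for n
  proof (cases "1 \<le> n")
    case True
    have "integrable M (\<lambda>\<omega>. A n \<omega> ^ q)"
      using Aq[OF True] A0[of n] by (intro integrableI_bounded) (auto simp: power_abs[symmetric] intro: order_le_less_trans)
    then show ?thesis
    proof (rule integrable_cong_AE_imp)
      show "(\<lambda>\<omega>. \<bar>?Y n \<omega>\<bar> ^ q) \<in> borel_measurable M" using Ym by measurable
      show "AE \<omega> in M. A n \<omega> ^ q = \<bar>?Y n \<omega>\<bar> ^ q" using YA[of n] by eventually_elim (use A0[of n] in simp)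
    qed
  qed (use q1 in \<open>simp add: power_0_left not_le\<close>)
  have "(\<integral>\<omega>. \<bar>?Y n \<omega> - \<mu>\<bar> ^ q \<partial>M) = enn2real (\<integral>\<^sup>+\<omega>. ennreal (\<bar>A n \<omega> - \<mu>\<bar> ^ q) \<partial>M)" for n
  proof -
    have "(\<integral>\<omega>. \<bar>?Y n \<omega> - \<mu>\<bar> ^ q \<partial>M) = (\<integral>\<omega>. \<bar>A n \<omega> - \<mu>\<bar> ^ q \<partial>M)"
    proof (rule integral_cong_AE)
      show "(\<lambda>\<omega>. \<bar>?Y n \<omega> - \<mu>\<bar> ^ q) \<in> borel_measurable M" using Ym[of n] by measurable
      show "AE \<omega> in M. \<bar>?Y n \<omega> - \<mu>\<bar> ^ q = \<bar>A n \<omega> - \<mu>\<bar> ^ q" using YA[of n] by eventually_elim simp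
    qed measurable
    also have "\<dots> = enn2real (\<integral>\<^sup>+\<omega>. ennreal (\<bar>A n \<omega> - \<mu>\<bar> ^ q) \<partial>M)"
      by (rule integral_eq_nn_integral) auto
    finally show ?thesis .
  qed
  moreover have "(\<lambda>n. enn2real (\<integral>\<^sup>+\<omega>. ennreal (\<bar>A n \<omega> - \<mu>\<bar> ^ q) \<partial>M)) \<longlonglongrightarrow> 0"
    by (rule tendsto_enn2real) (use main in simp_all)
  ultimately have "(\<lambda>n. \<integral>\<omega>. \<bar>?Y n \<omega> - \<mu>\<bar> ^ q \<partial>M) \<longlonglongrightarrow> 0" by simp
  then have "converges_in_Lq M q ?Y (\<lambda>_. \<mu>)"
    unfolding converges_in_Lq_def using Ym Yi by simp
  with fin show ?thesis unfolding \<mu>_def by blast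
qed

end

theorem theorem2p1:
  fixes M :: "'w measure"
    and X :: "nat \<Rightarrow> 'w \<Rightarrow> 'a::euclidean_space"
    and f :: "'a \<Rightarrow> real"
    and \<xi> :: "'a \<Rightarrow> 'a set \<Rightarrow> real"
    and N :: "real \<Rightarrow> 'v measure"
    and P :: "real \<Rightarrow> 'v \<Rightarrow> 'a set"
    and q :: nat and p :: real
  assumes q: "q = 1 \<or> q = 2"
    and xi_measurable: "measurable_functional \<xi>"
    and xi_nonneg: "nonneg_functional \<xi>"
    and xi_translation: "translation_invariant \<xi>"
    and M: "prob_space M"
    and f_nonneg: "\<And>x. 0 \<le> f x"
    and X_indep: "prob_space.indep_vars M (\<lambda>_. borel) X {1..}"
    and X_density: "\<And>i. 1 \<le> i \<Longrightarrow> distributed M lborel (X i) (\<lambda>x. ennreal (f x))"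
    and poisson: "\<And>\<tau>. 0 < \<tau> \<Longrightarrow> homogeneous_poisson (N \<tau>) \<tau> (P \<tau>)"
    and stabilizing: "\<And>\<tau>. 0 < \<tau> \<Longrightarrow> AE v in N \<tau>. stabilizes_on \<xi> (P \<tau> v)"
    and p: "real q < p"
    and moments: "(SUP n\<in>{1..}. \<integral>\<^sup>+\<omega>. ennreal (rescaled \<xi> n (X 1 \<omega>) (sample_set X n \<omega>) powr p) \<partial>M) < \<infinity>"
  shows "limit_mean \<xi> N P f < \<infinity> \<and>
    converges_in_Lq M q
      (\<lambda>n \<omega>. inverse (real n) * total_functional (rescaled \<xi> n) (sample_set X n \<omega>))
      (\<lambda>_. enn2real (limit_mean \<xi> N P f))"
proof -
  interpret M: prob_space M by fact
  have D: "distributed M lborel (X 1) (\<lambda>x. ennreal (f x))" by (rule X_density) simp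
  have "(\<lambda>x. enn2real (ennreal (f x))) \<in> borel_measurable lborel"
    using distributed_borel_measurable[OF D] by measurable
  then have fm: "f \<in> borel_measurable lborel" using f_nonneg by simp
  have "(\<integral>\<^sup>+x. ennreal (f x) \<partial>lborel) = emeasure (density lborel (\<lambda>x. ennreal (f x))) UNIV"
    using distributed_borel_measurable[OF D] by (simp add: emeasure_density)
  also have "\<dots> = emeasure (distr M lborel (X 1)) (space (distr M lborel (X 1)))"
    using distributed_distr_eq_density[OF D] by simp
  also have "\<dots> = 1"
    using M.prob_space_distr[OF distributed_measurable[OF D]] by (rule prob_space.emeasure_space_1)
  finally have 1: "(\<integral>\<^sup>+x. ennreal (f x) \<partial>lborel) = 1" .
  then have fi: "integrable lborel f"
    using fm f_nonneg by (intro integrableI_nonneg) auto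
  have "ennreal (\<integral>x. f x \<partial>lborel) = 1"
    using nn_integral_eq_integral[OF fi] f_nonneg 1 by simp
  then have f1: "(\<integral>x. f x \<partial>lborel) = 1" by simp
  interpret stabilizing_setting f M X \<xi> N P
    by unfold_locales (use fi f_nonneg f1 X_indep X_density xi_measurable xi_nonneg xi_translation poisson stabilizing in auto)
  show ?thesis
    using Lq_convergence[OF q p] moments by (simp add: score_def)
qed

end
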